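(* Let $R$ and $C$ be unital rings, let $U$ be an $R,C$-bimodule which is faithful as a left $R$-module, let $Z$ be an injective cogenerator in the category of right $C$-modules, and let $U^*=\mathrm{Hom}_C(U,Z)$. (i) If $U$, as a left $R$-module, is torsionless and $T$-accessible (that is, $TU=U$, where $T$ is the trace ideal of $U$ in $R$), then $$\mathrm{Biend}_R(U)\subseteq\mathrm{Biend}_R(U^* ).$$ (ii) If $U$ is flat as a left $R$-module and $G\subseteq U^*$ is a separating subset for $R$, then $$\mathrm{Biend}_R((U^* )^G)\subseteq\mathrm{Biend}_R(U^{(G)})\ (\cong\mathrm{Biend}_R(U)).$$ Thus, if $U^*$ has a finite separating subset for $R$ (which is always the case if $R$ is right artinian), then $$\mathrm{Biend}_R(U^* )\subseteq\mathrm{Biend}_R(U).$$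
   Context: All rings are unital and $1$ acts as the identity on all modules. A right $C$-module $Z$ is a cogenerator if for every right $C$-module $U$ and every $0\ne u\in U$ there is $f\in\mathrm{Hom}_C(U,Z)$ with $f(u)\neq0$. For an $R,C$-bimodule $U$, $U^*=\mathrm{Hom}_C(U,Z)$ is a right $R$-module via $(\rho r)(u)=\rho(ru)$. For a left or right $R$-module $X$, $\mathrm{Biend}_R(X)=\mathrm{End}_{\mathrm{End}_R(X)}(X)$, i.e. the ring of all additive maps $X\to X$ commuting with every $R$-endomorphism of $X$. For left $R$-modules the multiplication of $\mathrm{Biend}_R(X)$ is composition; for right $R$-modules biendomorphisms act from the right and the multiplication is the reverse of composition. $X^G$ denotes the direct product and $X^{(G)}$ the direct sum of copies of $X$ indexed by $G$; $(U^{(G)})^*$ is identified with $(U^* )^G$. Meaning of the inclusions: since each $c\in C$ acts on $U$ (and on $U^{(G)}$) as an $R$-endomorphism, every biendomorphism $g$ of $U$ (or of $U^{(G)}$) is $C$-linear and has an adjoint $g^*$, $g^*(\rho)=\rho\circ g$, acting on the dual; $g\mapsto g^*$ is an injective ring homomorphism (composition reversed on the dual) and $g$ is identified with $g^*$. Thus "$\mathrm{Biend}_R(U)\subseteq\mathrm{Biend}_R(U^* )$" means that $g^*\in\mathrm{Biend}_R(U^* )$ for all $g\in\mathrm{Biend}_R(U)$; "$\mathrm{Biend}_R(U^* )\subseteq\mathrm{Biend}_R(U)$" means that every element of $\mathrm{Biend}_R(U^* )$ is $g^*$ for some $g\in\mathrm{Biend}_R(U)$; and similarly for $U^{(G)}$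 and $(U^* )^G$. A left $R$-module $U$ is torsionless if for each $0\ne u\in U$ there is $f\in\mathrm{Hom}_R(U,R)$ with $f(u)\ne0$. The trace ideal $T$ of $U$ is the set of all finite sums of elements $f(u)$ with $u\in U$, $f\in\mathrm{Hom}_R(U,R)$; it is a two-sided ideal of $R$. A subset $G\subseteq U^*$ is separating for $R$ if, for $r\in R$, $\rho r=0$ for all $\rho\in G$ implies $r=0$. *)

theory Defs
  imports "HOL-Algebra.Module" "HOL-Algebra.QuotRing" "HOL-Algebra.Free_Abelian_Groups"
begin

section \<open>Modules over possibly noncommutative rings\<close>

text \<open>
  The locale \<open>module\<close> of HOL-Algebra is restricted to commutative rings. Its record type is
  reused here for left modules. As in HOL-Algebra, the multiplicative fields of a module record
  carry no meaning. Homomorphisms are extensional functions, so that equality of homomorphisms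
  is equality in HOL.
\<close>

locale left_module = R?: ring R + M?: abelian_group M
  for R :: "'r ring" (structure) and M :: "('r, 'a, 'm) module_scheme" (structure) +
  assumes lsmult_closed [simp, intro]:
      "\<lbrakk>a \<in> carrier R; x \<in> carrier M\<rbrakk> \<Longrightarrow> a \<odot>\<^bsub>M\<^esub> x \<in> carrier M"
    and lsmult_l_distr:
      "\<lbrakk>a \<in> carrier R; b \<in> carrier R; x \<in> carrier M\<rbrakk> \<Longrightarrow>
        (a \<oplus>\<^bsub>R\<^esub> b) \<odot>\<^bsub>M\<^esub> x = a \<odot>\<^bsub>M\<^esub> x \<oplus>\<^bsub>M\<^esub> b \<odot>\<^bsub>M\<^esub> x"
    and lsmult_r_distr:
      "\<lbrakk>a \<in> carrier R; x \<in> carrier M; y \<in> carrier M\<rbrakk> \<Longrightarrow>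
        a \<odot>\<^bsub>M\<^esub> (x \<oplus>\<^bsub>M\<^esub> y) = a \<odot>\<^bsub>M\<^esub> x \<oplus>\<^bsub>M\<^esub> a \<odot>\<^bsub>M\<^esub> y"
    and lsmult_assoc:
      "\<lbrakk>a \<in> carrier R; b \<in> carrier R; x \<in> carrier M\<rbrakk> \<Longrightarrow>
        (a \<otimes>\<^bsub>R\<^esub> b) \<odot>\<^bsub>M\<^esub> x = a \<odot>\<^bsub>M\<^esub> (b \<odot>\<^bsub>M\<^esub> x)"
    and lsmult_one [simp]: "x \<in> carrier M \<Longrightarrow> \<one>\<^bsub>R\<^esub> \<odot>\<^bsub>M\<^esub> x = x"

record ('c, 'a) rmodule = "'a ring" +
  rsmult :: "['a, 'c] \<Rightarrow> 'a" (infixl \<open>\<cdot>\<index>\<close> 70)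

locale right_module = C?: ring C + M?: abelian_group M
  for C :: "'c ring" (structure) and M :: "('c, 'a) rmodule" (structure) +
  assumes rsmult_closed [simp, intro]:
      "\<lbrakk>x \<in> carrier M; c \<in> carrier C\<rbrakk> \<Longrightarrow> x \<cdot>\<^bsub>M\<^esub> c \<in> carrier M"
    and rsmult_r_distr:
      "\<lbrakk>x \<in> carrier M; c \<in> carrier C; d \<in> carrier C\<rbrakk> \<Longrightarrow>
        x \<cdot>\<^bsub>M\<^esub> (c \<oplus>\<^bsub>C\<^esub> d) = x \<cdot>\<^bsub>M\<^esub> c \<oplus>\<^bsub>M\<^esub> x \<cdot>\<^bsub>M\<^esub> d"
    and rsmult_l_distr:
      "\<lbrakk>x \<in> carrier M; y \<in> carrier M; c \<in> carrier C\<rbrakk> \<Longrightarrow>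
        (x \<oplus>\<^bsub>M\<^esub> y) \<cdot>\<^bsub>M\<^esub> c = x \<cdot>\<^bsub>M\<^esub> c \<oplus>\<^bsub>M\<^esub> y \<cdot>\<^bsub>M\<^esub> c"
    and rsmult_assoc:
      "\<lbrakk>x \<in> carrier M; c \<in> carrier C; d \<in> carrier C\<rbrakk> \<Longrightarrow>
        x \<cdot>\<^bsub>M\<^esub> (c \<otimes>\<^bsub>C\<^esub> d) = (x \<cdot>\<^bsub>M\<^esub> c) \<cdot>\<^bsub>M\<^esub> d"
    and rsmult_one [simp]: "x \<in> carrier M \<Longrightarrow> x \<cdot>\<^bsub>M\<^esub> \<one>\<^bsub>C\<^esub> = x"

record ('r, 'c, 'a) bimodule = "('r, 'a) module" +
  bi_rsmult :: "['a, 'c] \<Rightarrow> 'a"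

definition right_part :: "('r, 'c, 'a) bimodule \<Rightarrow> ('c, 'a) rmodule" where
  "right_part U = \<lparr>carrier = carrier U, monoid.mult = monoid.mult U, one = one U,
     ring.zero = ring.zero U, ring.add = ring.add U, rsmult = bi_rsmult U\<rparr>"

definition is_bimodule :: "'r ring \<Rightarrow> 'c ring \<Rightarrow> ('r, 'c, 'a) bimodule \<Rightarrow> bool" where
  "is_bimodule R C U \<longleftrightarrow> left_module R U \<and> right_module C (right_part U) \<and>
     (\<forall>r\<in>carrier R. \<forall>u\<in>carrier U. \<forall>c\<in>carrier C.
        bi_rsmult U (r \<odot>\<^bsub>U\<^esub> u) c = r \<odot>\<^bsub>U\<^esub> bi_rsmult U u c)"

definition left_hom ::
  "'r ring \<Rightarrow> ('r, 'a, 'm) module_scheme \<Rightarrow> ('r, 'b, 'n) module_scheme \<Rightarrow> ('a \<Rightarrow> 'b) set" where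
  "left_hom R M N = {f \<in> hom (add_monoid M) (add_monoid N) \<inter> extensional (carrier M).
     \<forall>r\<in>carrier R. \<forall>x\<in>carrier M. f (r \<odot>\<^bsub>M\<^esub> x) = r \<odot>\<^bsub>N\<^esub> f x}"

definition right_hom ::
  "'c ring \<Rightarrow> ('c, 'a) rmodule \<Rightarrow> ('c, 'b) rmodule \<Rightarrow> ('a \<Rightarrow> 'b) set" where
  "right_hom C M N = {f \<in> hom (add_monoid M) (add_monoid N) \<inter> extensional (carrier M).
     \<forall>x\<in>carrier M. \<forall>c\<in>carrier C. f (x \<cdot>\<^bsub>M\<^esub> c) = f x \<cdot>\<^bsub>N\<^esub> c}"

definition regular_left :: "'r ring \<Rightarrow> ('r, 'r) module" where
  "regular_left R = \<lparr>carrier = carrier R, monoid.mult = monoid.mult R, one = one R,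
     ring.zero = ring.zero R, ring.add = ring.add R, smult = monoid.mult R\<rparr>"

definition faithful_left :: "'r ring \<Rightarrow> ('r, 'a, 'm) module_scheme \<Rightarrow> bool" where
  "faithful_left R M \<longleftrightarrow>
     (\<forall>r\<in>carrier R. (\<forall>x\<in>carrier M. r \<odot>\<^bsub>M\<^esub> x = \<zero>\<^bsub>M\<^esub>) \<longrightarrow> r = \<zero>\<^bsub>R\<^esub>)"


section \<open>Torsionless modules and the trace ideal\<close>

definition torsionless :: "'r ring \<Rightarrow> ('r, 'a, 'm) module_scheme \<Rightarrow> bool" where
  "torsionless R M \<longleftrightarrow>
     (\<forall>x\<in>carrier M. x \<noteq> \<zero>\<^bsub>M\<^esub> \<longrightarrow> (\<exists>f\<in>left_hom R M (regular_left R). f x \<noteq> \<zero>\<^bsub>R\<^esub>))"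

definition finite_sums :: "('a, 'm) ring_scheme \<Rightarrow> 'a set \<Rightarrow> 'a set" where
  "finite_sums M S = {finsum M s {..<n} | (n::nat) s. s \<in> {..<n} \<rightarrow> S}"

definition trace_ideal :: "'r ring \<Rightarrow> ('r, 'a, 'm) module_scheme \<Rightarrow> 'r set" where
  "trace_ideal R M =
     finite_sums R {f u | f u. f \<in> left_hom R M (regular_left R) \<and> u \<in> carrier M}"

definition trace_accessible :: "'r ring \<Rightarrow> ('r, 'a, 'm) module_scheme \<Rightarrow> bool" where
  "trace_accessible R M \<longleftrightarrow>
     finite_sums M {t \<odot>\<^bsub>M\<^esub> u | t u. t \<in> trace_ideal R M \<and> u \<in> carrier M} = carrier M"


section \<open>Injective modules and cogenerators\<close>

text \<open>
  HOL cannot quantify over types inside a formula, so the category of right modules has to be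
  represented by the modules whose carrier is a set of elements of some type \<open>'m\<close>, the universe
  of the test modules. A smaller universe gives a weaker condition on \<open>Z\<close>. For a ring with
  elements of type \<open>'c\<close> the universe \<open>'c set\<close> contains a copy of the ring, of its right
  ideals and all cyclic modules (whose elements are cosets of right ideals); over this
  universe the conjunction of both properties already implies the same over every universe,
  see \<open>injective_module_universe\<close> and \<open>cogenerator_universe\<close> at the end of this theory.
\<close>

definition injective_module :: "'m itself \<Rightarrow> 'c ring \<Rightarrow> ('c, 'z) rmodule \<Rightarrow> bool" where
  "injective_module _ C Z \<longleftrightarrow> right_module C Z \<and>
     (\<forall>(A :: ('c, 'm) rmodule) (B :: ('c, 'm) rmodule). right_module C A \<longrightarrow> right_module C B \<longrightarrow>
        (\<forall>i\<in>right_hom C A B. inj_on i (carrier A) \<longrightarrow>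
           (\<forall>f\<in>right_hom C A Z. \<exists>h\<in>right_hom C B Z. \<forall>x\<in>carrier A. h (i x) = f x)))"

definition cogenerator :: "'m itself \<Rightarrow> 'c ring \<Rightarrow> ('c, 'z) rmodule \<Rightarrow> bool" where
  "cogenerator _ C Z \<longleftrightarrow> right_module C Z \<and>
     (\<forall>(Y :: ('c, 'm) rmodule). right_module C Y \<longrightarrow>
        (\<forall>x\<in>carrier Y. x \<noteq> \<zero>\<^bsub>Y\<^esub> \<longrightarrow> (\<exists>f\<in>right_hom C Y Z. f x \<noteq> \<zero>\<^bsub>Z\<^esub>)))"


section \<open>Tensor products and flatness\<close>

definition tensor_null ::
  "'r ring \<Rightarrow> ('r, 'a) rmodule \<Rightarrow> ('r, 'u, 'm) module_scheme \<Rightarrow> ('a \<times> 'u \<Rightarrow>\<^sub>0 int) set" where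
  "tensor_null R A M = generate (free_Abelian_group (carrier A \<times> carrier M))
     ({frag_of (a \<oplus>\<^bsub>A\<^esub> b, u) - frag_of (a, u) - frag_of (b, u) | a b u.
         a \<in> carrier A \<and> b \<in> carrier A \<and> u \<in> carrier M} \<union>
      {frag_of (a, u \<oplus>\<^bsub>M\<^esub> v) - frag_of (a, u) - frag_of (a, v) | a u v.
         a \<in> carrier A \<and> u \<in> carrier M \<and> v \<in> carrier M} \<union>
      {frag_of (a \<cdot>\<^bsub>A\<^esub> r, u) - frag_of (a, r \<odot>\<^bsub>M\<^esub> u) | a r u.
         a \<in> carrier A \<and> r \<in> carrier R \<and> u \<in> carrier M})"

definition tensor_product ::
  "'r ring \<Rightarrow> ('r, 'a) rmodule \<Rightarrow> ('r, 'u, 'm) module_scheme \<Rightarrow>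
     ('a \<times> 'u \<Rightarrow>\<^sub>0 int) set monoid" where
  "tensor_product R A M = free_Abelian_group (carrier A \<times> carrier M) Mod tensor_null R A M"

text \<open>The homomorphism \<open>f \<otimes> id\<close> from \<open>A \<otimes> M\<close> to \<open>B \<otimes> M\<close>, on cosets.\<close>

definition tensor_map ::
  "'r ring \<Rightarrow> ('r, 'b) rmodule \<Rightarrow> ('r, 'u, 'm) module_scheme \<Rightarrow> ('a \<Rightarrow> 'b) \<Rightarrow>
     ('a \<times> 'u \<Rightarrow>\<^sub>0 int) set \<Rightarrow> ('b \<times> 'u \<Rightarrow>\<^sub>0 int) set" where
  "tensor_map R B M f K = the_elem ((\<lambda>x. tensor_null R B M
     #>\<^bsub>free_Abelian_group (carrier B \<times> carrier M)\<^esub>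
     frag_extend (\<lambda>(a, u). frag_of (f a, u)) x) ` K)"

text \<open>The universe \<open>'m\<close> of test modules plays the same role as in \<open>injective_module\<close>.
  Again a smaller universe gives a weaker condition, and by the ideal criterion for flatness
  nothing is lost if the universe has room for \<open>R\<close> and its right ideals, as \<open>'r set\<close> has.\<close>

definition flat_module :: "'m itself \<Rightarrow> 'r ring \<Rightarrow> ('r, 'u, 'n) module_scheme \<Rightarrow> bool" where
  "flat_module _ R M \<longleftrightarrow> left_module R M \<and>
     (\<forall>(A :: ('r, 'm) rmodule) (B :: ('r, 'm) rmodule). right_module R A \<longrightarrow> right_module R B \<longrightarrow>
        (\<forall>f\<in>right_hom R A B. inj_on f (carrier A) \<longrightarrow>
           inj_on (tensor_map R B M f) (carrier (tensor_product R A M))))"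


section \<open>Biendomorphism rings\<close>

definition commuting_maps :: "('a, 'm) ring_scheme \<Rightarrow> ('a \<Rightarrow> 'a) set \<Rightarrow> ('a \<Rightarrow> 'a) set" where
  "commuting_maps M E = {g \<in> hom (add_monoid M) (add_monoid M) \<inter> extensional (carrier M).
     \<forall>f\<in>E. compose (carrier M) g f = compose (carrier M) f g}"

definition left_biend :: "'r ring \<Rightarrow> ('r, 'a, 'm) module_scheme \<Rightarrow> ('a \<Rightarrow> 'a) ring" where
  "left_biend R M = \<lparr>carrier = commuting_maps M (left_hom R M M),
     monoid.mult = (\<lambda>g h. compose (carrier M) g h),
     one = (\<lambda>x\<in>carrier M. x),
     ring.zero = (\<lambda>x\<in>carrier M. \<zero>\<^bsub>M\<^esub>),
     ring.add = (\<lambda>g h. \<lambda>x\<in>carrier M. g x \<oplus>\<^bsub>M\<^esub> h x)\<rparr>"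

definition right_biend :: "'r ring \<Rightarrow> ('r, 'a) rmodule \<Rightarrow> ('a \<Rightarrow> 'a) ring" where
  "right_biend R M = \<lparr>carrier = commuting_maps M (right_hom R M M),
     monoid.mult = (\<lambda>g h. compose (carrier M) h g),
     one = (\<lambda>x\<in>carrier M. x),
     ring.zero = (\<lambda>x\<in>carrier M. \<zero>\<^bsub>M\<^esub>),
     ring.add = (\<lambda>g h. \<lambda>x\<in>carrier M. g x \<oplus>\<^bsub>M\<^esub> h x)\<rparr>"


section \<open>Duals, powers and copowers\<close>

definition dual ::
  "'c ring \<Rightarrow> ('c, 'z) rmodule \<Rightarrow> ('r, 'c, 'u) bimodule \<Rightarrow> ('r, 'u \<Rightarrow> 'z) rmodule" where
  "dual C Z U = \<lparr>carrier = right_hom C (right_part U) Z,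
     monoid.mult = undefined, one = undefined,
     ring.zero = (\<lambda>u\<in>carrier U. \<zero>\<^bsub>Z\<^esub>),
     ring.add = (\<lambda>\<rho> \<sigma>. \<lambda>u\<in>carrier U. \<rho> u \<oplus>\<^bsub>Z\<^esub> \<sigma> u),
     rsmult = (\<lambda>\<rho> r. \<lambda>u\<in>carrier U. \<rho> (r \<odot>\<^bsub>U\<^esub> u))\<rparr>"

definition adjoint ::
  "'c ring \<Rightarrow> ('c, 'z) rmodule \<Rightarrow> ('r, 'c, 'u) bimodule \<Rightarrow>
     ('u \<Rightarrow> 'u) \<Rightarrow> (('u \<Rightarrow> 'z) \<Rightarrow> ('u \<Rightarrow> 'z))" where
  "adjoint C Z U g = (\<lambda>\<rho>\<in>carrier (dual C Z U). compose (carrier U) \<rho> g)"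

definition power_module :: "'i set \<Rightarrow> ('r, 'a) rmodule \<Rightarrow> ('r, 'i \<Rightarrow> 'a) rmodule" where
  "power_module G Y = \<lparr>carrier = (\<Pi>\<^sub>E i\<in>G. carrier Y),
     monoid.mult = undefined, one = undefined,
     ring.zero = (\<lambda>i\<in>G. \<zero>\<^bsub>Y\<^esub>),
     ring.add = (\<lambda>x y. \<lambda>i\<in>G. x i \<oplus>\<^bsub>Y\<^esub> y i),
     rsmult = (\<lambda>x r. \<lambda>i\<in>G. x i \<cdot>\<^bsub>Y\<^esub> r)\<rparr>"

definition copower_module :: "'i set \<Rightarrow> ('r, 'c, 'a) bimodule \<Rightarrow> ('r, 'c, 'i \<Rightarrow> 'a) bimodule" where
  "copower_module G U = \<lparr>carrier = {x \<in> \<Pi>\<^sub>E i\<in>G. carrier U. finite {i \<in> G. x i \<noteq> \<zero>\<^bsub>U\<^esub>}},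
     monoid.mult = undefined, one = undefined,
     ring.zero = (\<lambda>i\<in>G. \<zero>\<^bsub>U\<^esub>),
     ring.add = (\<lambda>x y. \<lambda>i\<in>G. x i \<oplus>\<^bsub>U\<^esub> y i),
     smult = (\<lambda>r x. \<lambda>i\<in>G. r \<odot>\<^bsub>U\<^esub> x i),
     bi_rsmult = (\<lambda>x c. \<lambda>i\<in>G. bi_rsmult U (x i) c)\<rparr>"

text \<open>The identification of the power of the dual with the dual of the copower: a family
  \<open>\<rho>\<close> is sent to the map taking \<open>x\<close> to the sum of the \<open>\<rho> i (x i)\<close>. The latter has only
  finitely many nonzero terms, and \<open>gfinprod\<close> is the sum over the support.\<close>

definition copower_pairing ::
  "'i set \<Rightarrow> ('c, 'z) rmodule \<Rightarrow> ('r, 'c, 'u) bimodule \<Rightarrow>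
     ('i \<Rightarrow> 'u \<Rightarrow> 'z) \<Rightarrow> (('i \<Rightarrow> 'u) \<Rightarrow> 'z)" where
  "copower_pairing G Z U \<rho> =
     (\<lambda>x\<in>carrier (copower_module G U). gfinprod (add_monoid Z) (\<lambda>i. \<rho> i (x i)) G)"

definition diagonal_map ::
  "'i set \<Rightarrow> ('r, 'c, 'u) bimodule \<Rightarrow> ('u \<Rightarrow> 'u) \<Rightarrow> (('i \<Rightarrow> 'u) \<Rightarrow> ('i \<Rightarrow> 'u))" where
  "diagonal_map G U g = (\<lambda>x\<in>carrier (copower_module G U). \<lambda>i\<in>G. g (x i))"

definition separating :: "'r ring \<Rightarrow> ('r, 'a) rmodule \<Rightarrow> 'a set \<Rightarrow> bool" where
  "separating R Y G \<longleftrightarrow> G \<subseteq> carrier Y \<and>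
     (\<forall>r\<in>carrier R. (\<forall>\<rho>\<in>G. \<rho> \<cdot>\<^bsub>Y\<^esub> r = \<zero>\<^bsub>Y\<^esub>) \<longrightarrow> r = \<zero>\<^bsub>R\<^esub>)"


section \<open>Right artinian rings\<close>

definition right_ideal :: "'r set \<Rightarrow> 'r ring \<Rightarrow> bool" where
  "right_ideal I R \<longleftrightarrow> additive_subgroup I R \<and>
     (\<forall>a\<in>I. \<forall>r\<in>carrier R. a \<otimes>\<^bsub>R\<^esub> r \<in> I)"

definition right_artinian :: "'r ring \<Rightarrow> bool" where
  "right_artinian R \<longleftrightarrow>
     (\<forall>(I :: nat \<Rightarrow> 'r set). (\<forall>n. right_ideal (I n) R) \<and> (\<forall>n. I (Suc n) \<subseteq> I n) \<longrightarrow>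
        (\<exists>N. \<forall>n\<ge>N. I n = I N))"


section \<open>Independence of the universe\<close>

text \<open>Baer's criterion is used to pass from the universe \<open>'c set\<close> to an arbitrary one.\<close>

lemma (in right_module) rsmult_zero_right: "x \<in> carrier M \<Longrightarrow> x \<cdot>\<^bsub>M\<^esub> \<zero>\<^bsub>C\<^esub> = \<zero>\<^bsub>M\<^esub>"
  by (metis C.add.l_cancel_one' C.zero_closed M.add.l_cancel_one' rsmult_closed rsmult_r_distr)

lemma (in right_module) rsmult_minus_one:
  assumes "x \<in> carrier M" shows "x \<cdot>\<^bsub>M\<^esub> (\<ominus>\<^bsub>C\<^esub> \<one>\<^bsub>C\<^esub>) = \<ominus>\<^bsub>M\<^esub> x"
proof -
  have "x \<cdot>\<^bsub>M\<^esub> (\<ominus>\<^bsub>C\<^esub> \<one>\<^bsub>C\<^esub>) \<oplus>\<^bsub>M\<^esub> x = x \<cdot>\<^bsub>M\<^esub> (\<ominus>\<^bsub>C\<^esub> \<one>\<^bsub>C\<^esub> \<oplus>\<^bsub>C\<^esub> \<one>\<^bsub>C\<^esub>)"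
    using assms rsmult_r_distr[of x "\<ominus>\<^bsub>C\<^esub> \<one>\<^bsub>C\<^esub>" "\<one>\<^bsub>C\<^esub>"] by simp
  also have "\<dots> = \<zero>\<^bsub>M\<^esub>" using assms by (simp add: C.l_neg rsmult_zero_right)
  finally show ?thesis using assms M.minus_equality by (metis C.add.inv_closed C.one_closed rsmult_closed)
qed

lemma right_homI:
  assumes "\<And>x. x \<in> carrier M \<Longrightarrow> f x \<in> carrier N" "f \<in> extensional (carrier M)"
    "\<And>x y. x \<in> carrier M \<Longrightarrow> y \<in> carrier M \<Longrightarrow> f (x \<oplus>\<^bsub>M\<^esub> y) = f x \<oplus>\<^bsub>N\<^esub> f y"
    "\<And>x c. x \<in> carrier M \<Longrightarrow> c \<in> carrier C \<Longrightarrow> f (x \<cdot>\<^bsub>M\<^esub> c) = f x \<cdot>\<^bsub>N\<^esub> c"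
  shows "f \<in> right_hom C M N"
  using assms by (auto simp: right_hom_def hom_def)

lemma right_homD:
  assumes "f \<in> right_hom C M N"
  shows "x \<in> carrier M \<Longrightarrow> f x \<in> carrier N" "f \<in> extensional (carrier M)"
    "x \<in> carrier M \<Longrightarrow> y \<in> carrier M \<Longrightarrow> f (x \<oplus>\<^bsub>M\<^esub> y) = f x \<oplus>\<^bsub>N\<^esub> f y"
    "x \<in> carrier M \<Longrightarrow> c \<in> carrier C \<Longrightarrow> f (x \<cdot>\<^bsub>M\<^esub> c) = f x \<cdot>\<^bsub>N\<^esub> c"
  using assms by (auto simp: right_hom_def hom_def)

lemma injective_moduleD:
  assumes "injective_module TYPE('m) C Z"
    and "right_module C (A :: ('c, 'm) rmodule)" and "right_module C (B :: ('c, 'm) rmodule)"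
    and "i \<in> right_hom C A B" and "inj_on i (carrier A)" and "f \<in> right_hom C A Z"
  shows "\<exists>h\<in>right_hom C B Z. \<forall>x\<in>carrier A. h (i x) = f x"
  using assms(1)[unfolded injective_module_def, THEN conjunct2, rule_format, OF assms(2-)] .

text \<open>Right ideals transported to singletons.\<close>

definition singleton_module :: "'c ring \<Rightarrow> 'c set \<Rightarrow> ('c, 'c set) rmodule" where
  "singleton_module C I = \<lparr>carrier = (\<lambda>a. {a}) ` I, monoid.mult = undefined, one = undefined,
     ring.zero = {\<zero>\<^bsub>C\<^esub>}, ring.add = (\<lambda>A B. {the_elem A \<oplus>\<^bsub>C\<^esub> the_elem B}),
     rsmult = (\<lambda>A c. {the_elem A \<otimes>\<^bsub>C\<^esub> c})\<rparr>"

lemma right_module_singleton: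
  assumes "ring C" "right_ideal I C" shows "right_module C (singleton_module C I)"
proof -
  interpret C: ring C by fact
  interpret I: additive_subgroup I C using assms by (simp add: right_ideal_def)
  have *: "a \<in> I \<Longrightarrow> a \<in> carrier C" for a using I.a_Hcarr by blast
  have m: "a \<in> I \<Longrightarrow> c \<in> carrier C \<Longrightarrow> a \<otimes>\<^bsub>C\<^esub> c \<in> I" for a c
    using assms by (simp add: right_ideal_def)
  have "abelian_group (singleton_module C I)"
  proof (rule abelian_groupI)
    fix x assume "x \<in> carrier (singleton_module C I)"
    then obtain a where a: "a \<in> I" "x = {a}" by (auto simp: singleton_module_def)
    have "\<ominus>\<^bsub>C\<^esub> a \<in> I" "\<ominus>\<^bsub>C\<^esub> a \<oplus>\<^bsub>C\<^esub> a = \<zero>\<^bsub>C\<^esub>" using a * by (auto intro: C.l_neg)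
    with a show "\<exists>y\<in>carrier (singleton_module C I).
        y \<oplus>\<^bsub>singleton_module C I\<^esub> x = \<zero>\<^bsub>singleton_module C I\<^esub>"
      by (auto simp: singleton_module_def)
  qed (auto simp: singleton_module_def * C.a_ac)
  then show ?thesis
    by (intro right_module.intro right_module_axioms.intro assms)
       (auto simp: singleton_module_def * m C.l_distr C.r_distr C.m_assoc)
qed

lemma baer_criterion:
  assumes inj: "injective_module TYPE('c set) (C :: 'c ring) Z" and I: "right_ideal I C"
    and \<phi>: "\<And>a. a \<in> I \<Longrightarrow> \<phi> a \<in> carrier Z"
      "\<And>a b. a \<in> I \<Longrightarrow> b \<in> I \<Longrightarrow> \<phi> (a \<oplus>\<^bsub>C\<^esub> b) = \<phi> a \<oplus>\<^bsub>Z\<^esub> \<phi> b"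
      "\<And>a c. a \<in> I \<Longrightarrow> c \<in> carrier C \<Longrightarrow> \<phi> (a \<otimes>\<^bsub>C\<^esub> c) = \<phi> a \<cdot>\<^bsub>Z\<^esub> c"
  obtains z where "z \<in> carrier Z" "\<And>a. a \<in> I \<Longrightarrow> \<phi> a = z \<cdot>\<^bsub>Z\<^esub> a"
proof -
  interpret Z: right_module C Z using inj by (simp add: injective_module_def)
  interpret I: additive_subgroup I C using I by (simp add: right_ideal_def)
  have IC: "a \<in> I \<Longrightarrow> a \<in> carrier C" for a using I.a_Hcarr by blast
  have m: "a \<in> I \<Longrightarrow> c \<in> carrier C \<Longrightarrow> a \<otimes>\<^bsub>C\<^esub> c \<in> I" for a c
    using I by (simp add: right_ideal_def)
  have unit: "right_ideal (carrier C) C"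
    using Z.C.add.subgroup_self by (simp add: right_ideal_def additive_subgroup_def)
  let ?A = "singleton_module C I" and ?B = "singleton_module C (carrier C)"
  have AB: "right_module C ?A" "right_module C ?B"
    by (rule right_module_singleton[OF Z.C.ring_axioms]; fact)+
  let ?i = "restrict id (carrier ?A)" and ?f = "\<lambda>X\<in>carrier ?A. \<phi> (the_elem X)"
  have i: "?i \<in> right_hom C ?A ?B" "inj_on ?i (carrier ?A)"
    by (intro right_homI; auto simp: singleton_module_def IC m) (auto simp: inj_on_def)
  have "?f \<in> right_hom C ?A Z"
    by (intro right_homI; auto simp: singleton_module_def m \<phi>)
  from injective_moduleD[OF inj AB i this]
  obtain h where h: "h \<in> right_hom C ?B Z" "\<And>x. x \<in> carrier ?A \<Longrightarrow> h (?i x) = ?f x" by blast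
  show thesis
  proof
    show "h {\<one>\<^bsub>C\<^esub>} \<in> carrier Z" using right_homD(1)[OF h(1)] by (simp add: singleton_module_def)
    fix a assume a: "a \<in> I"
    have "\<phi> a = h {a}" using h(2)[of "{a}"] a by (simp add: singleton_module_def)
    also have "\<dots> = h {\<one>\<^bsub>C\<^esub>} \<cdot>\<^bsub>Z\<^esub> a"
      using right_homD(4)[OF h(1), of "{\<one>\<^bsub>C\<^esub>}" a] a IC by (simp add: singleton_module_def)
    finally show "\<phi> a = h {\<one>\<^bsub>C\<^esub>} \<cdot>\<^bsub>Z\<^esub> a" .
  qed
qed

lemma injective_module_universe:
  assumes "injective_module TYPE('c set) (C :: 'c ring) Z"
  shows "injective_module TYPE('m) C Z"
  unfolding injective_module_def
proof (intro conjI allI impI ballI)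
  show rZ: "right_module C Z" using assms by (simp add: injective_module_def)
  fix A B :: "('c, 'm) rmodule" and i f
  assume rA: "right_module C A" and rB: "right_module C B" and i: "i \<in> right_hom C A B"
    and inj: "inj_on i (carrier A)" and f: "f \<in> right_hom C A Z"
  interpret Z: right_module C Z by fact
  interpret A: right_module C A by fact
  interpret B: right_module C B by fact
  define P where "P S \<longleftrightarrow> S \<subseteq> carrier B \<times> carrier Z \<and> (\<forall>x\<in>carrier A. (i x, f x) \<in> S) \<and>
    (\<forall>b z b' z'. (b, z) \<in> S \<longrightarrow> (b', z') \<in> S \<longrightarrow> (b \<oplus>\<^bsub>B\<^esub> b', z \<oplus>\<^bsub>Z\<^esub> z') \<in> S) \<and>
    (\<forall>b z c. (b, z) \<in> S \<longrightarrow> c \<in> carrier C \<longrightarrow> (b \<cdot>\<^bsub>B\<^esub> c, z \<cdot>\<^bsub>Z\<^esub> c) \<in> S) \<and>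
    (\<forall>b z z'. (b, z) \<in> S \<longrightarrow> (b, z') \<in> S \<longrightarrow> z = z')" for S
  have P0: "P ((\<lambda>x. (i x, f x)) ` carrier A)"
    unfolding P_def
  proof (intro conjI allI impI ballI)
    show "z = z'" if "(b, z) \<in> (\<lambda>x. (i x, f x)) ` carrier A" "(b, z') \<in> (\<lambda>x. (i x, f x)) ` carrier A"
      for b z z' using that inj by (auto dest: inj_onD)
    show "(b \<oplus>\<^bsub>B\<^esub> b', z \<oplus>\<^bsub>Z\<^esub> z') \<in> (\<lambda>x. (i x, f x)) ` carrier A"
      if bz: "(b, z) \<in> (\<lambda>x. (i x, f x)) ` carrier A" "(b', z') \<in> (\<lambda>x. (i x, f x)) ` carrier A"
      for b z b' z'
    proof -
      obtain x y where "x \<in> carrier A" "y \<in> carrier A" "b = i x" "z = f x" "b' = i y" "z' = f y"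
        using bz by auto
      then show ?thesis
        by (intro image_eqI[of _ _ "x \<oplus>\<^bsub>A\<^esub> y"]) (auto simp: right_homD(3)[OF i] right_homD(3)[OF f])
    qed
    show "(b \<cdot>\<^bsub>B\<^esub> c, z \<cdot>\<^bsub>Z\<^esub> c) \<in> (\<lambda>x. (i x, f x)) ` carrier A"
      if bz: "(b, z) \<in> (\<lambda>x. (i x, f x)) ` carrier A" "c \<in> carrier C" for b z c
    proof -
      obtain x where "x \<in> carrier A" "b = i x" "z = f x" using bz by auto
      with bz(2) show ?thesis
        by (intro image_eqI[of _ _ "x \<cdot>\<^bsub>A\<^esub> c"]) (auto simp: right_homD(4)[OF i] right_homD(4)[OF f])
    qed
  qed (use right_homD(1)[OF i] right_homD(1)[OF f] in auto)
  have "\<exists>M\<in>{S. P S}. \<forall>X\<in>{S. P S}. M \<subseteq> X \<longrightarrow> X = M"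
  proof (rule subset_Zorn_nonempty)
    show "{S. P S} \<noteq> {}" using P0 by blast
    fix \<C> assume ne: "\<C> \<noteq> {}" and ch: "subset.chain {S. P S} \<C>"
    have PS: "P S" if "S \<in> \<C>" for S using ch that by (auto simp: subset.chain_def)
    note PS' = PS[unfolded P_def]
    note PS1 = PS'[THEN conjunct1] and PS2 = PS'[THEN conjunct2, THEN conjunct1]
      and PS3 = PS'[THEN conjunct2, THEN conjunct2, THEN conjunct1]
      and PS4 = PS'[THEN conjunct2, THEN conjunct2, THEN conjunct2, THEN conjunct1]
      and PS5 = PS'[THEN conjunct2, THEN conjunct2, THEN conjunct2, THEN conjunct2]
    have tot: "S \<subseteq> T \<or> T \<subseteq> S" if "S \<in> \<C>" "T \<in> \<C>" for S T
      using ch that unfolding subset_chain_def by blast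
    have join: "\<exists>S\<in>\<C>. p \<in> S \<and> q \<in> S" if "p \<in> \<Union>\<C>" "q \<in> \<Union>\<C>" for p q
    proof -
      from that obtain S T where ST: "S \<in> \<C>" "p \<in> S" "T \<in> \<C>" "q \<in> T" by blast
      from tot[OF ST(1,3)] show ?thesis using ST by (elim disjE) blast+
    qed
    show "\<Union>\<C> \<in> {S. P S}"
      unfolding mem_Collect_eq P_def
    proof (intro conjI allI impI ballI)
      show "\<Union>\<C> \<subseteq> carrier B \<times> carrier Z" using PS1 by blast
      show "(i x, f x) \<in> \<Union>\<C>" if "x \<in> carrier A" for x using ne PS2 that by blast
      show "(b \<oplus>\<^bsub>B\<^esub> b', z \<oplus>\<^bsub>Z\<^esub> z') \<in> \<Union>\<C>" if "(b, z) \<in> \<Union>\<C>" "(b', z') \<in> \<Union>\<C>" for b z b' z'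
        using join[OF that] PS3 by blast
      show "(b \<cdot>\<^bsub>B\<^esub> c, z \<cdot>\<^bsub>Z\<^esub> c) \<in> \<Union>\<C>" if "(b, z) \<in> \<Union>\<C>" "c \<in> carrier C" for b z c
        using that PS4 by blast
      show "z = z'" if "(b, z) \<in> \<Union>\<C>" "(b, z') \<in> \<Union>\<C>" for b z z'
        using join[OF that] PS5 by blast
    qed
  qed
  then obtain S where S: "P S" and max: "\<And>T. P T \<Longrightarrow> S \<subseteq> T \<Longrightarrow> T = S" by blast
  note S' = S[unfolded P_def]
  note S1 = S'[THEN conjunct1] and S2 = S'[THEN conjunct2, THEN conjunct1]
    and S3 = S'[THEN conjunct2, THEN conjunct2, THEN conjunct1]
    and S4 = S'[THEN conjunct2, THEN conjunct2, THEN conjunct2, THEN conjunct1]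
    and S5 = S'[THEN conjunct2, THEN conjunct2, THEN conjunct2, THEN conjunct2]
  have sub: "b \<in> carrier B" "z \<in> carrier Z" if "(b, z) \<in> S" for b z
    using S1 that by auto
  have ext: "(i x, f x) \<in> S" if "x \<in> carrier A" for x using S2 that by blast
  have add: "(b \<oplus>\<^bsub>B\<^esub> b', z \<oplus>\<^bsub>Z\<^esub> z') \<in> S" if "(b, z) \<in> S" "(b', z') \<in> S" for b z b' z'
    using S3 that by blast
  have smul: "(b \<cdot>\<^bsub>B\<^esub> c, z \<cdot>\<^bsub>Z\<^esub> c) \<in> S" if "(b, z) \<in> S" "c \<in> carrier C" for b z c
    using S4 that by blast
  have sv: "z = z'" if "(b, z) \<in> S" "(b, z') \<in> S" for b z z'
    using S5 that by blast
  have neg: "(\<ominus>\<^bsub>B\<^esub> b, \<ominus>\<^bsub>Z\<^esub> z) \<in> S" if "(b, z) \<in> S" for b z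
    using smul[OF that, of "\<ominus>\<^bsub>C\<^esub> \<one>\<^bsub>C\<^esub>"] sub[OF that]
    by (simp add: B.rsmult_minus_one Z.rsmult_minus_one)
  obtain b0 z0 where bz0: "(b0, z0) \<in> S" using ext[of "\<zero>\<^bsub>A\<^esub>"] by blast
  have zero: "(\<zero>\<^bsub>B\<^esub>, \<zero>\<^bsub>Z\<^esub>) \<in> S"
    using smul[OF bz0, of "\<zero>\<^bsub>C\<^esub>"] sub[OF bz0] by (simp add: B.rsmult_zero_right Z.rsmult_zero_right)
  have total: "\<exists>z. (b, z) \<in> S" if b: "b \<in> carrier B" for b
  proof -
    define I where "I = {c \<in> carrier C. \<exists>z. (b \<cdot>\<^bsub>B\<^esub> c, z) \<in> S}"
    define \<phi> where "\<phi> c = (THE z. (b \<cdot>\<^bsub>B\<^esub> c, z) \<in> S)" for c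
    have \<phi>eq: "\<phi> c = z" if "(b \<cdot>\<^bsub>B\<^esub> c, z) \<in> S" for c z
      unfolding \<phi>_def by (rule the_equality, rule that, rule sv[OF _ that])
    have \<phi>S: "(b \<cdot>\<^bsub>B\<^esub> c, \<phi> c) \<in> S" if "c \<in> I" for c 
    proof -
      from that obtain z where "(b \<cdot>\<^bsub>B\<^esub> c, z) \<in> S" by (auto simp: I_def)
      with \<phi>eq[OF this] show ?thesis by simp
    qed
    have IC: "c \<in> carrier C" if "c \<in> I" for c using that by (simp add: I_def)
    have II: "c \<in> I" if "c \<in> carrier C" "(b \<cdot>\<^bsub>B\<^esub> c, z) \<in> S" for c z
      unfolding I_def using that by blast
    have a1: "(b \<cdot>\<^bsub>B\<^esub> (c \<oplus>\<^bsub>C\<^esub> d), \<phi> c \<oplus>\<^bsub>Z\<^esub> \<phi> d) \<in> S" if "c \<in> I" "d \<in> I" for c d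
      using add[OF \<phi>S \<phi>S, OF that] b that IC by (simp add: B.rsmult_r_distr)
    have a2: "(b \<cdot>\<^bsub>B\<^esub> (c \<otimes>\<^bsub>C\<^esub> d), \<phi> c \<cdot>\<^bsub>Z\<^esub> d) \<in> S" if "c \<in> I" "d \<in> carrier C" for c d
      using smul[OF \<phi>S, OF that] b that IC by (simp add: B.rsmult_assoc)
    have mI: "c \<otimes>\<^bsub>C\<^esub> d \<in> I" if "c \<in> I" "d \<in> carrier C" for c d
      by (rule II[OF _ a2[OF that]]) (use that IC in simp)
    have "subgroup I (add_monoid C)"
    proof (rule Z.C.add.subgroupI)
      show "I \<subseteq> carrier C" by (auto simp: I_def)
      have "\<zero>\<^bsub>C\<^esub> \<in> I" by (rule II) (use zero b in \<open>simp_all add: B.rsmult_zero_right\<close>)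
      then show "I \<noteq> {}" by blast
      show "\<ominus>\<^bsub>C\<^esub> c \<in> I" if "c \<in> I" for c
        using mI[OF that, of "\<ominus>\<^bsub>C\<^esub> \<one>\<^bsub>C\<^esub>"] IC[OF that] by (simp add: Z.C.r_minus)
      show "c \<oplus>\<^bsub>C\<^esub> d \<in> I" if "c \<in> I" "d \<in> I" for c d
        by (rule II[OF _ a1[OF that]]) (use that IC in simp)
    qed
    then have "right_ideal I C" by (simp add: right_ideal_def additive_subgroup_def mI)
    then obtain w where w: "w \<in> carrier Z" "\<And>c. c \<in> I \<Longrightarrow> \<phi> c = w \<cdot>\<^bsub>Z\<^esub> c"
    proof (rule baer_criterion[OF assms])
      show "\<phi> a \<in> carrier Z" if "a \<in> I" for a using \<phi>S[OF that] sub by blast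
      show "\<phi> (a \<oplus>\<^bsub>C\<^esub> b) = \<phi> a \<oplus>\<^bsub>Z\<^esub> \<phi> b" if "a \<in> I" "b \<in> I" for a b
        by (rule \<phi>eq[OF a1[OF that]])
      show "\<phi> (a \<otimes>\<^bsub>C\<^esub> c) = \<phi> a \<cdot>\<^bsub>Z\<^esub> c" if "a \<in> I" "c \<in> carrier C" for a c
        by (rule \<phi>eq[OF a2[OF that]])
    qed blast
    have wS: "z = w \<cdot>\<^bsub>Z\<^esub> c" if "(b \<cdot>\<^bsub>B\<^esub> c, z) \<in> S" "c \<in> carrier C" for c z
      using w(2)[OF II[OF that(2,1)]] \<phi>eq[OF that(1)] by simp
    define T where "T = {(d \<oplus>\<^bsub>B\<^esub> b \<cdot>\<^bsub>B\<^esub> c, z \<oplus>\<^bsub>Z\<^esub> w \<cdot>\<^bsub>Z\<^esub> c) | d z c. (d, z) \<in> S \<and> c \<in> carrier C}"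
    have ST: "S \<subseteq> T"
    proof
      fix p assume "p \<in> S"
      then obtain d z where p: "p = (d, z)" "(d, z) \<in> S" by (cases p) auto
      then have "p = (d \<oplus>\<^bsub>B\<^esub> b \<cdot>\<^bsub>B\<^esub> \<zero>\<^bsub>C\<^esub>, z \<oplus>\<^bsub>Z\<^esub> w \<cdot>\<^bsub>Z\<^esub> \<zero>\<^bsub>C\<^esub>)"
        using sub[OF p(2)] b w by (simp add: B.rsmult_zero_right Z.rsmult_zero_right)
      then show "p \<in> T" using p(2) Z.C.zero_closed unfolding T_def by blast
    qed
    have "P T"
      unfolding P_def
    proof (intro conjI allI impI ballI)
      show "T \<subseteq> carrier B \<times> carrier Z" using sub b w by (auto simp: T_def)
      show "(i x, f x) \<in> T" if "x \<in> carrier A" for x using ext that ST by blast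
    next
      fix p y p' y' assume "(p, y) \<in> T" "(p', y') \<in> T"
      then obtain d z c d' z' c' where
        e: "p = d \<oplus>\<^bsub>B\<^esub> b \<cdot>\<^bsub>B\<^esub> c" "y = z \<oplus>\<^bsub>Z\<^esub> w \<cdot>\<^bsub>Z\<^esub> c" "p' = d' \<oplus>\<^bsub>B\<^esub> b \<cdot>\<^bsub>B\<^esub> c'" "y' = z' \<oplus>\<^bsub>Z\<^esub> w \<cdot>\<^bsub>Z\<^esub> c'"
        and s: "(d, z) \<in> S" "(d', z') \<in> S" "c \<in> carrier C" "c' \<in> carrier C"
        unfolding T_def by blast
      note cl = sub[OF s(1)] sub[OF s(2)] s(3,4) b w(1)
      have "p \<oplus>\<^bsub>B\<^esub> p' = (d \<oplus>\<^bsub>B\<^esub> d') \<oplus>\<^bsub>B\<^esub> b \<cdot>\<^bsub>B\<^esub> (c \<oplus>\<^bsub>C\<^esub> c')"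
        "y \<oplus>\<^bsub>Z\<^esub> y' = (z \<oplus>\<^bsub>Z\<^esub> z') \<oplus>\<^bsub>Z\<^esub> w \<cdot>\<^bsub>Z\<^esub> (c \<oplus>\<^bsub>C\<^esub> c')"
        using cl by (simp_all add: e B.rsmult_r_distr Z.rsmult_r_distr B.a_ac Z.a_ac)
      then show "(p \<oplus>\<^bsub>B\<^esub> p', y \<oplus>\<^bsub>Z\<^esub> y') \<in> T"
        using add[OF s(1,2)] s(3,4) unfolding T_def by blast
    next
      fix p y c' assume "(p, y) \<in> T" and c': "c' \<in> carrier C"
      then obtain d z c where
        e: "p = d \<oplus>\<^bsub>B\<^esub> b \<cdot>\<^bsub>B\<^esub> c" "y = z \<oplus>\<^bsub>Z\<^esub> w \<cdot>\<^bsub>Z\<^esub> c" and s: "(d, z) \<in> S" "c \<in> carrier C"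
        unfolding T_def by blast
      have "p \<cdot>\<^bsub>B\<^esub> c' = d \<cdot>\<^bsub>B\<^esub> c' \<oplus>\<^bsub>B\<^esub> b \<cdot>\<^bsub>B\<^esub> (c \<otimes>\<^bsub>C\<^esub> c')" "y \<cdot>\<^bsub>Z\<^esub> c' = z \<cdot>\<^bsub>Z\<^esub> c' \<oplus>\<^bsub>Z\<^esub> w \<cdot>\<^bsub>Z\<^esub> (c \<otimes>\<^bsub>C\<^esub> c')"
        using sub[OF s(1)] s(2) c' b w(1)
        by (simp_all add: e B.rsmult_l_distr Z.rsmult_l_distr B.rsmult_assoc Z.rsmult_assoc)
      then show "(p \<cdot>\<^bsub>B\<^esub> c', y \<cdot>\<^bsub>Z\<^esub> c') \<in> T"
        using smul[OF s(1) c'] s(2) c' unfolding T_def by blast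
    next
      fix p y y' assume "(p, y) \<in> T" "(p, y') \<in> T"
      then obtain d z c d' z' c' where
        e: "p = d \<oplus>\<^bsub>B\<^esub> b \<cdot>\<^bsub>B\<^esub> c" "y = z \<oplus>\<^bsub>Z\<^esub> w \<cdot>\<^bsub>Z\<^esub> c" "p = d' \<oplus>\<^bsub>B\<^esub> b \<cdot>\<^bsub>B\<^esub> c'" "y' = z' \<oplus>\<^bsub>Z\<^esub> w \<cdot>\<^bsub>Z\<^esub> c'"
        and s: "(d, z) \<in> S" "(d', z') \<in> S" "c \<in> carrier C" "c' \<in> carrier C"
        unfolding T_def by blast
      note cl = sub[OF s(1)] sub[OF s(2)] s(3,4) b w(1)
      define k where "k = c' \<oplus>\<^bsub>C\<^esub> \<ominus>\<^bsub>C\<^esub> c"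
      have k: "k \<in> carrier C" "c' = k \<oplus>\<^bsub>C\<^esub> c" using cl by (auto simp: k_def Z.C.a_assoc Z.C.l_neg)
      have "d \<oplus>\<^bsub>B\<^esub> b \<cdot>\<^bsub>B\<^esub> c = (d' \<oplus>\<^bsub>B\<^esub> b \<cdot>\<^bsub>B\<^esub> k) \<oplus>\<^bsub>B\<^esub> b \<cdot>\<^bsub>B\<^esub> c"
        using e(1,3) cl k by (simp add: B.rsmult_r_distr B.a_assoc)
      then have "d = d' \<oplus>\<^bsub>B\<^esub> b \<cdot>\<^bsub>B\<^esub> k" using cl k(1) by simp
      then have "b \<cdot>\<^bsub>B\<^esub> k = \<ominus>\<^bsub>B\<^esub> d' \<oplus>\<^bsub>B\<^esub> d" using cl k(1) by (simp add: B.a_assoc[symmetric] B.l_neg)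
      then have "(b \<cdot>\<^bsub>B\<^esub> k, \<ominus>\<^bsub>Z\<^esub> z' \<oplus>\<^bsub>Z\<^esub> z) \<in> S" using add[OF neg[OF s(2)] s(1)] by simp
      then have "\<ominus>\<^bsub>Z\<^esub> z' \<oplus>\<^bsub>Z\<^esub> z = w \<cdot>\<^bsub>Z\<^esub> k" using wS k(1) by blast
      then have "z = z' \<oplus>\<^bsub>Z\<^esub> w \<cdot>\<^bsub>Z\<^esub> k"
        using cl by (metis Z.M.add.inv_closed Z.M.a_assoc Z.M.r_neg Z.M.l_zero)
      then show "y = y'" using cl k by (simp add: e Z.rsmult_r_distr Z.M.a_assoc)
    qed
    then have "T = S" using max ST by blast
    moreover have "(\<zero>\<^bsub>B\<^esub> \<oplus>\<^bsub>B\<^esub> b \<cdot>\<^bsub>B\<^esub> \<one>\<^bsub>C\<^esub>, \<zero>\<^bsub>Z\<^esub> \<oplus>\<^bsub>Z\<^esub> w \<cdot>\<^bsub>Z\<^esub> \<one>\<^bsub>C\<^esub>) \<in> T"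
      using zero unfolding T_def by blast
    ultimately show ?thesis using b w(1) by auto
  qed
  define h where "h = (\<lambda>b\<in>carrier B. THE z. (b, z) \<in> S)"
  have h: "h b = z" if "(b, z) \<in> S" for b z
  proof -
    have "(THE z. (b, z) \<in> S) = z" by (rule the_equality, rule that, rule sv[OF _ that])
    then show ?thesis using sub(1)[OF that] by (simp add: h_def)
  qed
  have hS: "(b, h b) \<in> S" if "b \<in> carrier B" for b
  proof -
    from total[OF that] obtain z where "(b, z) \<in> S" by blast
    with h[OF this] show ?thesis by simp
  qed
  have "h \<in> right_hom C B Z"
  proof (rule right_homI)
    show "h \<in> extensional (carrier B)" by (simp add: h_def)
    show "h x \<in> carrier Z" if "x \<in> carrier B" for x by (rule sub(2)[OF hS[OF that]])
    show "h (x \<oplus>\<^bsub>B\<^esub> y) = h x \<oplus>\<^bsub>Z\<^esub> h y" if "x \<in> carrier B" "y \<in> carrier B" for x y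
      by (rule h[OF add[OF hS hS, OF that]])
    show "h (x \<cdot>\<^bsub>B\<^esub> c) = h x \<cdot>\<^bsub>Z\<^esub> c" if "x \<in> carrier B" "c \<in> carrier C" for x c
      by (rule h[OF smul[OF hS, OF that]])
  qed
  moreover have "\<forall>x\<in>carrier A. h (i x) = f x" using h[OF ext] by blast
  ultimately show "\<exists>h\<in>right_hom C B Z. \<forall>x\<in>carrier A. h (i x) = f x" by blast
qed

lemma right_module_cyclic:
  assumes "right_module C Y" "x \<in> carrier Y"
  shows "right_module C (Y\<lparr>carrier := (\<lambda>c. x \<cdot>\<^bsub>Y\<^esub> c) ` carrier C\<rparr>)"
proof -
  interpret Y: right_module C Y by fact
  let ?M = "Y\<lparr>carrier := (\<lambda>c. x \<cdot>\<^bsub>Y\<^esub> c) ` carrier C\<rparr>"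
  have add: "(x \<cdot>\<^bsub>Y\<^esub> c) \<oplus>\<^bsub>Y\<^esub> (x \<cdot>\<^bsub>Y\<^esub> d) \<in> carrier ?M" if "c \<in> carrier C" "d \<in> carrier C" for c d
    using that assms(2) by (auto simp flip: Y.rsmult_r_distr)
  have mul: "(x \<cdot>\<^bsub>Y\<^esub> c) \<cdot>\<^bsub>Y\<^esub> d \<in> carrier ?M" if "c \<in> carrier C" "d \<in> carrier C" for c d
    using that assms(2) by (auto simp flip: Y.rsmult_assoc)
  have "abelian_group ?M"
  proof (rule abelian_groupI)
    fix y assume "y \<in> carrier ?M"
    then obtain c where c: "c \<in> carrier C" "y = x \<cdot>\<^bsub>Y\<^esub> c" by auto
    have "\<ominus>\<^bsub>Y\<^esub> y \<in> carrier ?M"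
      using mul[OF c(1), of "\<ominus>\<^bsub>C\<^esub> \<one>\<^bsub>C\<^esub>"] c assms(2) by (simp add: Y.rsmult_minus_one)
    moreover have "\<ominus>\<^bsub>Y\<^esub> y \<oplus>\<^bsub>Y\<^esub> y = \<zero>\<^bsub>Y\<^esub>" using c assms(2) by (simp add: Y.M.l_neg)
    ultimately show "\<exists>z\<in>carrier ?M. z \<oplus>\<^bsub>?M\<^esub> y = \<zero>\<^bsub>?M\<^esub>" by auto
  next
    show "\<zero>\<^bsub>?M\<^esub> \<in> carrier ?M"
      using Y.rsmult_zero_right[OF assms(2)] by (auto intro!: image_eqI[of _ _ "\<zero>\<^bsub>C\<^esub>"])
  qed (use add assms(2) in \<open>auto simp: Y.M.a_ac\<close>)
  then show ?thesis
    by (intro right_module.intro right_module_axioms.intro Y.C.ring_axioms)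
       (use mul assms(2) in \<open>auto simp: Y.rsmult_l_distr Y.rsmult_r_distr Y.rsmult_assoc\<close>)
qed

definition transport_module :: "('a \<Rightarrow> 'b) \<Rightarrow> ('c, 'a) rmodule \<Rightarrow> ('c, 'b) rmodule" where
  "transport_module e M = (let d = inv_into (carrier M) e in
     \<lparr>carrier = e ` carrier M, monoid.mult = undefined, one = undefined, ring.zero = e \<zero>\<^bsub>M\<^esub>,
      ring.add = (\<lambda>x y. e (d x \<oplus>\<^bsub>M\<^esub> d y)), rsmult = (\<lambda>x c. e (d x \<cdot>\<^bsub>M\<^esub> c))\<rparr>)"

lemma right_module_transport:
  assumes "right_module C M" "inj_on e (carrier M)"
  shows "right_module C (transport_module e M)"
proof -
  interpret M: right_module C M by fact
  let ?T = "transport_module e M"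
  have [simp]: "inv_into (carrier M) e (e x) = x" if "x \<in> carrier M" for x
    using assms(2) that by simp
  have "abelian_group ?T"
  proof (rule abelian_groupI)
    fix y assume "y \<in> carrier ?T"
    then obtain x where x: "x \<in> carrier M" "y = e x" by (auto simp: transport_module_def Let_def)
    then show "\<exists>z\<in>carrier ?T. z \<oplus>\<^bsub>?T\<^esub> y = \<zero>\<^bsub>?T\<^esub>"
      by (auto simp: transport_module_def Let_def M.M.l_neg intro!: bexI[of _ "\<ominus>\<^bsub>M\<^esub> x"])
  qed (auto simp: transport_module_def Let_def M.M.a_ac)
  then show ?thesis
    by (intro right_module.intro right_module_axioms.intro M.C.ring_axioms)
       (auto simp: transport_module_def Let_def M.rsmult_l_distr M.rsmult_r_distr M.rsmult_assoc)
qed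

lemma cogenerator_universe:
  assumes "injective_module TYPE('c set) (C :: 'c ring) Z" and "cogenerator TYPE('c set) C Z"
  shows "cogenerator TYPE('m) C Z"
  unfolding cogenerator_def
proof (intro conjI allI impI ballI)
  show "right_module C Z" using assms by (simp add: injective_module_def)
  fix Y :: "('c, 'm) rmodule" and x
  assume Y: "right_module C Y" and x: "x \<in> carrier Y" "x \<noteq> \<zero>\<^bsub>Y\<^esub>"
  interpret Y: right_module C Y by fact
  let ?M = "Y\<lparr>carrier := (\<lambda>c. x \<cdot>\<^bsub>Y\<^esub> c) ` carrier C\<rparr>"
  interpret M: right_module C ?M by (rule right_module_cyclic[OF Y x(1)])
  have sub: "y \<in> carrier Y" if "y \<in> carrier ?M" for y using that x by auto
  define e where "e y = {c \<in> carrier C. x \<cdot>\<^bsub>Y\<^esub> c = y}" for y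
  have e: "inj_on e (carrier ?M)" by (auto simp: inj_on_def e_def)
  let ?T = "transport_module e ?M"
  have rT: "right_module C ?T" by (rule right_module_transport[OF M.right_module_axioms e])
  have einv: "inv_into (carrier ?M) e (e y) = y" if "y \<in> carrier ?M" for y
    using e that by (rule inv_into_f_f)
  have xM: "x \<in> carrier ?M" using x(1) by (auto intro!: image_eqI[of _ _ "\<one>\<^bsub>C\<^esub>"])
  have zM: "\<zero>\<^bsub>Y\<^esub> \<in> carrier ?M" using M.M.zero_closed by simp
  have "e x \<noteq> \<zero>\<^bsub>?T\<^esub>" using inj_onD[OF e _ xM zM] x(2) by (auto simp: transport_module_def Let_def)
  moreover have "e x \<in> carrier ?T" using xM by (simp add: transport_module_def Let_def)
  ultimately obtain f where f: "f \<in> right_hom C ?T Z" "f (e x) \<noteq> \<zero>\<^bsub>Z\<^esub>"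
    using assms(2) rT unfolding cogenerator_def by blast
  let ?g = "\<lambda>y\<in>carrier ?M. f (e y)" and ?i = "restrict id (carrier ?M)"
  have eT: "e y \<in> carrier ?T" if "y \<in> carrier ?M" for y
    using that by (simp add: transport_module_def Let_def)
  have "?g \<in> right_hom C ?M Z"
  proof (rule right_homI)
    fix y y' assume y: "y \<in> carrier ?M" "y' \<in> carrier ?M"
    have "e (y \<oplus>\<^bsub>?M\<^esub> y') = e y \<oplus>\<^bsub>?T\<^esub> e y'"
      using einv[OF y(1)] einv[OF y(2)] by (simp add: transport_module_def Let_def)
    then show "?g (y \<oplus>\<^bsub>?M\<^esub> y') = ?g y \<oplus>\<^bsub>Z\<^esub> ?g y'"
      using M.M.a_closed[OF y] y right_homD(3)[OF f(1) eT eT, OF y] by simp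
  next
    fix y c assume y: "y \<in> carrier ?M" "c \<in> carrier C"
    have "e (y \<cdot>\<^bsub>?M\<^esub> c) = e y \<cdot>\<^bsub>?T\<^esub> c"
      using einv[OF y(1)] by (simp add: transport_module_def Let_def)
    then show "?g (y \<cdot>\<^bsub>?M\<^esub> c) = ?g y \<cdot>\<^bsub>Z\<^esub> c"
      using M.rsmult_closed[OF y] y right_homD(4)[OF f(1) eT, OF y] by simp
  qed (use right_homD(1)[OF f(1) eT] in auto)
  note g = this
  have i: "?i \<in> right_hom C ?M Y"
    by (rule right_homI) (use sub M.M.a_closed M.rsmult_closed in \<open>simp_all\<close>)
  have "inj_on ?i (carrier ?M)" by (auto simp: inj_on_def)
  from injective_moduleD[OF injective_module_universe[OF assms(1)] M.right_module_axioms Y i this g]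
  obtain h where h: "h \<in> right_hom C Y Z" "\<And>y. y \<in> carrier ?M \<Longrightarrow> h (?i y) = ?g y" by blast
  from h(2)[OF xM] f(2) xM have "h x \<noteq> \<zero>\<^bsub>Z\<^esub>" by simp
  with h(1) show "\<exists>f\<in>right_hom C Y Z. f x \<noteq> \<zero>\<^bsub>Z\<^esub>" by blast
qed

end

theory Submission
  imports Defs
begin

text \<open>
  (i) Endomorphisms \<open>w \<mapsto> f(w)v\<close> of \<open>U\<close> commute with a biendomorphism \<open>g\<close>, which moves \<open>g\<close> past the
  elements of the trace ideal; as \<open>TU = U\<close>, this determines \<open>\<phi>(\<rho> \<circ> g)\<close> for every endomorphism \<open>\<phi>\<close>
  of \<open>U*\<close>.

  (ii) Flatness makes \<open>U*\<close> an injective right \<open>R\<close>-module. Let \<open>W\<close> be the power of \<open>U*\<close> indexed by \<open>G\<close>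
  and \<open>w\<close> the element of \<open>W\<close> whose components are the elements of \<open>G\<close>. Since \<open>G\<close> is separating, \<open>r \<mapsto> wr\<close>
  is injective, so every \<open>\<sigma>\<close> in \<open>U*\<close> is \<open>\<psi>(w)\<close> for some \<open>\<psi> : W \<rightarrow> U*\<close>. A biendomorphism \<open>h\<close> of \<open>W\<close> acts
  by one map in all components, which is hence determined by \<open>t = h(w)\<close> through \<open>\<psi>(w) \<mapsto> \<psi>(t)\<close>, and the
  cogenerator property forces \<open>t \<otimes> u = w \<otimes> g(u)\<close> in \<open>W \<otimes> U\<close> for a unique \<open>g(u)\<close>. This \<open>g\<close> is the
  required biendomorphism of \<open>U\<close>.
\<close>

section \<open>Right modules\<close>

text \<open>A single functional may be annihilated by nonzero elements of \<open>R\<close>; passing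
  to a power \<open>W\<close> gives an element \<open>w\<close> for which \<open>wR\<close> is a
  copy of \<open>R\<close>. The argument then needs a condition on all \<psi> from \<open>W\<close>
  to \<open>Ud\<close>, namely \<open>h (\<psi> w) = \<psi> t\<close>, and this is where the two
  versions of (ii) part. A biendomorphism of \<open>W\<close> satisfies it for every
  \<open>G\<close>, since \<psi> followed by a coordinate inclusion is an endomorphism of
  \<open>W\<close>. A biendomorphism of \<open>Ud\<close> commutes only with endomorphisms of
  \<open>Ud\<close>, so \<open>w\<close> has to be cut into coordinates and reassembled by
  additivity, which needs \<open>G\<close> finite. The common core is therefore stated for an
  arbitrary right module \<open>W\<close>, elements \<open>w\<close> and \<open>t\<close>, and a
  bare function \<open>h\<close>. The tensor product turns a statement about all \<psi> into an
  equation between two elements. That equation mentions only \<open>R\<close>, so it survives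
  endomorphisms of \<open>U\<close> that are not \<open>C\<close>-linear. Injectivity and
  cogeneration are assumed over small universes only, whereas quotients, tensor products and powers
  live in larger types; the universe lemmas built on Baer's criterion bridge this gap.\<close>

lemma (in right_module) rsmult_zero_left:
  assumes "c \<in> carrier C" shows "\<zero>\<^bsub>M\<^esub> \<cdot>\<^bsub>M\<^esub> c = \<zero>\<^bsub>M\<^esub>"
  using rsmult_l_distr[of "\<zero>\<^bsub>M\<^esub>" "\<zero>\<^bsub>M\<^esub>" c] assms by simp

lemma (in right_module) rsmult_minus_left:
  assumes "x \<in> carrier M" "c \<in> carrier C" shows "(\<ominus>\<^bsub>M\<^esub> x) \<cdot>\<^bsub>M\<^esub> c = \<ominus>\<^bsub>M\<^esub> (x \<cdot>\<^bsub>M\<^esub> c)"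
proof (rule M.minus_equality[symmetric])
  show "(\<ominus>\<^bsub>M\<^esub> x) \<cdot>\<^bsub>M\<^esub> c \<oplus>\<^bsub>M\<^esub> x \<cdot>\<^bsub>M\<^esub> c = \<zero>\<^bsub>M\<^esub>"
    using assms by (simp flip: rsmult_l_distr add: M.l_neg rsmult_zero_left)
qed (use assms in auto)

text \<open>The map \<open>e\<close> need not be injective: the last two hypotheses say that the
  operations of \<open>N\<close> are well defined on images, and all module laws are then inherited.
  This covers quotients.\<close>

lemma right_module_image:
  assumes "right_module C M" and "carrier N = e ` carrier M" and "\<zero>\<^bsub>N\<^esub> = e \<zero>\<^bsub>M\<^esub>"
    and "\<And>x y. x \<in> carrier M \<Longrightarrow> y \<in> carrier M \<Longrightarrow> e x \<oplus>\<^bsub>N\<^esub> e y = e (x \<oplus>\<^bsub>M\<^esub> y)"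
    and "\<And>x c. x \<in> carrier M \<Longrightarrow> c \<in> carrier C \<Longrightarrow> e x \<cdot>\<^bsub>N\<^esub> c = e (x \<cdot>\<^bsub>M\<^esub> c)"
  shows "right_module C N"
proof -
  interpret M: right_module C M by fact
  have "abelian_group N"
  proof (rule abelian_groupI)
    fix y assume "y \<in> carrier N"
    then obtain x where x: "x \<in> carrier M" "y = e x" by (auto simp: assms(2))
    then show "\<exists>z\<in>carrier N. z \<oplus>\<^bsub>N\<^esub> y = \<zero>\<^bsub>N\<^esub>"
      by (auto simp: assms M.M.l_neg intro!: bexI[of _ "\<ominus>\<^bsub>M\<^esub> x"])
  qed (auto simp: assms M.M.a_ac)
  then show ?thesis
    by (intro right_module.intro right_module_axioms.intro M.C.ring_axioms)
       (auto simp: assms M.rsmult_l_distr M.rsmult_r_distr M.rsmult_assoc)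
qed

lemma right_hom_zero:
  assumes "right_module C M" "right_module C N" "f \<in> right_hom C M N"
  shows "f \<zero>\<^bsub>M\<^esub> = \<zero>\<^bsub>N\<^esub>"
proof -
  interpret M: right_module C M by fact
  interpret N: right_module C N by fact
  have "f (\<zero>\<^bsub>M\<^esub> \<cdot>\<^bsub>M\<^esub> \<zero>\<^bsub>C\<^esub>) = f \<zero>\<^bsub>M\<^esub> \<cdot>\<^bsub>N\<^esub> \<zero>\<^bsub>C\<^esub>"
    by (rule right_homD(4)[OF assms(3)]) auto
  then show ?thesis
    using right_homD(1)[OF assms(3)] by (simp add: M.rsmult_zero_right N.rsmult_zero_right)
qed

lemma right_hom_compose:
  assumes "f \<in> right_hom C L M" "g \<in> right_hom C M N"
    and "\<And>x y. x \<in> carrier L \<Longrightarrow> y \<in> carrier L \<Longrightarrow> x \<oplus>\<^bsub>L\<^esub> y \<in> carrier L"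
    and "\<And>x c. x \<in> carrier L \<Longrightarrow> c \<in> carrier C \<Longrightarrow> x \<cdot>\<^bsub>L\<^esub> c \<in> carrier L"
  shows "compose (carrier L) g f \<in> right_hom C L N"
  using assms(3,4) right_homD[OF assms(1)] right_homD[OF assms(2)]
  by (intro right_homI) (auto simp: compose_def)

text \<open>In the quotient of \<open>M\<close> by \<open>P\<close> the class of \<open>x\<close> is
  nonzero, so a functional on the quotient detects it; composing with the projection kills
  \<open>P\<close>. The quotient consists of sets of elements of \<open>M\<close>, hence the appeal
  to \<open>cogenerator_universe\<close>.\<close>

lemma cogenerator_submodule:
  assumes Z: "injective_module TYPE('c set) (C :: 'c ring) Z" "cogenerator TYPE('c set) C Z"
    and M: "right_module C M"
    and P: "P \<subseteq> carrier M" "\<zero>\<^bsub>M\<^esub> \<in> P" "\<And>x y. x \<in> P \<Longrightarrow> y \<in> P \<Longrightarrow> x \<oplus>\<^bsub>M\<^esub> y \<in> P"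
      "\<And>x c. x \<in> P \<Longrightarrow> c \<in> carrier C \<Longrightarrow> x \<cdot>\<^bsub>M\<^esub> c \<in> P"
    and x: "x \<in> carrier M" "x \<notin> P"
  obtains f where "f \<in> right_hom C M Z" "\<And>p. p \<in> P \<Longrightarrow> f p = \<zero>\<^bsub>Z\<^esub>" "f x \<noteq> \<zero>\<^bsub>Z\<^esub>"
proof -
  interpret M: right_module C M by fact
  have PM: "p \<in> carrier M" if "p \<in> P" for p using that P(1) by blast
  have neg: "\<ominus>\<^bsub>M\<^esub> p \<in> P" if "p \<in> P" for p
    using P(4)[OF that, of "\<ominus>\<^bsub>C\<^esub> \<one>\<^bsub>C\<^esub>"] PM[OF that] by (simp add: M.rsmult_minus_one)
  \<comment> \<open>\<open>e x\<close> is the coset of \<open>x\<close> modulo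
    \<open>P\<close>.\<close>
  define e where "e x = {y \<in> carrier M. y \<oplus>\<^bsub>M\<^esub> \<ominus>\<^bsub>M\<^esub> x \<in> P}" for x
  have e_eq: "e y = e z" if "y \<in> carrier M" "z \<in> carrier M" "y \<oplus>\<^bsub>M\<^esub> \<ominus>\<^bsub>M\<^esub> z \<in> P" for y z
  proof -
    have tel: "(a \<oplus>\<^bsub>M\<^esub> \<ominus>\<^bsub>M\<^esub> b) \<oplus>\<^bsub>M\<^esub> (b \<oplus>\<^bsub>M\<^esub> \<ominus>\<^bsub>M\<^esub> c) = a \<oplus>\<^bsub>M\<^esub> \<ominus>\<^bsub>M\<^esub> c"
      if "a \<in> carrier M" "b \<in> carrier M" "c \<in> carrier M" for a b c
      using that by (simp add: M.M.a_assoc M.M.r_neg1)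
    have zy: "z \<oplus>\<^bsub>M\<^esub> \<ominus>\<^bsub>M\<^esub> y \<in> P"
      using neg[OF that(3)] that(1,2) by (simp add: M.M.minus_add M.M.a_comm)
    show ?thesis
      using P(3)[OF _ that(3)] P(3)[OF _ zy] tel that unfolding e_def by fastforce
  qed
  have zneg: "\<ominus>\<^bsub>M\<^esub> \<zero>\<^bsub>M\<^esub> = \<zero>\<^bsub>M\<^esub>" by (rule M.M.minus_equality) auto
  have e_self: "y \<in> e y" if "y \<in> carrier M" for y using that P(2) by (simp add: e_def M.M.r_neg)
  \<comment> \<open>The operations on cosets are computed on chosen representatives;
    \<open>add\<close> and \<open>smul\<close> below show that the choice does not matter.\<close>
  define rep where "rep K = (SOME y. y \<in> K)" for K :: "'b set"
  have rep: "rep (e y) \<in> carrier M" "rep (e y) \<oplus>\<^bsub>M\<^esub> \<ominus>\<^bsub>M\<^esub> y \<in> P" if "y \<in> carrier M" for y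
    using someI[of "\<lambda>z. z \<in> e y", OF e_self[OF that]] by (auto simp: rep_def e_def)
  define N :: "('c, 'b set) rmodule" where "N = \<lparr>carrier = e ` carrier M, monoid.mult = undefined, one = undefined,
     ring.zero = e \<zero>\<^bsub>M\<^esub>, ring.add = (\<lambda>K L. e (rep K \<oplus>\<^bsub>M\<^esub> rep L)),
     rsmult = (\<lambda>K c. e (rep K \<cdot>\<^bsub>M\<^esub> c))\<rparr>"
  have add: "e y \<oplus>\<^bsub>N\<^esub> e z = e (y \<oplus>\<^bsub>M\<^esub> z)" if "y \<in> carrier M" "z \<in> carrier M" for y z
  proof -
    have "rep (e y) \<oplus>\<^bsub>M\<^esub> rep (e z) \<oplus>\<^bsub>M\<^esub> \<ominus>\<^bsub>M\<^esub> (y \<oplus>\<^bsub>M\<^esub> z)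
      = (rep (e y) \<oplus>\<^bsub>M\<^esub> \<ominus>\<^bsub>M\<^esub> y) \<oplus>\<^bsub>M\<^esub> (rep (e z) \<oplus>\<^bsub>M\<^esub> \<ominus>\<^bsub>M\<^esub> z)"
      using that rep by (simp add: M.M.minus_add M.M.a_ac)
    also have "\<dots> \<in> P" using that by (intro P(3) rep)
    finally show ?thesis using that rep by (simp add: N_def) (rule e_eq, auto)
  qed
  have smul: "e y \<cdot>\<^bsub>N\<^esub> c = e (y \<cdot>\<^bsub>M\<^esub> c)" if "y \<in> carrier M" "c \<in> carrier C" for y c
  proof -
    have "rep (e y) \<cdot>\<^bsub>M\<^esub> c \<oplus>\<^bsub>M\<^esub> \<ominus>\<^bsub>M\<^esub> (y \<cdot>\<^bsub>M\<^esub> c) = (rep (e y) \<oplus>\<^bsub>M\<^esub> \<ominus>\<^bsub>M\<^esub> y) \<cdot>\<^bsub>M\<^esub> c"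
      using that rep by (simp add: M.rsmult_l_distr M.rsmult_minus_left)
    also have "\<dots> \<in> P" using that by (intro P(4) rep)
    finally show ?thesis using that rep by (simp add: N_def) (rule e_eq, auto)
  qed
  have N: "right_module C N"
    by (rule right_module_image[OF M, of _ e]) (use add smul in \<open>auto simp: N_def\<close>)
  have "x \<notin> e \<zero>\<^bsub>M\<^esub>" using x by (simp add: e_def zneg)
  then have "e x \<noteq> \<zero>\<^bsub>N\<^esub>" using e_self[OF x(1)] by (auto simp: N_def)
  moreover have "e x \<in> carrier N" using x by (simp add: N_def)
  ultimately obtain f where f: "f \<in> right_hom C N Z" "f (e x) \<noteq> \<zero>\<^bsub>Z\<^esub>"
    using cogenerator_universe[OF Z, where 'm = "'b set"] N unfolding cogenerator_def by blast
  have rZ: "right_module C Z" using Z(2) by (simp add: cogenerator_def)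
  show thesis
  proof
    let ?f = "\<lambda>y\<in>carrier M. f (e y)"
    have eN: "e y \<in> carrier N" if "y \<in> carrier M" for y using that by (simp add: N_def)
    show "?f \<in> right_hom C M Z"
      using right_homD[OF f(1)] eN by (intro right_homI) (auto simp flip: add smul)
    show "?f x \<noteq> \<zero>\<^bsub>Z\<^esub>" using x f by simp
    show "?f p = \<zero>\<^bsub>Z\<^esub>" if "p \<in> P" for p
    proof -
      have "e p = \<zero>\<^bsub>N\<^esub>" using e_eq[of p "\<zero>\<^bsub>M\<^esub>"] PM that by (simp add: N_def zneg)
      then show ?thesis using PM[OF that] right_hom_zero[OF N rZ f(1)] by simp
    qed
  qed
qed

section \<open>Tensor products\<close>

locale tensor = A: right_module R A + M: left_module R M
  for R :: "'r ring" and A :: "('r, 'a) rmodule" and M :: "('r, 'u, 'm) module_scheme"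
begin

abbreviation free_group :: "('a \<times> 'u \<Rightarrow>\<^sub>0 int) monoid" where
  "free_group \<equiv> free_Abelian_group (carrier A \<times> carrier M)"

definition tensor_class :: "('a \<times> 'u \<Rightarrow>\<^sub>0 int) \<Rightarrow> ('a \<times> 'u \<Rightarrow>\<^sub>0 int) set" where
  "tensor_class x = tensor_null R A M #>\<^bsub>free_group\<^esub> x"

lemma tensor_null_subgroup: "subgroup (tensor_null R A M) free_group"
  unfolding tensor_null_def
proof (rule group.generate_is_subgroup[OF group_free_Abelian_group])
  have "frag_of x - frag_of y - frag_of z \<in> carrier free_group" "frag_of x - frag_of y \<in> carrier free_group"
    if "x \<in> carrier A \<times> carrier M" "y \<in> carrier A \<times> carrier M" "z \<in> carrier A \<times> carrier M" for x y z
    using that keys_diff[of "frag_of x - frag_of y" "frag_of z"] keys_diff[of "frag_of x" "frag_of y"]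
    by auto
  then show "{frag_of (a \<oplus>\<^bsub>A\<^esub> b, u) - frag_of (a, u) - frag_of (b, u) | a b u.
         a \<in> carrier A \<and> b \<in> carrier A \<and> u \<in> carrier M} \<union>
      {frag_of (a, u \<oplus>\<^bsub>M\<^esub> v) - frag_of (a, u) - frag_of (a, v) | a u v.
         a \<in> carrier A \<and> u \<in> carrier M \<and> v \<in> carrier M} \<union>
      {frag_of (a \<cdot>\<^bsub>A\<^esub> r, u) - frag_of (a, r \<odot>\<^bsub>M\<^esub> u) | a r u.
         a \<in> carrier A \<and> r \<in> carrier R \<and> u \<in> carrier M} \<subseteq> carrier free_group"
    by (intro Un_least subsetI) (force simp del: carrier_free_Abelian_group_iff)+
qed

lemma tensor_null_closed:
  shows tensor_null_keys: "x \<in> tensor_null R A M \<Longrightarrow> Poly_Mapping.keys x \<subseteq> carrier A \<times> carrier M"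
    and tensor_null_zero: "0 \<in> tensor_null R A M"
    and tensor_null_add: "x \<in> tensor_null R A M \<Longrightarrow> y \<in> tensor_null R A M \<Longrightarrow> x + y \<in> tensor_null R A M"
    and tensor_null_uminus: "x \<in> tensor_null R A M \<Longrightarrow> - x \<in> tensor_null R A M"
    and tensor_null_diff: "x \<in> tensor_null R A M \<Longrightarrow> y \<in> tensor_null R A M \<Longrightarrow> x - y \<in> tensor_null R A M"
proof -
  interpret N: subgroup "tensor_null R A M" free_group by (rule tensor_null_subgroup)
  show k: "Poly_Mapping.keys x \<subseteq> carrier A \<times> carrier M" if "x \<in> tensor_null R A M" for x
    using N.mem_carrier[OF that] by simp
  show "0 \<in> tensor_null R A M" using N.one_closed by simp
  show a: "x + y \<in> tensor_null R A M" if "x \<in> tensor_null R A M" "y \<in> tensor_null R A M" for x y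
    using N.m_closed[OF that] by simp
  show u: "- x \<in> tensor_null R A M" if "x \<in> tensor_null R A M" for x
    using N.m_inv_closed[OF that] k[OF that] by simp
  show "x - y \<in> tensor_null R A M" if "x \<in> tensor_null R A M" "y \<in> tensor_null R A M" for x y
    using a[OF that(1) u[OF that(2)]] by simp
qed

text \<open>A subgroup of an abelian group is generated by differences, so one \<open>diff\<close>
  case replaces the product and inverse cases of \<open>generate\<close>. Its premises keep
  membership in the null group, which bounds the keys of both terms.\<close>

lemma tensor_null_induct [consumes 1, case_names zero diff add_left add_right balanced]:
  assumes "x \<in> tensor_null R A M" and zero: "P 0"
    and diff: "\<And>x y. x \<in> tensor_null R A M \<Longrightarrow> y \<in> tensor_null R A M \<Longrightarrow> P x \<Longrightarrow> P y \<Longrightarrow> P (x - y)"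
    and "\<And>a b u. a \<in> carrier A \<Longrightarrow> b \<in> carrier A \<Longrightarrow> u \<in> carrier M \<Longrightarrow>
      P (frag_of (a \<oplus>\<^bsub>A\<^esub> b, u) - frag_of (a, u) - frag_of (b, u))"
    and "\<And>a u v. a \<in> carrier A \<Longrightarrow> u \<in> carrier M \<Longrightarrow> v \<in> carrier M \<Longrightarrow>
      P (frag_of (a, u \<oplus>\<^bsub>M\<^esub> v) - frag_of (a, u) - frag_of (a, v))"
    and "\<And>a r u. a \<in> carrier A \<Longrightarrow> r \<in> carrier R \<Longrightarrow> u \<in> carrier M \<Longrightarrow>
      P (frag_of (a \<cdot>\<^bsub>A\<^esub> r, u) - frag_of (a, r \<odot>\<^bsub>M\<^esub> u))"
  shows "P x"
proof -
  let ?S = "{frag_of (a \<oplus>\<^bsub>A\<^esub> b, u) - frag_of (a, u) - frag_of (b, u) | a b u.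
         a \<in> carrier A \<and> b \<in> carrier A \<and> u \<in> carrier M} \<union>
      {frag_of (a, u \<oplus>\<^bsub>M\<^esub> v) - frag_of (a, u) - frag_of (a, v) | a u v.
         a \<in> carrier A \<and> u \<in> carrier M \<and> v \<in> carrier M} \<union>
      {frag_of (a \<cdot>\<^bsub>A\<^esub> r, u) - frag_of (a, r \<odot>\<^bsub>M\<^esub> u) | a r u.
         a \<in> carrier A \<and> r \<in> carrier R \<and> u \<in> carrier M}"
  have S: "P y" if "y \<in> ?S" for y using that assms(4-6) by auto
  \<comment> \<open>Membership is proved along with \<open>P\<close> because \<open>diff\<close>
    asks for it. Inverses are written as \<open>0 - h\<close>, products as
    \<open>h1 - (0 - h2)\<close>.\<close>
  have "x \<in> tensor_null R A M \<and> P x" if "x \<in> generate free_group ?S" for x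
    using that
  proof (induction rule: generate.induct)
    case one
    then show ?case using zero tensor_null_zero by simp
  next
    case (incl h)
    then show ?case using S[OF incl] generate.incl[OF incl] by (simp add: tensor_null_def)
  next
    case (inv h)
    have "h \<in> tensor_null R A M" using generate.incl[OF inv] by (simp add: tensor_null_def)
    then show ?case
      using diff[OF tensor_null_zero, of h] zero S[OF inv] tensor_null_uminus tensor_null_keys by simp
  next
    case (eng h1 h2)
    then show ?case
      using diff[of h1 "0 - h2"] diff[OF tensor_null_zero, of h2] zero tensor_null_uminus
        tensor_null_add by simp
  qed
  then show ?thesis using assms(1) by (simp add: tensor_null_def)
qed

lemma tensor_null_generators:
  shows "a \<in> carrier A \<Longrightarrow> b \<in> carrier A \<Longrightarrow> u \<in> carrier M \<Longrightarrow>
      frag_of (a \<oplus>\<^bsub>A\<^esub> b, u) - frag_of (a, u) - frag_of (b, u) \<in> tensor_null R A M"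
    and "a \<in> carrier A \<Longrightarrow> u \<in> carrier M \<Longrightarrow> v \<in> carrier M \<Longrightarrow>
      frag_of (a, u \<oplus>\<^bsub>M\<^esub> v) - frag_of (a, u) - frag_of (a, v) \<in> tensor_null R A M"
    and "a \<in> carrier A \<Longrightarrow> r \<in> carrier R \<Longrightarrow> u \<in> carrier M \<Longrightarrow>
      frag_of (a \<cdot>\<^bsub>A\<^esub> r, u) - frag_of (a, r \<odot>\<^bsub>M\<^esub> u) \<in> tensor_null R A M"
  unfolding tensor_null_def by (rule generate.incl, blast)+

lemma tensor_class_eq_iff:
  assumes "Poly_Mapping.keys x \<subseteq> carrier A \<times> carrier M" "Poly_Mapping.keys y \<subseteq> carrier A \<times> carrier M"
  shows "tensor_class x = tensor_class y \<longleftrightarrow> x - y \<in> tensor_null R A M"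
proof
  assume "tensor_class x = tensor_class y"
  then have "x \<in> tensor_class y"
    unfolding tensor_class_def using assms
    by (metis carrier_free_Abelian_group_iff group.rcos_self group_free_Abelian_group tensor_null_subgroup)
  then show "x - y \<in> tensor_null R A M" by (auto simp: tensor_class_def r_coset_def)
next
  assume "x - y \<in> tensor_null R A M"
  then have "x \<in> tensor_null R A M #>\<^bsub>free_group\<^esub> y"
    by (auto simp: r_coset_def intro!: bexI[of _ "x - y"])
  then show "tensor_class x = tensor_class y"
    unfolding tensor_class_def
    using group.repr_independence[OF group_free_Abelian_group, of x] assms tensor_null_subgroup by simp
qed

lemma tensor_class_self:
  assumes "Poly_Mapping.keys x \<subseteq> carrier A \<times> carrier M" shows "x \<in> tensor_class x"
  using assms group.rcos_self[OF group_free_Abelian_group] tensor_null_subgroup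
  by (simp add: tensor_class_def)

lemma mem_tensor_class:
  assumes "Poly_Mapping.keys x \<subseteq> carrier A \<times> carrier M" "y \<in> tensor_class x"
  shows "Poly_Mapping.keys y \<subseteq> carrier A \<times> carrier M" "tensor_class y = tensor_class x"
proof -
  obtain n where n: "n \<in> tensor_null R A M" "y = n + x"
    using assms(2) by (auto simp: tensor_class_def r_coset_def)
  show "Poly_Mapping.keys y \<subseteq> carrier A \<times> carrier M"
    using n(2) keys_add[of n x] tensor_null_keys[OF n(1)] assms(1) by blast
  with assms(1) n show "tensor_class y = tensor_class x" by (simp add: tensor_class_eq_iff)
qed

lemma carrier_tensor_product: "carrier (tensor_product R A M) = tensor_class ` carrier free_group"
  by (auto simp: tensor_product_def FactGroup_def RCOSETS_def tensor_class_def)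

lemma tensor_class_add:
  assumes "Poly_Mapping.keys x \<subseteq> carrier A \<times> carrier M" "Poly_Mapping.keys y \<subseteq> carrier A \<times> carrier M"
  shows "tensor_class x \<otimes>\<^bsub>tensor_product R A M\<^esub> tensor_class y = tensor_class (x + y)"
proof -
  have "normal (tensor_null R A M) free_group"
    by (rule comm_group.subgroup_imp_normal[OF abelian_free_Abelian_group tensor_null_subgroup])
  from normal.rcos_sum[OF this, of x y] assms show ?thesis
    by (simp add: tensor_class_def tensor_product_def FactGroup_def)
qed

text \<open>A balanced map extends to the free group and kills the three kinds of relations, hence
  the whole null group. The induced map is described on classes of formal sums only, so
  \<open>h\<close> is unconstrained on other sets.\<close>

lemma tensor_universal:
  assumes "abelian_group Z"
    and closed: "\<And>a u. a \<in> carrier A \<Longrightarrow> u \<in> carrier M \<Longrightarrow> \<beta> a u \<in> carrier Z"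
    and "\<And>a b u. a \<in> carrier A \<Longrightarrow> b \<in> carrier A \<Longrightarrow> u \<in> carrier M \<Longrightarrow> \<beta> (a \<oplus>\<^bsub>A\<^esub> b) u = \<beta> a u \<oplus>\<^bsub>Z\<^esub> \<beta> b u"
    and "\<And>a u v. a \<in> carrier A \<Longrightarrow> u \<in> carrier M \<Longrightarrow> v \<in> carrier M \<Longrightarrow> \<beta> a (u \<oplus>\<^bsub>M\<^esub> v) = \<beta> a u \<oplus>\<^bsub>Z\<^esub> \<beta> a v"
    and "\<And>a r u. a \<in> carrier A \<Longrightarrow> r \<in> carrier R \<Longrightarrow> u \<in> carrier M \<Longrightarrow> \<beta> (a \<cdot>\<^bsub>A\<^esub> r) u = \<beta> a (r \<odot>\<^bsub>M\<^esub> u)"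
  obtains h where "\<And>x. Poly_Mapping.keys x \<subseteq> carrier A \<times> carrier M \<Longrightarrow> h (tensor_class x) \<in> carrier Z"
    and "\<And>x y. Poly_Mapping.keys x \<subseteq> carrier A \<times> carrier M \<Longrightarrow> Poly_Mapping.keys y \<subseteq> carrier A \<times> carrier M \<Longrightarrow>
      h (tensor_class (x + y)) = h (tensor_class x) \<oplus>\<^bsub>Z\<^esub> h (tensor_class y)"
    and "\<And>a u. a \<in> carrier A \<Longrightarrow> u \<in> carrier M \<Longrightarrow> h (tensor_class (frag_of (a, u))) = \<beta> a u"
proof -
  interpret Z: abelian_group Z by fact
  obtain k where k: "k \<in> hom free_group (add_monoid Z)"
    and kof: "\<And>p. p \<in> carrier A \<times> carrier M \<Longrightarrow> k (frag_of p) = (case p of (a, u) \<Rightarrow> \<beta> a u)"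
  proof (rule comm_group.free_Abelian_group_universal[OF Z.a_comm_group])
    show "(\<lambda>(a, u). \<beta> a u) ` (carrier A \<times> carrier M) \<subseteq> carrier (add_monoid Z)" using closed by auto
  qed blast
  have kcl: "k x \<in> carrier Z" if "Poly_Mapping.keys x \<subseteq> carrier A \<times> carrier M" for x
    using k that by (auto simp: hom_def Pi_def)
  have kadd: "k (x + y) = k x \<oplus>\<^bsub>Z\<^esub> k y"
    if "Poly_Mapping.keys x \<subseteq> carrier A \<times> carrier M" "Poly_Mapping.keys y \<subseteq> carrier A \<times> carrier M" for x y
    using k that by (auto simp: hom_def)
  have kdiff: "k (x - y) = k x \<ominus>\<^bsub>Z\<^esub> k y"
    if "Poly_Mapping.keys x \<subseteq> carrier A \<times> carrier M" "Poly_Mapping.keys y \<subseteq> carrier A \<times> carrier M" for x y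
  proof -
    have xy: "Poly_Mapping.keys (x - y) \<subseteq> carrier A \<times> carrier M" using that keys_diff[of x y] by blast
    have "k x = k (x - y) \<oplus>\<^bsub>Z\<^esub> k y" using kadd[OF xy that(2)] by simp
    then show ?thesis using kcl xy that by (simp add: Z.minus_eq Z.a_assoc Z.r_neg)
  qed
  have k0: "k 0 = \<zero>\<^bsub>Z\<^esub>" using kdiff[of 0 0] kcl[of 0] by (simp add: Z.minus_eq Z.r_neg)
  have gen: "Poly_Mapping.keys (frag_of p - frag_of q) \<subseteq> carrier A \<times> carrier M"
    if "p \<in> carrier A \<times> carrier M" "q \<in> carrier A \<times> carrier M" for p q
    using that keys_diff[of "frag_of p" "frag_of q"] by auto
  have cancel: "(x \<oplus>\<^bsub>Z\<^esub> y) \<ominus>\<^bsub>Z\<^esub> x \<ominus>\<^bsub>Z\<^esub> y = \<zero>\<^bsub>Z\<^esub>" if "x \<in> carrier Z" "y \<in> carrier Z" for x y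
    using Z.r_neg[of "x \<oplus>\<^bsub>Z\<^esub> y"] that by (simp add: Z.minus_eq Z.minus_add Z.a_assoc)
  have null: "k x = \<zero>\<^bsub>Z\<^esub>" if "x \<in> tensor_null R A M" for x
    using that
  proof (induction rule: tensor_null_induct)
    case (diff x y)
    then show ?case using kdiff[of x y] tensor_null_keys by (simp add: Z.minus_eq)
  next
    case (add_left a b u)
    then show ?case
      by (simp add: kdiff gen kof assms(3) closed cancel)
  next
    case (add_right a u v)
    then show ?case
      by (simp add: kdiff gen kof assms(4) closed cancel)
  next
    case (balanced a r u)
    then show ?case by (simp add: kdiff kof assms(5) closed Z.minus_eq Z.r_neg)
  qed (rule k0)
  \<comment> \<open>Evaluate at an arbitrary member of the coset; by \<open>null\<close> any two
    members give the same value.\<close>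
  define h where "h K = k (SOME x. x \<in> K)" for K
  have h: "h (tensor_class x) = k x" if x: "Poly_Mapping.keys x \<subseteq> carrier A \<times> carrier M" for x
  proof -
    define y where "y = (SOME y. y \<in> tensor_class x)"
    have "y \<in> tensor_class x" unfolding y_def by (rule someI[of _ x]) (rule tensor_class_self[OF x])
    from mem_tensor_class[OF x this] have y: "Poly_Mapping.keys y \<subseteq> carrier A \<times> carrier M" "y - x \<in> tensor_null R A M"
      using tensor_class_eq_iff x by auto
    have "k y = k (y - x) \<oplus>\<^bsub>Z\<^esub> k x" using kadd[OF tensor_null_keys[OF y(2)] x] by simp
    then show ?thesis using null[OF y(2)] kcl[OF x] by (simp add: h_def y_def)
  qed
  show thesis
  proof (rule that)
    show "h (tensor_class x) \<in> carrier Z" if "Poly_Mapping.keys x \<subseteq> carrier A \<times> carrier M" for x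
      using that by (simp add: h kcl)
    show "h (tensor_class (x + y)) = h (tensor_class x) \<oplus>\<^bsub>Z\<^esub> h (tensor_class y)"
      if "Poly_Mapping.keys x \<subseteq> carrier A \<times> carrier M" "Poly_Mapping.keys y \<subseteq> carrier A \<times> carrier M" for x y
      using that keys_add[of x y] by (simp add: h kadd order_trans[OF keys_add])
    show "h (tensor_class (frag_of (a, u))) = \<beta> a u" if "a \<in> carrier A" "u \<in> carrier M" for a u
      using that by (simp add: h kof)
  qed
qed

end

lemma keys_frag_extend_pairs:
  assumes "Poly_Mapping.keys x \<subseteq> A \<times> M" "\<And>a. a \<in> A \<Longrightarrow> f a \<in> B" "\<And>u. u \<in> M \<Longrightarrow> g u \<in> N"
  shows "Poly_Mapping.keys (frag_extend (\<lambda>(a, u). frag_of (f a, g u)) x) \<subseteq> B \<times> N"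
  using keys_frag_extend[of "\<lambda>(a, u). frag_of (f a, g u)" x] assms by fastforce

text \<open>Relations go to relations of the same kind, so \<open>f\<close> tensor \<open>g\<close>
  is well defined. With \<open>g\<close> the identity this gives the map on \<open>A\<close>; with
  \<open>f\<close> the identity it gives both the right \<open>C\<close>-action and the effect of
  endomorphisms of \<open>U\<close>.\<close>

lemma tensor_null_map:
  assumes "tensor R A M" "tensor R B N"
    and "\<And>a. a \<in> carrier A \<Longrightarrow> f a \<in> carrier B"
    and "\<And>a b. a \<in> carrier A \<Longrightarrow> b \<in> carrier A \<Longrightarrow> f (a \<oplus>\<^bsub>A\<^esub> b) = f a \<oplus>\<^bsub>B\<^esub> f b"
    and "\<And>a r. a \<in> carrier A \<Longrightarrow> r \<in> carrier R \<Longrightarrow> f (a \<cdot>\<^bsub>A\<^esub> r) = f a \<cdot>\<^bsub>B\<^esub> r"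
    and "\<And>u. u \<in> carrier M \<Longrightarrow> g u \<in> carrier N"
    and "\<And>u v. u \<in> carrier M \<Longrightarrow> v \<in> carrier M \<Longrightarrow> g (u \<oplus>\<^bsub>M\<^esub> v) = g u \<oplus>\<^bsub>N\<^esub> g v"
    and "\<And>r u. r \<in> carrier R \<Longrightarrow> u \<in> carrier M \<Longrightarrow> g (r \<odot>\<^bsub>M\<^esub> u) = r \<odot>\<^bsub>N\<^esub> g u"
    and "x \<in> tensor_null R A M"
  shows "frag_extend (\<lambda>(a, u). frag_of (f a, g u)) x \<in> tensor_null R B N"
proof -
  interpret S: tensor R A M by fact
  interpret T: tensor R B N by fact
  show ?thesis using assms(9)
    by (induction rule: S.tensor_null_induct)
       (auto simp: frag_extend_diff assms(3-8) T.tensor_null_zero T.tensor_null_diff T.tensor_null_generators)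
qed

section \<open>Bimodules and their duals\<close>

lemma right_part_sel [simp]:
  "carrier (right_part U) = carrier U" "\<zero>\<^bsub>right_part U\<^esub> = \<zero>\<^bsub>U\<^esub>"
  "x \<oplus>\<^bsub>right_part U\<^esub> y = x \<oplus>\<^bsub>U\<^esub> y" "x \<cdot>\<^bsub>right_part U\<^esub> c = bi_rsmult U x c"
  by (simp_all add: right_part_def)

lemma dual_sel [simp]:
  "carrier (dual C Z U) = right_hom C (right_part U) Z"
  "\<zero>\<^bsub>dual C Z U\<^esub> = (\<lambda>u\<in>carrier U. \<zero>\<^bsub>Z\<^esub>)"
  "\<rho> \<oplus>\<^bsub>dual C Z U\<^esub> \<sigma> = (\<lambda>u\<in>carrier U. \<rho> u \<oplus>\<^bsub>Z\<^esub> \<sigma> u)"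
  "\<rho> \<cdot>\<^bsub>dual C Z U\<^esub> r = (\<lambda>u\<in>carrier U. \<rho> (r \<odot>\<^bsub>U\<^esub> u))"
  by (simp_all add: dual_def)

locale bimodule =
  fixes R :: "'r ring" and C :: "'c ring" and U :: "('r, 'c, 'u) bimodule"
  assumes is_bimodule: "is_bimodule R C U"
begin

sublocale U: left_module R U
  using is_bimodule by (simp add: is_bimodule_def)

sublocale right: right_module C "right_part U"
  using is_bimodule by (simp add: is_bimodule_def)

lemma bi_rsmult_closed [simp, intro]:
    "u \<in> carrier U \<Longrightarrow> c \<in> carrier C \<Longrightarrow> bi_rsmult U u c \<in> carrier U"
  and bi_rsmult_r_distr: "u \<in> carrier U \<Longrightarrow> c \<in> carrier C \<Longrightarrow> d \<in> carrier C \<Longrightarrow>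
    bi_rsmult U u (c \<oplus>\<^bsub>C\<^esub> d) = bi_rsmult U u c \<oplus>\<^bsub>U\<^esub> bi_rsmult U u d"
  and bi_rsmult_l_distr: "u \<in> carrier U \<Longrightarrow> v \<in> carrier U \<Longrightarrow> c \<in> carrier C \<Longrightarrow>
    bi_rsmult U (u \<oplus>\<^bsub>U\<^esub> v) c = bi_rsmult U u c \<oplus>\<^bsub>U\<^esub> bi_rsmult U v c"
  and bi_rsmult_assoc: "u \<in> carrier U \<Longrightarrow> c \<in> carrier C \<Longrightarrow> d \<in> carrier C \<Longrightarrow>
    bi_rsmult U u (c \<otimes>\<^bsub>C\<^esub> d) = bi_rsmult U (bi_rsmult U u c) d"
  and bi_rsmult_one: "u \<in> carrier U \<Longrightarrow> bi_rsmult U u \<one>\<^bsub>C\<^esub> = u"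
  using right.rsmult_closed right.rsmult_r_distr right.rsmult_l_distr right.rsmult_assoc right.rsmult_one
  by simp_all

lemma bi_rsmult_lsmult: "r \<in> carrier R \<Longrightarrow> u \<in> carrier U \<Longrightarrow> c \<in> carrier C \<Longrightarrow>
    bi_rsmult U (r \<odot>\<^bsub>U\<^esub> u) c = r \<odot>\<^bsub>U\<^esub> bi_rsmult U u c"
  using is_bimodule by (simp add: is_bimodule_def)

end

section \<open>The tensor product as a right \<open>C\<close>-module, and the hom-tensor
  adjunction\<close>

definition bitensor ::
  "'r ring \<Rightarrow> ('r, 'a) rmodule \<Rightarrow> ('r, 'c, 'u) bimodule \<Rightarrow> ('c, ('a \<times> 'u \<Rightarrow>\<^sub>0 int) set) rmodule" where
  "bitensor R A U = \<lparr>carrier = carrier (tensor_product R A U),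
     monoid.mult = undefined, one = undefined,
     ring.zero = tensor.tensor_class R A U 0, ring.add = monoid.mult (tensor_product R A U),
     rsmult = (\<lambda>K c. tensor.tensor_class R A U
       (frag_extend (\<lambda>(a, u). frag_of (a, bi_rsmult U u c)) (SOME x. x \<in> K)))\<rparr>"

locale tensor_bimodule = bimodule R C U + A: right_module R A
  for R :: "'r ring" and C :: "'c ring" and U :: "('r, 'c, 'u) bimodule" and A :: "('r, 'a) rmodule"
begin

sublocale tensor R A U
  by (intro tensor.intro A.right_module_axioms U.left_module_axioms)

abbreviation pure_tensor :: "'a \<Rightarrow> 'u \<Rightarrow> ('a \<times> 'u \<Rightarrow>\<^sub>0 int) set" where
  "pure_tensor a u \<equiv> tensor_class (frag_of (a, u))"

text \<open>The action of \<open>c\<close> lifted to formal sums, where no representative has to be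
  chosen.\<close>

definition ract :: "'c \<Rightarrow> ('a \<times> 'u \<Rightarrow>\<^sub>0 int) \<Rightarrow> 'a \<times> 'u \<Rightarrow>\<^sub>0 int" where
  "ract c = frag_extend (\<lambda>(a, u). frag_of (a, bi_rsmult U u c))"

lemma keys_ract:
  assumes "Poly_Mapping.keys x \<subseteq> carrier A \<times> carrier U" "c \<in> carrier C"
  shows "Poly_Mapping.keys (ract c x) \<subseteq> carrier A \<times> carrier U"
  unfolding ract_def using assms by (intro keys_frag_extend_pairs[where f = "\<lambda>a. a"]) auto

lemma ract_null:
  assumes "x \<in> tensor_null R A U" "c \<in> carrier C"
  shows "ract c x \<in> tensor_null R A U"
  unfolding ract_def
  by (rule tensor_null_map[where f = "\<lambda>a. a"])
     (use assms tensor_axioms in \<open>auto simp: bi_rsmult_l_distr bi_rsmult_lsmult\<close>)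

lemma tensor_bimodule_sel:
  shows carrier_tensor_bimodule: "carrier (bitensor R A U) = tensor_class ` carrier free_group"
    and zero_tensor_bimodule: "\<zero>\<^bsub>bitensor R A U\<^esub> = tensor_class 0"
  by (simp_all add: bitensor_def carrier_tensor_product)

lemma tensor_bimodule_cases:
  assumes "K \<in> carrier (bitensor R A U)"
  obtains x where "Poly_Mapping.keys x \<subseteq> carrier A \<times> carrier U" "K = tensor_class x"
  using assms by (auto simp: carrier_tensor_bimodule)

lemma add_tensor_bimodule:
  "Poly_Mapping.keys x \<subseteq> carrier A \<times> carrier U \<Longrightarrow> Poly_Mapping.keys y \<subseteq> carrier A \<times> carrier U \<Longrightarrow>
    tensor_class x \<oplus>\<^bsub>bitensor R A U\<^esub> tensor_class y = tensor_class (x + y)"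
  using tensor_class_add by (simp add: bitensor_def)

text \<open>Independence of the representative picked in \<open>bitensor\<close>: by
  \<open>ract_null\<close> the lifted action preserves the null group, which rests on the bimodule
  law linking the two actions on \<open>U\<close>.\<close>

lemma rsmult_tensor_bimodule:
  assumes x: "Poly_Mapping.keys x \<subseteq> carrier A \<times> carrier U" and c: "c \<in> carrier C"
  shows "tensor_class x \<cdot>\<^bsub>bitensor R A U\<^esub> c = tensor_class (ract c x)"
proof -
  define y where "y = (SOME y. y \<in> tensor_class x)"
  have "y \<in> tensor_class x" unfolding y_def by (rule someI[of _ x]) (rule tensor_class_self[OF x])
  from mem_tensor_class[OF x this]
  have y: "Poly_Mapping.keys y \<subseteq> carrier A \<times> carrier U" "y - x \<in> tensor_null R A U"
    using tensor_class_eq_iff x by auto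
  have "ract c y - ract c x \<in> tensor_null R A U"
    using ract_null[OF y(2) c] by (simp add: ract_def frag_extend_diff)
  then have "tensor_class (ract c y) = tensor_class (ract c x)"
    using tensor_class_eq_iff keys_ract x y c by blast
  then show ?thesis by (simp add: bitensor_def y_def ract_def)
qed

lemma right_module_tensor_bimodule: "right_module C (bitensor R A U)"
proof -
  let ?T = "bitensor R A U"
  have kadd: "Poly_Mapping.keys (x + y) \<subseteq> carrier A \<times> carrier U"
    if "Poly_Mapping.keys x \<subseteq> carrier A \<times> carrier U" "Poly_Mapping.keys y \<subseteq> carrier A \<times> carrier U"
    for x y :: "'a \<times> 'u \<Rightarrow>\<^sub>0 int" using that keys_add[of x y] by blast
  have "abelian_group ?T"
  proof (rule abelian_groupI)
    fix K assume "K \<in> carrier ?T"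
    then obtain x where x: "Poly_Mapping.keys x \<subseteq> carrier A \<times> carrier U" "K = tensor_class x"
      by (rule tensor_bimodule_cases)
    show "\<exists>L\<in>carrier ?T. L \<oplus>\<^bsub>?T\<^esub> K = \<zero>\<^bsub>?T\<^esub>"
      by (rule bexI[of _ "tensor_class (- x)"])
        (use x in \<open>auto simp: carrier_tensor_bimodule zero_tensor_bimodule add_tensor_bimodule\<close>)
  qed (auto simp: carrier_tensor_bimodule zero_tensor_bimodule add_tensor_bimodule kadd add_ac)
  \<comment> \<open>Distributivity over sums in \<open>C\<close> is the one law of the action that
    fails for formal sums and holds only modulo the relations, those for sums in \<open>U\<close>.
    The laws below hold before passing to classes.\<close>
  moreover have "tensor_class (ract (c \<oplus>\<^bsub>C\<^esub> d) x) = tensor_class (ract c x + ract d x)"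
    if "c \<in> carrier C" "d \<in> carrier C" and x: "Poly_Mapping.keys x \<subseteq> carrier A \<times> carrier U" for c d x
  proof -
    have "ract (c \<oplus>\<^bsub>C\<^esub> d) x - ract c x - ract d x \<in> tensor_null R A U"
      using x
    proof (induction rule: frag_induction)
      case (one p)
      then show ?case
        using that tensor_null_generators(2) by (auto simp: ract_def bi_rsmult_r_distr)
    next
      case (diff x y)
      from tensor_null_diff[OF diff] show ?case
        by (simp add: ract_def frag_extend_diff algebra_simps)
    qed (simp add: ract_def tensor_null_zero)
    then show ?thesis
      using that by (subst tensor_class_eq_iff) (auto simp: keys_ract kadd diff_diff_eq)
  qed
  moreover have "ract (c \<otimes>\<^bsub>C\<^esub> d) x = ract d (ract c x)"
    if "c \<in> carrier C" "d \<in> carrier C" and x: "Poly_Mapping.keys x \<subseteq> carrier A \<times> carrier U" for c d x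
    using x by (induction rule: frag_induction)
      (use that in \<open>auto simp: ract_def frag_extend_diff bi_rsmult_assoc\<close>)
  moreover have "ract \<one>\<^bsub>C\<^esub> x = x" if x: "Poly_Mapping.keys x \<subseteq> carrier A \<times> carrier U" for x
    using x by (induction rule: frag_induction)
      (auto simp: ract_def frag_extend_diff bi_rsmult_one)
  moreover have "ract c (x + y) = ract c x + ract c y" for c x y
    by (simp add: ract_def frag_extend_add)
  ultimately show ?thesis
    by (intro right_module.intro right_module_axioms.intro right.C.ring_axioms)
       (auto elim!: tensor_bimodule_cases simp: rsmult_tensor_bimodule add_tensor_bimodule keys_ract
         kadd carrier_tensor_bimodule)
qed

lemma pure_tensor_closed:
  "a \<in> carrier A \<Longrightarrow> u \<in> carrier U \<Longrightarrow> pure_tensor a u \<in> carrier (bitensor R A U)"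
  by (simp add: carrier_tensor_bimodule)

lemma pure_tensor_eq:
  shows pure_tensor_add_left: "a \<in> carrier A \<Longrightarrow> b \<in> carrier A \<Longrightarrow> u \<in> carrier U \<Longrightarrow>
      pure_tensor (a \<oplus>\<^bsub>A\<^esub> b) u = pure_tensor a u \<oplus>\<^bsub>bitensor R A U\<^esub> pure_tensor b u"
    and pure_tensor_add_right: "a \<in> carrier A \<Longrightarrow> u \<in> carrier U \<Longrightarrow> v \<in> carrier U \<Longrightarrow>
      pure_tensor a (u \<oplus>\<^bsub>U\<^esub> v) = pure_tensor a u \<oplus>\<^bsub>bitensor R A U\<^esub> pure_tensor a v"
    and pure_tensor_balanced: "a \<in> carrier A \<Longrightarrow> r \<in> carrier R \<Longrightarrow> u \<in> carrier U \<Longrightarrow>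
      pure_tensor (a \<cdot>\<^bsub>A\<^esub> r) u = pure_tensor a (r \<odot>\<^bsub>U\<^esub> u)"
    and pure_tensor_rsmult: "a \<in> carrier A \<Longrightarrow> u \<in> carrier U \<Longrightarrow> c \<in> carrier C \<Longrightarrow>
      pure_tensor a u \<cdot>\<^bsub>bitensor R A U\<^esub> c = pure_tensor a (bi_rsmult U u c)"
proof -
  have k: "Poly_Mapping.keys (frag_of p + frag_of q) \<subseteq> carrier A \<times> carrier U"
    if "p \<in> carrier A \<times> carrier U" "q \<in> carrier A \<times> carrier U" for p q
    using that keys_add[of "frag_of p" "frag_of q"] by auto
  show "pure_tensor (a \<oplus>\<^bsub>A\<^esub> b) u = pure_tensor a u \<oplus>\<^bsub>bitensor R A U\<^esub> pure_tensor b u"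
    if "a \<in> carrier A" "b \<in> carrier A" "u \<in> carrier U"
    using that tensor_null_generators(1)
    by (simp add: add_tensor_bimodule tensor_class_eq_iff k diff_diff_eq[symmetric])
  show "pure_tensor a (u \<oplus>\<^bsub>U\<^esub> v) = pure_tensor a u \<oplus>\<^bsub>bitensor R A U\<^esub> pure_tensor a v"
    if "a \<in> carrier A" "u \<in> carrier U" "v \<in> carrier U"
    using that tensor_null_generators(2)
    by (simp add: add_tensor_bimodule tensor_class_eq_iff k diff_diff_eq[symmetric])
  show "pure_tensor (a \<cdot>\<^bsub>A\<^esub> r) u = pure_tensor a (r \<odot>\<^bsub>U\<^esub> u)"
    if "a \<in> carrier A" "r \<in> carrier R" "u \<in> carrier U"
    using that tensor_null_generators(3) by (simp add: tensor_class_eq_iff)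
  show "pure_tensor a u \<cdot>\<^bsub>bitensor R A U\<^esub> c = pure_tensor a (bi_rsmult U u c)"
    if "a \<in> carrier A" "u \<in> carrier U" "c \<in> carrier C"
    using that by (simp add: rsmult_tensor_bimodule ract_def)
qed

text \<open>One direction of the adjunction: \<open>(a, u) \<mapsto> \<phi> a u\<close> is balanced
  because \<phi> is \<open>R\<close>-linear for the action on the dual, and the induced map is
  \<open>C\<close>-linear because each \<open>\<phi> a\<close> is.\<close>

lemma right_hom_tensor_bimodule:
  assumes Z: "right_module C Z" and \<phi>: "\<phi> \<in> right_hom R A (dual C Z U)"
  obtains h where "h \<in> right_hom C (bitensor R A U) Z"
    and "\<And>a u. a \<in> carrier A \<Longrightarrow> u \<in> carrier U \<Longrightarrow> h (pure_tensor a u) = \<phi> a u"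
proof -
  interpret Z: right_module C Z by fact
  have \<phi>': "\<phi> a \<in> right_hom C (right_part U) Z" if "a \<in> carrier A" for a
    using right_homD(1)[OF \<phi> that] by simp
  note \<phi>D = right_homD[OF \<phi>', simplified]
  obtain k where k: "\<And>x. Poly_Mapping.keys x \<subseteq> carrier A \<times> carrier U \<Longrightarrow> k (tensor_class x) \<in> carrier Z"
    "\<And>x y. Poly_Mapping.keys x \<subseteq> carrier A \<times> carrier U \<Longrightarrow> Poly_Mapping.keys y \<subseteq> carrier A \<times> carrier U \<Longrightarrow>
      k (tensor_class (x + y)) = k (tensor_class x) \<oplus>\<^bsub>Z\<^esub> k (tensor_class y)"
    "\<And>a u. a \<in> carrier A \<Longrightarrow> u \<in> carrier U \<Longrightarrow> k (tensor_class (frag_of (a, u))) = \<phi> a u"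
  proof (rule tensor_universal[of Z \<phi>])
    show "abelian_group Z" by (rule Z.M.abelian_group_axioms)
  qed (use \<phi>D right_homD(3,4)[OF \<phi>] in auto)
  have lin: "k (tensor_class (ract c x)) = k (tensor_class x) \<cdot>\<^bsub>Z\<^esub> c"
    if c: "c \<in> carrier C" and x: "Poly_Mapping.keys x \<subseteq> carrier A \<times> carrier U" for c x
    using x
  proof (induction rule: free_Abelian_group_induct[consumes 1, case_names zero diff gen])
    case zero
    have k0: "k (tensor_class 0) = \<zero>\<^bsub>Z\<^esub>" using k(1)[of 0] k(2)[of 0 0] by simp
    show ?case using k0 c by (simp add: ract_def Z.rsmult_zero_left)
  next
    case (diff x y)
    have xy: "Poly_Mapping.keys (x - y) \<subseteq> carrier A \<times> carrier U" using diff keys_diff[of x y] by blast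
    have "k (tensor_class (ract c (x - y))) \<oplus>\<^bsub>Z\<^esub> k (tensor_class (ract c y)) = k (tensor_class (ract c x))"
      using k(2)[OF keys_ract[OF xy c] keys_ract[OF diff(2) c]] by (simp add: ract_def frag_extend_diff)
    also have "\<dots> = k (tensor_class (x - y)) \<cdot>\<^bsub>Z\<^esub> c \<oplus>\<^bsub>Z\<^esub> k (tensor_class (ract c y))"
      using k(2)[OF xy diff(2)] diff c k(1) xy by (simp add: Z.rsmult_l_distr)
    finally show ?case using k(1) keys_ract xy diff c by simp
  next
    case (gen p)
    then show ?case using c \<phi>D by (auto simp: ract_def k(3))
  qed
  show thesis
  proof
    show "restrict k (carrier (bitensor R A U)) \<in> right_hom C (bitensor R A U) Z"
      by (rule right_homI)
        (auto elim!: tensor_bimodule_cases simp: k lin add_tensor_bimodule rsmult_tensor_bimodule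
          carrier_tensor_bimodule keys_ract order_trans[OF keys_add])
    show "restrict k (carrier (bitensor R A U)) (pure_tensor a u) = \<phi> a u"
      if "a \<in> carrier A" "u \<in> carrier U" for a u
      using that by (simp add: k pure_tensor_closed)
  qed
qed

text \<open>The converse direction of the adjunction: functionals on the tensor product are
  curried.\<close>

lemma right_hom_dual:
  assumes h: "h \<in> right_hom C (bitensor R A U) Z"
  shows "(\<lambda>a\<in>carrier A. \<lambda>u\<in>carrier U. h (pure_tensor a u)) \<in> right_hom R A (dual C Z U)"
  using right_homD[OF h]
  by (intro right_homI)
     (auto intro!: right_homI simp: pure_tensor_eq[symmetric] pure_tensor_closed, 
      auto simp: pure_tensor_eq pure_tensor_closed fun_eq_iff)

end

section \<open>Homomorphisms and commuting maps in terms of elements\<close>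

lemma left_homI:
  assumes "\<And>x. x \<in> carrier M \<Longrightarrow> f x \<in> carrier N" "f \<in> extensional (carrier M)"
    "\<And>x y. x \<in> carrier M \<Longrightarrow> y \<in> carrier M \<Longrightarrow> f (x \<oplus>\<^bsub>M\<^esub> y) = f x \<oplus>\<^bsub>N\<^esub> f y"
    "\<And>r x. r \<in> carrier R \<Longrightarrow> x \<in> carrier M \<Longrightarrow> f (r \<odot>\<^bsub>M\<^esub> x) = r \<odot>\<^bsub>N\<^esub> f x"
  shows "f \<in> left_hom R M N"
  using assms by (auto simp: left_hom_def hom_def)

lemma left_homD:
  assumes "f \<in> left_hom R M N"
  shows "x \<in> carrier M \<Longrightarrow> f x \<in> carrier N" "f \<in> extensional (carrier M)"
    "x \<in> carrier M \<Longrightarrow> y \<in> carrier M \<Longrightarrow> f (x \<oplus>\<^bsub>M\<^esub> y) = f x \<oplus>\<^bsub>N\<^esub> f y"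
    "r \<in> carrier R \<Longrightarrow> x \<in> carrier M \<Longrightarrow> f (r \<odot>\<^bsub>M\<^esub> x) = r \<odot>\<^bsub>N\<^esub> f x"
  using assms by (auto simp: left_hom_def hom_def)

lemma biend_sel [simp]:
  "carrier (left_biend R M) = commuting_maps M (left_hom R M M)"
  "carrier (right_biend R Y) = commuting_maps Y (right_hom R Y Y)"
  by (simp_all add: left_biend_def right_biend_def)

lemma commuting_mapsI:
  assumes "\<And>x. x \<in> carrier M \<Longrightarrow> g x \<in> carrier M" "g \<in> extensional (carrier M)"
    "\<And>x y. x \<in> carrier M \<Longrightarrow> y \<in> carrier M \<Longrightarrow> g (x \<oplus>\<^bsub>M\<^esub> y) = g x \<oplus>\<^bsub>M\<^esub> g y"
    "\<And>f x. f \<in> E \<Longrightarrow> x \<in> carrier M \<Longrightarrow> g (f x) = f (g x)"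
  shows "g \<in> commuting_maps M E"
  using assms by (auto simp: commuting_maps_def hom_def compose_def fun_eq_iff)

lemma commuting_mapsD:
  assumes "g \<in> commuting_maps M E"
  shows "x \<in> carrier M \<Longrightarrow> g x \<in> carrier M" "g \<in> extensional (carrier M)"
    "x \<in> carrier M \<Longrightarrow> y \<in> carrier M \<Longrightarrow> g (x \<oplus>\<^bsub>M\<^esub> y) = g x \<oplus>\<^bsub>M\<^esub> g y"
    "f \<in> E \<Longrightarrow> x \<in> carrier M \<Longrightarrow> g (f x) = f (g x)"
proof -
  show "g (f x) = f (g x)" if "f \<in> E" "x \<in> carrier M"
  proof -
    have "compose (carrier M) g f = compose (carrier M) f g"
      using assms that by (simp add: commuting_maps_def)
    from fun_cong[OF this, of x] that show ?thesis by (simp add: compose_def)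
  qed
qed (use assms in \<open>auto simp: commuting_maps_def hom_def\<close>)

section \<open>The dual: module structure, separation of points, injectivity\<close>

lemma (in bimodule) right_module_dual:
  assumes "right_module C Z" shows "right_module R (dual C Z U)"
proof -
  interpret Z: right_module C Z by fact
  note D = right_homD[where C = C and M = "right_part U" and N = Z, simplified]
  have neg: "(\<lambda>u\<in>carrier U. \<ominus>\<^bsub>Z\<^esub> \<rho> u) \<in> right_hom C (right_part U) Z"
    if \<rho>: "\<rho> \<in> right_hom C (right_part U) Z" for \<rho>
    using D[OF \<rho>] by (intro right_homI) (auto simp: Z.M.minus_add Z.rsmult_minus_left)
  have zero: "(\<lambda>u\<in>carrier U. \<zero>\<^bsub>Z\<^esub>) \<in> right_hom C (right_part U) Z"
    by (intro right_homI) (auto simp: Z.rsmult_zero_left)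
  have add: "(\<lambda>u\<in>carrier U. \<rho> u \<oplus>\<^bsub>Z\<^esub> \<sigma> u) \<in> right_hom C (right_part U) Z"
    if "\<rho> \<in> right_hom C (right_part U) Z" "\<sigma> \<in> right_hom C (right_part U) Z" for \<rho> \<sigma>
    using D[OF that(1)] D[OF that(2)]
    by (intro right_homI) (auto simp: Z.M.a_ac Z.rsmult_l_distr)
  have smul: "(\<lambda>u\<in>carrier U. \<rho> (r \<odot>\<^bsub>U\<^esub> u)) \<in> right_hom C (right_part U) Z"
    if "\<rho> \<in> right_hom C (right_part U) Z" "r \<in> carrier R" for \<rho> r
    using D[OF that(1)] that(2)
    by (intro right_homI) (auto simp: U.lsmult_r_distr simp flip: bi_rsmult_lsmult)
  have ext: "\<rho> = \<sigma>" if "\<rho> \<in> right_hom C (right_part U) Z" "\<sigma> \<in> right_hom C (right_part U) Z"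
    "\<And>u. u \<in> carrier U \<Longrightarrow> \<rho> u = \<sigma> u" for \<rho> \<sigma>
    using extensionalityI[OF D(2)[OF that(1)] D(2)[OF that(2)]] that(3) by blast
  have "abelian_group (dual C Z U)"
  proof (rule abelian_groupI)
    fix \<rho> assume "\<rho> \<in> carrier (dual C Z U)"
    then show "\<exists>\<sigma>\<in>carrier (dual C Z U). \<sigma> \<oplus>\<^bsub>dual C Z U\<^esub> \<rho> = \<zero>\<^bsub>dual C Z U\<^esub>"
      using neg[of \<rho>] D(1)[of \<rho>]
      by (intro bexI[of _ "\<lambda>u\<in>carrier U. \<ominus>\<^bsub>Z\<^esub> \<rho> u"]) (auto simp: Z.M.l_neg cong: restrict_cong)
  next
    fix \<rho> assume "\<rho> \<in> carrier (dual C Z U)"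
    then show "\<zero>\<^bsub>dual C Z U\<^esub> \<oplus>\<^bsub>dual C Z U\<^esub> \<rho> = \<rho>"
      using add[OF zero, of \<rho>] D(1)[of \<rho>] by (intro ext) auto
  qed (use add zero D(1) in \<open>auto intro!: restrict_ext simp: Z.M.a_ac\<close>)
  then show ?thesis
  proof (intro right_module.intro right_module_axioms.intro U.R.ring_axioms)
    fix \<rho> assume "\<rho> \<in> carrier (dual C Z U)"
    then show "\<rho> \<cdot>\<^bsub>dual C Z U\<^esub> \<one>\<^bsub>R\<^esub> = \<rho>"
      by (intro ext) (use smul in auto)
  qed (use smul D(1,3) in \<open>auto intro!: restrict_ext simp: U.lsmult_l_distr U.lsmult_assoc\<close>)
qed

locale bimodule_dual = bimodule R C U
  for R :: "'r ring" and C :: "'c ring" and U :: "('r, 'c, 'u) bimodule" +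
  fixes Z :: "('c, 'z) rmodule"
  assumes injective: "injective_module TYPE('c set) C Z"
    and cogenerator: "cogenerator TYPE('c set) C Z"
begin

abbreviation Ud :: "('r, 'u \<Rightarrow> 'z) rmodule" where "Ud \<equiv> dual C Z U"

sublocale Z: right_module C Z
  using cogenerator by (simp add: cogenerator_def)

sublocale dual: right_module R Ud
  by (rule right_module_dual) (rule Z.right_module_axioms)

lemmas dualD = right_homD[where C = C and M = "right_part U" and N = Z, simplified]

text \<open>The cogenerator property for \<open>U\<close>, applied to the difference of
  \<open>u\<close> and \<open>v\<close>.\<close>

lemma dual_separates:
  assumes "u \<in> carrier U" "v \<in> carrier U" "\<And>\<sigma>. \<sigma> \<in> carrier Ud \<Longrightarrow> \<sigma> u = \<sigma> v"
  shows "u = v"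
proof (rule ccontr)
  assume ne: "u \<noteq> v"
  define w where "w = u \<ominus>\<^bsub>U\<^esub> v"
  have w: "w \<in> carrier U" "u = w \<oplus>\<^bsub>U\<^esub> v"
    using assms(1,2) by (auto simp: w_def U.M.minus_eq U.M.a_assoc U.M.l_neg)
  then have "w \<noteq> \<zero>\<^bsub>U\<^esub>" using assms(2) ne by auto
  obtain \<sigma> where \<sigma>: "\<sigma> \<in> right_hom C (right_part U) Z" "\<sigma> w \<noteq> \<zero>\<^bsub>Z\<^esub>"
    using cogenerator_universe[OF injective cogenerator, where 'm = 'u] right.right_module_axioms w(1) \<open>w \<noteq> \<zero>\<^bsub>U\<^esub>\<close>
    unfolding cogenerator_def by fastforce
  have "\<sigma> u = \<sigma> w \<oplus>\<^bsub>Z\<^esub> \<sigma> v" using dualD(3)[OF \<sigma>(1), of w v] w assms by simp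
  moreover have "\<sigma> u = \<sigma> v" using \<sigma>(1) assms(3) by simp
  ultimately show False using \<sigma>(2) dualD(1)[OF \<sigma>(1)] w(1) assms(2) by simp
qed

text \<open>\<open>tensor_map\<close> takes the only element of the image of a whole coset. The
  formula is therefore meaningful once that image is constant, which holds because the map on formal
  sums respects the null groups.\<close>

lemma tensor_map_class:
  assumes "right_module R A" "right_module R B" "i \<in> right_hom R A B"
    and x: "Poly_Mapping.keys x \<subseteq> carrier A \<times> carrier U"
  shows "tensor_map R B U i (tensor.tensor_class R A U x)
    = tensor.tensor_class R B U (frag_extend (\<lambda>(a, u). frag_of (i a, u)) x)"
proof -
  interpret A: tensor_bimodule R C U A by (intro tensor_bimodule.intro bimodule_axioms assms)
  interpret B: tensor_bimodule R C U B by (intro tensor_bimodule.intro bimodule_axioms assms)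
  note iD = right_homD[OF assms(3)]
  have "B.tensor_class (frag_extend (\<lambda>(a, u). frag_of (i a, u)) y)
      = B.tensor_class (frag_extend (\<lambda>(a, u). frag_of (i a, u)) x)"
    if "y \<in> A.tensor_class x" for y
  proof -
    have y: "Poly_Mapping.keys y \<subseteq> carrier A \<times> carrier U" "y - x \<in> tensor_null R A U"
      using A.mem_tensor_class[OF x that] A.tensor_class_eq_iff x by auto
    have "frag_extend (\<lambda>(a, u). frag_of (i a, u)) (y - x) \<in> tensor_null R B U"
      by (rule tensor_null_map[OF A.tensor_axioms B.tensor_axioms, where g = "\<lambda>u. u"])
         (use iD y in auto)
    moreover have "Poly_Mapping.keys (frag_extend (\<lambda>(a, u). frag_of (i a, u)) z) \<subseteq> carrier B \<times> carrier U"
      if "Poly_Mapping.keys z \<subseteq> carrier A \<times> carrier U" for z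
      using that iD(1) by (intro keys_frag_extend_pairs[where g = "\<lambda>u. u"]) auto
    ultimately show ?thesis using x y by (simp add: B.tensor_class_eq_iff frag_extend_diff)
  qed
  then have "(\<lambda>y. B.tensor_class (frag_extend (\<lambda>(a, u). frag_of (i a, u)) y)) ` A.tensor_class x
      = (\<lambda>y. B.tensor_class (frag_extend (\<lambda>(a, u). frag_of (i a, u)) x)) ` A.tensor_class x"
    by (rule image_cong[OF refl])
  also have "\<dots> = {B.tensor_class (frag_extend (\<lambda>(a, u). frag_of (i a, u)) x)}"
    by (rule image_constant[OF A.tensor_class_self[OF x]])
  finally show ?thesis by (simp add: tensor_map_def B.tensor_class_def)
qed

text \<open>Lambek's argument: homomorphisms \<open>A \<rightarrow> U*\<close> are homomorphisms \<open>A \<otimes> U \<rightarrow> Z\<close>, and by flatness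
  the latter extend along \<open>A \<otimes> U \<rightarrow> B \<otimes> U\<close>.\<close>

lemma injective_dual:
  assumes flat: "flat_module TYPE('r set) R U"
  shows "injective_module TYPE('r set) R Ud"
  unfolding injective_module_def
proof (intro conjI allI impI ballI)
  show "right_module R Ud" by (rule dual.right_module_axioms)
  fix A B :: "('r, 'r set) rmodule" and i \<phi>
  assume A: "right_module R A" and B: "right_module R B" and i: "i \<in> right_hom R A B"
    and inj: "inj_on i (carrier A)" and \<phi>: "\<phi> \<in> right_hom R A Ud"
  interpret A: tensor_bimodule R C U A by (intro tensor_bimodule.intro bimodule_axioms A)
  interpret B: tensor_bimodule R C U B by (intro tensor_bimodule.intro bimodule_axioms B)
  note iD = right_homD[OF i]
  let ?F = "frag_extend (\<lambda>(a, u). frag_of (i a, u))"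
  let ?i = "restrict (tensor_map R B U i) (carrier (bitensor R A U))"
  have map: "tensor_map R B U i (A.tensor_class x) = B.tensor_class (?F x)"
    if "Poly_Mapping.keys x \<subseteq> carrier A \<times> carrier U" for x
    using tensor_map_class[OF A B i that] .
  have kF: "Poly_Mapping.keys (?F x) \<subseteq> carrier B \<times> carrier U"
    if "Poly_Mapping.keys x \<subseteq> carrier A \<times> carrier U" for x
    using that iD(1) by (intro keys_frag_extend_pairs[where g = "\<lambda>u. u"]) auto
  have kadd: "Poly_Mapping.keys (x + y) \<subseteq> carrier A \<times> carrier U"
    if "Poly_Mapping.keys x \<subseteq> carrier A \<times> carrier U" "Poly_Mapping.keys y \<subseteq> carrier A \<times> carrier U"
    for x y :: "'r set \<times> 'u \<Rightarrow>\<^sub>0 int" using that keys_add[of x y] by blast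
  \<comment> \<open>The map \<open>i\<close> acts on the first factor and \<open>c\<close> on the
    second, so they commute already on formal sums; this makes the tensored map
    \<open>C\<close>-linear.\<close>
  have Fract: "?F (A.ract c x) = B.ract c (?F x)" for c x
    by (rule frag_induction[of x UNIV])
       (auto simp: A.ract_def B.ract_def frag_extend_diff)
  have hom_i: "?i \<in> right_hom C (bitensor R A U) (bitensor R B U)"
    by (rule right_homI)
       (auto elim!: A.tensor_bimodule_cases simp: map kF kadd A.carrier_tensor_bimodule
         A.add_tensor_bimodule B.add_tensor_bimodule A.rsmult_tensor_bimodule
         B.rsmult_tensor_bimodule A.keys_ract Fract frag_extend_add B.carrier_tensor_bimodule)
  have "inj_on (tensor_map R B U i) (carrier (tensor_product R A U))"
    using flat A B i inj unfolding flat_module_def by blast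
  then have inj_i: "inj_on ?i (carrier (bitensor R A U))"
    by (auto simp: bitensor_def inj_on_def)
  obtain k where k: "k \<in> right_hom C (bitensor R A U) Z"
    "\<And>a u. a \<in> carrier A \<Longrightarrow> u \<in> carrier U \<Longrightarrow> k (A.pure_tensor a u) = \<phi> a u"
    by (rule A.right_hom_tensor_bimodule[OF Z.right_module_axioms \<phi>]) (rule that)
  \<comment> \<open>The modules to extend along are tensor products, whose elements are sets of
    formal sums, so injectivity of \<open>Z\<close> is needed beyond the universe
    \<open>'c set\<close>.\<close>
  from injective_moduleD[OF injective_module_universe[OF injective]
      A.right_module_tensor_bimodule B.right_module_tensor_bimodule hom_i inj_i k(1)]
  obtain h where h: "h \<in> right_hom C (bitensor R B U) Z"
    "\<And>K. K \<in> carrier (bitensor R A U) \<Longrightarrow> h (?i K) = k K" by blast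
  show "\<exists>\<psi>\<in>right_hom R B Ud. \<forall>a\<in>carrier A. \<psi> (i a) = \<phi> a"
  proof (intro bexI ballI)
    show "(\<lambda>b\<in>carrier B. \<lambda>u\<in>carrier U. h (B.pure_tensor b u)) \<in> right_hom R B Ud"
      by (rule B.right_hom_dual[OF h(1)])
    fix a assume a: "a \<in> carrier A"
    have "h (B.pure_tensor (i a) u) = \<phi> a u" if "u \<in> carrier U" for u
      using h(2)[OF A.pure_tensor_closed[OF a that]] map[of "frag_of (a, u)"] k(2) a that
        A.pure_tensor_closed[OF a that] by simp
    moreover have "\<phi> a \<in> extensional (carrier U)"
      using right_homD(1)[OF \<phi> a] dualD(2) by simp
    ultimately show "(\<lambda>b\<in>carrier B. \<lambda>u\<in>carrier U. h (B.pure_tensor b u)) (i a) = \<phi> a"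
      using iD(1)[OF a] by (auto intro!: extensionalityI[of _ "carrier U"])
  qed
qed

text \<open>By \<open>sep\<close> the map from \<open>R\<close> onto the cyclic submodule
  \<open>wR\<close> is bijective, so \<open>wr \<mapsto> \<sigma>r\<close> is a well-defined
  homomorphism on \<open>wR\<close>. Injectivity of the dual extends it to \<open>W\<close>.\<close>

lemma dual_hom_through:
  assumes flat: "flat_module TYPE('r set) R U" and W: "right_module R W" and w: "w \<in> carrier W"
    and sep: "\<And>r. r \<in> carrier R \<Longrightarrow> w \<cdot>\<^bsub>W\<^esub> r = \<zero>\<^bsub>W\<^esub> \<Longrightarrow> r = \<zero>\<^bsub>R\<^esub>"
    and \<sigma>: "\<sigma> \<in> carrier Ud"
  obtains \<psi> where "\<psi> \<in> right_hom R W Ud" "\<psi> w = \<sigma>"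
proof -
  interpret W: right_module R W by fact
  let ?A = "W\<lparr>carrier := (\<lambda>r. w \<cdot>\<^bsub>W\<^esub> r) ` carrier R\<rparr>"
  let ?i = "\<lambda>x\<in>carrier ?A. x"
  have A: "right_module R ?A" by (rule right_module_cyclic[OF W w])
  have inj: "r = s" if "r \<in> carrier R" "s \<in> carrier R" "w \<cdot>\<^bsub>W\<^esub> r = w \<cdot>\<^bsub>W\<^esub> s" for r s
  proof -
    define d where "d = r \<oplus>\<^bsub>R\<^esub> \<ominus>\<^bsub>R\<^esub> s"
    have d: "d \<in> carrier R" "r = d \<oplus>\<^bsub>R\<^esub> s"
      using that by (simp_all add: d_def U.R.a_assoc U.R.l_neg)
    have "w \<cdot>\<^bsub>W\<^esub> d \<oplus>\<^bsub>W\<^esub> w \<cdot>\<^bsub>W\<^esub> s = w \<cdot>\<^bsub>W\<^esub> s"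
      using that(3) d(1) that(2) w unfolding d(2) by (simp add: W.rsmult_r_distr)
    then have "w \<cdot>\<^bsub>W\<^esub> d = \<zero>\<^bsub>W\<^esub>" using d(1) that(2) w by simp
    then show ?thesis using sep[OF d(1)] d that(2) by simp
  qed
  define \<phi> where "\<phi> = (\<lambda>x\<in>carrier ?A. \<sigma> \<cdot>\<^bsub>Ud\<^esub> (inv_into (carrier R) (\<lambda>r. w \<cdot>\<^bsub>W\<^esub> r) x))"
  have \<phi>: "\<phi> (w \<cdot>\<^bsub>W\<^esub> r) = \<sigma> \<cdot>\<^bsub>Ud\<^esub> r" if "r \<in> carrier R" for r
  proof -
    have "inv_into (carrier R) (\<lambda>r. w \<cdot>\<^bsub>W\<^esub> r) (w \<cdot>\<^bsub>W\<^esub> r) = r"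
      by (rule inv_into_f_f[OF _ that]) (use inj in \<open>auto simp: inj_on_def\<close>)
    then show ?thesis using that by (simp add: \<phi>_def del: dual_sel)
  qed
  have "\<phi> \<in> right_hom R ?A Ud"
  proof (rule right_homI)
    show "\<phi> \<in> extensional (carrier ?A)" by (simp add: \<phi>_def)
    show "\<phi> x \<in> carrier Ud" if "x \<in> carrier ?A" for x
      using that \<sigma> by (auto simp: \<phi> simp del: dual_sel)
    show "\<phi> (x \<oplus>\<^bsub>?A\<^esub> y) = \<phi> x \<oplus>\<^bsub>Ud\<^esub> \<phi> y" if "x \<in> carrier ?A" "y \<in> carrier ?A" for x y
    proof -
      obtain r s where rs: "r \<in> carrier R" "s \<in> carrier R" "x = w \<cdot>\<^bsub>W\<^esub> r" "y = w \<cdot>\<^bsub>W\<^esub> s"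
        using \<open>x \<in> carrier ?A\<close> \<open>y \<in> carrier ?A\<close> by auto
      then have "x \<oplus>\<^bsub>?A\<^esub> y = w \<cdot>\<^bsub>W\<^esub> (r \<oplus>\<^bsub>R\<^esub> s)" using w by (simp add: W.rsmult_r_distr)
      then show ?thesis using rs \<sigma> by (simp add: \<phi> dual.rsmult_r_distr del: dual_sel)
    qed
    show "\<phi> (x \<cdot>\<^bsub>?A\<^esub> s) = \<phi> x \<cdot>\<^bsub>Ud\<^esub> s" if "x \<in> carrier ?A" "s \<in> carrier R" for x s
    proof -
      obtain r where r: "r \<in> carrier R" "x = w \<cdot>\<^bsub>W\<^esub> r" using \<open>x \<in> carrier ?A\<close> by auto
      then have "x \<cdot>\<^bsub>?A\<^esub> s = w \<cdot>\<^bsub>W\<^esub> (r \<otimes>\<^bsub>R\<^esub> s)" using w that by (simp add: W.rsmult_assoc)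
      then show ?thesis using r that \<sigma> by (simp add: \<phi> dual.rsmult_assoc del: dual_sel)
    qed
  qed
  moreover have "?i \<in> right_hom R ?A W"
    using right_module.rsmult_closed[OF A] abelian_group.axioms
    by (intro right_homI) (use w in \<open>auto simp flip: W.rsmult_r_distr W.rsmult_assoc\<close>)
  moreover have "inj_on ?i (carrier ?A)" by (auto simp: inj_on_def)
  \<comment> \<open>Flatness yields injectivity of the dual for test modules over
    \<open>'r set\<close>; Baer's criterion carries it to the type of \<open>W\<close>.\<close>
  ultimately obtain \<psi> where \<psi>: "\<psi> \<in> right_hom R W Ud" "\<And>x. x \<in> carrier ?A \<Longrightarrow> \<psi> (?i x) = \<phi> x"
    using injective_moduleD[OF injective_module_universe[OF injective_dual[OF flat]] A W] by blast
  have "w \<in> carrier ?A" using w by (auto intro!: image_eqI[of _ _ "\<one>\<^bsub>R\<^esub>"])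
  from \<psi>(2)[OF this] this have "\<psi> w = \<phi> (w \<cdot>\<^bsub>W\<^esub> \<one>\<^bsub>R\<^esub>)" using w by simp
  also have "\<dots> = \<sigma>" using \<phi>[of "\<one>\<^bsub>R\<^esub>"] \<sigma> dual.rsmult_one by (simp del: dual_sel)
  finally show thesis using \<psi>(1) that by blast
qed

text \<open>The map \<open>g\<close> is given by \<open>t \<otimes> u = w \<otimes> g(u)\<close> in \<open>W \<otimes> U\<close>. If \<open>t \<otimes> u\<close> were not in \<open>w \<otimes> U\<close>, the
  cogenerator would supply \<open>\<psi> : W \<rightarrow> U*\<close> with \<open>\<psi>(w) = 0\<close> and \<open>\<psi>(t) \<noteq> 0\<close>. As \<open>g\<close> is defined without
  reference to \<open>C\<close>, it commutes with every \<open>R\<close>-endomorphism \<open>f\<close> of \<open>U\<close>: apply \<open>W \<otimes> f\<close>.\<close>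

lemma biend_of_compatible_map:
  assumes flat: "flat_module TYPE('r set) R U" and W: "right_module R W"
    and w: "w \<in> carrier W" and t: "t \<in> carrier W"
    and sep: "\<And>r. r \<in> carrier R \<Longrightarrow> w \<cdot>\<^bsub>W\<^esub> r = \<zero>\<^bsub>W\<^esub> \<Longrightarrow> r = \<zero>\<^bsub>R\<^esub>"
    and h: "\<And>\<psi>. \<psi> \<in> right_hom R W Ud \<Longrightarrow> h (\<psi> w) = \<psi> t"
  obtains g where "g \<in> carrier (left_biend R U)"
    "\<And>\<sigma>. \<sigma> \<in> carrier Ud \<Longrightarrow> h \<sigma> = compose (carrier U) \<sigma> g"
proof -
  interpret W: tensor_bimodule R C U W by (intro tensor_bimodule.intro bimodule_axioms W)
  interpret T: right_module C "bitensor R W U" by (rule W.right_module_tensor_bimodule)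
  \<comment> \<open>Nothing is assumed about additivity of \<open>h\<close>; its value at zero is
    read off from the zero homomorphism, which sends both \<open>w\<close> and \<open>t\<close> to
    zero.\<close>
  have zero: "h \<zero>\<^bsub>Ud\<^esub> = \<zero>\<^bsub>Ud\<^esub>"
  proof -
    have "(\<lambda>x\<in>carrier W. \<zero>\<^bsub>Ud\<^esub>) \<in> right_hom R W Ud"
      by (intro right_homI) (auto simp: dual.rsmult_zero_left simp del: dual_sel)
    from h[OF this] w t show ?thesis by (simp del: dual_sel)
  qed
  let ?P = "W.pure_tensor w ` carrier U"
  have "\<exists>v\<in>carrier U. W.pure_tensor t u = W.pure_tensor w v" if u: "u \<in> carrier U" for u
  proof (rule ccontr)
    assume "\<not> ?thesis"
    then have nP: "W.pure_tensor t u \<notin> ?P" by blast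
    obtain f where f: "f \<in> right_hom C (bitensor R W U) Z" "\<And>p. p \<in> ?P \<Longrightarrow> f p = \<zero>\<^bsub>Z\<^esub>"
      "f (W.pure_tensor t u) \<noteq> \<zero>\<^bsub>Z\<^esub>"
    proof (rule cogenerator_submodule[OF injective cogenerator W.right_module_tensor_bimodule, of ?P])
      show "?P \<subseteq> carrier (bitensor R W U)" using w by (auto simp: W.pure_tensor_closed)
      show "x \<oplus>\<^bsub>bitensor R W U\<^esub> y \<in> ?P" if "x \<in> ?P" "y \<in> ?P" for x y
        using that w by (auto simp flip: W.pure_tensor_add_right)
      show mul: "x \<cdot>\<^bsub>bitensor R W U\<^esub> c \<in> ?P" if "x \<in> ?P" "c \<in> carrier C" for x c
        using that w by (auto simp: W.pure_tensor_rsmult)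
      have "W.pure_tensor w \<zero>\<^bsub>U\<^esub> \<cdot>\<^bsub>bitensor R W U\<^esub> \<zero>\<^bsub>C\<^esub> \<in> ?P" by (rule mul) auto
      then show "\<zero>\<^bsub>bitensor R W U\<^esub> \<in> ?P"
        using T.rsmult_zero_right[OF W.pure_tensor_closed[OF w]] by simp
      show "W.pure_tensor t u \<in> carrier (bitensor R W U)" using t u by (simp add: W.pure_tensor_closed)
    qed (use nP in blast)+
    let ?\<psi> = "\<lambda>a\<in>carrier W. \<lambda>u\<in>carrier U. f (W.pure_tensor a u)"
    have \<psi>: "?\<psi> \<in> right_hom R W Ud" by (rule W.right_hom_dual[OF f(1)])
    have "?\<psi> w = \<zero>\<^bsub>Ud\<^esub>" using w f(2) by (auto cong: restrict_cong)
    then have "?\<psi> t = \<zero>\<^bsub>Ud\<^esub>" using h[OF \<psi>] zero by simp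
    from fun_cong[OF this, of u] f(3) t u show False by simp
  qed
  then obtain g0 where g0: "\<And>u. u \<in> carrier U \<Longrightarrow> g0 u \<in> carrier U"
    "\<And>u. u \<in> carrier U \<Longrightarrow> W.pure_tensor t u = W.pure_tensor w (g0 u)" by metis
  \<comment> \<open>Every \<sigma> in the dual is \<open>\<psi> w\<close> for some \<psi>, and
    \<psi> induces a map on the tensor product with value \<open>\<sigma> v\<close> at
    \<open>w\<close> tensor \<open>v\<close>. So equal tensors force
    \<open>\<sigma> v = \<sigma> v'\<close> for all \<sigma>.\<close>
  have uniq: "v = v'" if v: "v \<in> carrier U" "v' \<in> carrier U" "W.pure_tensor w v = W.pure_tensor w v'" for v v'
  proof (rule dual_separates[OF v(1,2)])
    fix \<sigma> assume "\<sigma> \<in> carrier Ud"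
    then obtain \<psi> where \<psi>: "\<psi> \<in> right_hom R W Ud" "\<psi> w = \<sigma>"
      using dual_hom_through[OF flat W w sep] by blast
    obtain k where "\<And>a u. a \<in> carrier W \<Longrightarrow> u \<in> carrier U \<Longrightarrow> k (W.pure_tensor a u) = \<psi> a u"
      using W.right_hom_tensor_bimodule[OF Z.right_module_axioms \<psi>(1)] by blast
    from this[OF w v(1)] this[OF w v(2)] v(3) \<psi>(2) show "\<sigma> v = \<sigma> v'" by simp
  qed
  let ?g = "\<lambda>u\<in>carrier U. g0 u"
  have g: "?g \<in> carrier (left_biend R U)"
    unfolding biend_sel
  proof (rule commuting_mapsI)
    show "?g (u \<oplus>\<^bsub>U\<^esub> v) = ?g u \<oplus>\<^bsub>U\<^esub> ?g v" if uv: "u \<in> carrier U" "v \<in> carrier U" for u v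
    proof -
      have "W.pure_tensor w (g0 (u \<oplus>\<^bsub>U\<^esub> v)) = W.pure_tensor t (u \<oplus>\<^bsub>U\<^esub> v)"
        using uv g0(2) by simp
      also have "\<dots> = W.pure_tensor w (g0 u \<oplus>\<^bsub>U\<^esub> g0 v)"
        using uv g0 w t by (simp add: W.pure_tensor_add_right)
      finally have "g0 (u \<oplus>\<^bsub>U\<^esub> v) = g0 u \<oplus>\<^bsub>U\<^esub> g0 v" by (intro uniq) (use uv g0(1) in auto)
      then show ?thesis using uv by simp
    qed
    show "?g (f u) = f (?g u)" if f: "f \<in> left_hom R U U" and u: "u \<in> carrier U" for f u
    proof -
      note fD = left_homD[OF f]
      \<comment> \<open>Since \<open>f\<close> need not be \<open>C\<close>-linear, it is applied to
        the relation between formal sums rather than through homomorphisms of right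
        \<open>C\<close>-modules.\<close>
      have "frag_of (t, u) - frag_of (w, g0 u) \<in> tensor_null R W U"
        using g0[OF u] t w u by (subst W.tensor_class_eq_iff[symmetric]) auto
      then have "frag_extend (\<lambda>(a, u). frag_of (a, f u)) (frag_of (t, u) - frag_of (w, g0 u))
          \<in> tensor_null R W U"
        by (intro tensor_null_map[OF W.tensor_axioms W.tensor_axioms, where f = "\<lambda>a. a"])
           (use fD in auto)
      then have "frag_of (t, f u) - frag_of (w, f (g0 u)) \<in> tensor_null R W U"
        by (simp add: frag_extend_diff)
      then have "W.pure_tensor t (f u) = W.pure_tensor w (f (g0 u))"
        using t w u g0(1) fD(1) by (subst W.tensor_class_eq_iff) auto
      then have "g0 (f u) = f (g0 u)"
        using g0[OF fD(1)[OF u]] by (intro uniq) (use u g0(1) fD(1) in auto)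
      then show ?thesis using u fD(1) by simp
    qed
  qed (use g0(1) in auto)
  \<comment> \<open>The map induced by \<psi> on the tensor product, evaluated on both sides of the
    equation that defines \<open>g0 u\<close>, gives
    \<open>\<psi> t u = \<sigma> (g0 u)\<close>.\<close>
  moreover have "h \<sigma> = compose (carrier U) \<sigma> ?g" if \<sigma>: "\<sigma> \<in> carrier Ud" for \<sigma>
  proof -
    obtain \<psi> where \<psi>: "\<psi> \<in> right_hom R W Ud" "\<psi> w = \<sigma>"
      using dual_hom_through[OF flat W w sep \<sigma>] by blast
    obtain k where k: "\<And>a u. a \<in> carrier W \<Longrightarrow> u \<in> carrier U \<Longrightarrow> k (W.pure_tensor a u) = \<psi> a u"
      using W.right_hom_tensor_bimodule[OF Z.right_module_axioms \<psi>(1)] by blast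
    have "\<psi> t \<in> extensional (carrier U)" using right_homD(1)[OF \<psi>(1) t] dualD(2) by simp
    then have "\<psi> t = compose (carrier U) \<sigma> ?g"
    proof (rule extensionalityI)
      fix u assume u: "u \<in> carrier U"
      have "\<psi> t u = \<psi> w (g0 u)" using k[OF t u] k[OF w g0(1)[OF u]] g0(2)[OF u] by simp
      then show "\<psi> t u = compose (carrier U) \<sigma> ?g u" using u \<psi>(2) by (simp add: compose_def)
    qed (simp add: compose_def)
    then show ?thesis using h[OF \<psi>(1)] \<psi>(2) by simp
  qed
  ultimately show thesis by (rule that)
qed

end

section \<open>Adjoints and finite separating sets\<close>

lemma finite_sums_induct [consumes 2, case_names zero add gen]:
  assumes "abelian_monoid M" and x: "x \<in> finite_sums M S" and "P \<zero>\<^bsub>M\<^esub>"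
    and "\<And>x y. x \<in> carrier M \<Longrightarrow> y \<in> carrier M \<Longrightarrow> P x \<Longrightarrow> P y \<Longrightarrow> P (x \<oplus>\<^bsub>M\<^esub> y)"
    and S: "\<And>x. x \<in> S \<Longrightarrow> x \<in> carrier M \<and> P x"
  shows "x \<in> carrier M \<and> P x"
proof -
  interpret M: abelian_monoid M by fact
  obtain n :: nat and s where s: "s \<in> {..<n} \<rightarrow> S" "x = finsum M s {..<n}"
    using x by (auto simp: finite_sums_def)
  have "finsum M s {..<n} \<in> carrier M \<and> P (finsum M s {..<n})"
    using s(1)
  proof (induction n)
    case 0
    then show ?case using assms(3) by simp
  next
    case (Suc n)
    have "s \<in> {..<n} \<rightarrow> S" "s n \<in> S" using Suc.prems by (auto simp: Pi_iff)
    moreover have "s \<in> {..<n} \<rightarrow> carrier M" using calculation(1) S by blast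
    ultimately show ?case
      using Suc.IH S[of "s n"] assms(4) by (simp add: lessThan_Suc M.finsum_insert)
  qed
  then show ?thesis using s(2) by simp
qed

lemma (in left_module) lsmult_zero_right:
  assumes "r \<in> carrier R" shows "r \<odot>\<^bsub>M\<^esub> \<zero>\<^bsub>M\<^esub> = \<zero>\<^bsub>M\<^esub>"
  using lsmult_r_distr[of r "\<zero>\<^bsub>M\<^esub>" "\<zero>\<^bsub>M\<^esub>"] assms by simp

lemma (in left_module) lsmult_zero_left:
  assumes "x \<in> carrier M" shows "\<zero>\<^bsub>R\<^esub> \<odot>\<^bsub>M\<^esub> x = \<zero>\<^bsub>M\<^esub>"
  using lsmult_l_distr[of "\<zero>\<^bsub>R\<^esub>" "\<zero>\<^bsub>R\<^esub>" x] assms by simp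

lemma commuting_maps_zero:
  assumes "abelian_group M" "g \<in> commuting_maps M E" shows "g \<zero>\<^bsub>M\<^esub> = \<zero>\<^bsub>M\<^esub>"
proof -
  interpret M: abelian_group M by fact
  show ?thesis
    using commuting_mapsD(1,3)[OF assms(2), of "\<zero>\<^bsub>M\<^esub>"] by (metis M.add.l_cancel_one' M.l_zero M.zero_closed)
qed

lemma commuting_maps_id:
  assumes "abelian_group M" "\<And>f x. f \<in> E \<Longrightarrow> x \<in> carrier M \<Longrightarrow> f x \<in> carrier M"
  shows "(\<lambda>x\<in>carrier M. x) \<in> commuting_maps M E"
proof -
  interpret M: abelian_group M by fact
  show ?thesis by (rule commuting_mapsI) (use assms(2) in auto)
qed

context bimodule_dual
begin

lemma dual_eqI:
  assumes "\<rho> \<in> carrier Ud" "\<sigma> \<in> carrier Ud" "\<And>u. u \<in> carrier U \<Longrightarrow> \<rho> u = \<sigma> u"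
  shows "\<rho> = \<sigma>"
  using assms by (intro extensionalityI[of \<rho> "carrier U"]) (auto intro: dualD(2))

lemma dual_zero: "\<rho> \<in> carrier Ud \<Longrightarrow> \<rho> \<zero>\<^bsub>U\<^esub> = \<zero>\<^bsub>Z\<^esub>"
  using right_hom_zero[OF right.right_module_axioms Z.right_module_axioms] by simp

text \<open>Right multiplication by an element of \<open>C\<close> is an
  \<open>R\<close>-endomorphism of \<open>U\<close>, so \<open>g\<close> commutes with it and is
  \<open>C\<close>-linear.\<close>

lemma compose_biend_dual:
  assumes g: "g \<in> carrier (left_biend R U)" and \<rho>: "\<rho> \<in> carrier Ud"
  shows "compose (carrier U) \<rho> g \<in> carrier Ud"
proof -
  note gD = commuting_mapsD[OF g[simplified]] and \<rho>D = dualD[OF \<rho>[simplified]]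
  have "(\<lambda>u\<in>carrier U. bi_rsmult U u c) \<in> left_hom R U U" if "c \<in> carrier C" for c
    using that by (intro left_homI) (auto simp: bi_rsmult_l_distr bi_rsmult_lsmult)
  from gD(4)[OF this] gD(1)
  have "g (bi_rsmult U u c) = bi_rsmult U (g u) c" if "c \<in> carrier C" "u \<in> carrier U" for u c
    using that by simp
  then show ?thesis
    unfolding dual_sel using gD(1,3) \<rho>D by (intro right_homI) (auto simp: compose_def)
qed

text \<open>With \<open>f\<close> in the dual of \<open>U\<close> as a left module, \<open>w \<mapsto> f(w)v\<close> is an endomorphism
  of \<open>U\<close>, so \<open>g(f(w)v) = f(g w)v\<close>; hence \<open>(\<rho> \<circ> g) \<cdot> f(w) = \<rho> \<cdot> f(g w)\<close>, where an
  endomorphism of \<open>U*\<close> can be pulled out on the right.\<close>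

lemma adjoint_biend:
  assumes acc: "trace_accessible R U" and g: "g \<in> carrier (left_biend R U)"
  shows "adjoint C Z U g \<in> carrier (right_biend R Ud)"
  unfolding biend_sel
proof (rule commuting_mapsI)
  note gD = commuting_mapsD[OF g[simplified]]
  have adj: "adjoint C Z U g \<rho> = compose (carrier U) \<rho> g" if "\<rho> \<in> carrier Ud" for \<rho>
    using that by (simp only: adjoint_def restrict_apply if_True)
  show "adjoint C Z U g \<rho> \<in> carrier Ud" if "\<rho> \<in> carrier Ud" for \<rho>
    using compose_biend_dual[OF g that] by (simp only: adj[OF that])
  show "adjoint C Z U g \<in> extensional (carrier Ud)" by (simp add: adjoint_def)
  show "adjoint C Z U g (\<rho> \<oplus>\<^bsub>Ud\<^esub> \<sigma>) = adjoint C Z U g \<rho> \<oplus>\<^bsub>Ud\<^esub> adjoint C Z U g \<sigma>"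
    if "\<rho> \<in> carrier Ud" "\<sigma> \<in> carrier Ud" for \<rho> \<sigma>
    unfolding adj[OF that(1)] adj[OF that(2)] adj[OF dual.M.a_closed[OF that]]
    using gD(1) by (auto simp: compose_def intro!: restrict_ext)
  fix \<phi> \<rho> assume \<phi>: "\<phi> \<in> right_hom R Ud Ud" and \<rho>: "\<rho> \<in> carrier Ud"
  note \<phi>D = right_homD[OF \<phi>]
  let ?a = "compose (carrier U) (\<phi> \<rho>) g" and ?b = "\<phi> (compose (carrier U) \<rho> g)"
  have a: "?a \<in> carrier Ud" and \<rho>g: "compose (carrier U) \<rho> g \<in> carrier Ud" and b: "?b \<in> carrier Ud"
    using compose_biend_dual[OF g] \<phi>D(1) \<rho> by blast+
  have rank_one: "?b (f w \<odot>\<^bsub>U\<^esub> v) = ?a (f w \<odot>\<^bsub>U\<^esub> v)"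
    if f: "f \<in> left_hom R U (regular_left R)" and w: "w \<in> carrier U" and v: "v \<in> carrier U" for f w v
  proof -
    note fD = left_homD[OF f, unfolded regular_left_def, simplified]
    have "(\<lambda>w\<in>carrier U. f w \<odot>\<^bsub>U\<^esub> x) \<in> left_hom R U U" if "x \<in> carrier U" for x
      using that fD by (intro left_homI) (auto simp: U.lsmult_l_distr U.lsmult_assoc)
    from gD(4)[OF this w] have gf: "g (f w \<odot>\<^bsub>U\<^esub> x) = f (g w) \<odot>\<^bsub>U\<^esub> x" if "x \<in> carrier U" for x
      using that w gD(1) by simp
    have "compose (carrier U) \<rho> g \<cdot>\<^bsub>Ud\<^esub> f w = \<rho> \<cdot>\<^bsub>Ud\<^esub> f (g w)"
      using fD(1) w gf by (auto simp: compose_def intro!: restrict_ext)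
    then have "?b \<cdot>\<^bsub>Ud\<^esub> f w = \<phi> \<rho> \<cdot>\<^bsub>Ud\<^esub> f (g w)"
      using \<phi>D(4)[OF \<rho>g fD(1)[OF w]] \<phi>D(4)[OF \<rho> fD(1)[OF gD(1)[OF w]]] by simp
    \<comment> \<open>At \<open>v\<close> the left side is \<open>?b\<close> at
      \<open>f(w)v\<close>, the right side is \<open>\<phi> \<rho>\<close> at
      \<open>f(g w)v = g(f(w)v)\<close>, which is \<open>?a\<close> at \<open>f(w)v\<close>.\<close>
    from fun_cong[OF this, of v] show ?thesis
      using v w fD(1) gf by (simp add: compose_def)
  qed
  have "?b x = ?a x" if x: "x \<in> carrier U" for x
  proof -
    have xs: "x \<in> finite_sums U {t \<odot>\<^bsub>U\<^esub> u | t u. t \<in> trace_ideal R U \<and> u \<in> carrier U}"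
      using acc x by (simp add: trace_accessible_def)
    note aD = dualD[OF a[simplified]] and bD = dualD[OF b[simplified]]
    have ab_zero: "?b \<zero>\<^bsub>U\<^esub> = ?a \<zero>\<^bsub>U\<^esub>"
      by (simp only: dual_zero[OF a] dual_zero[OF b])
    \<comment> \<open>Elements of \<open>TU\<close> are sums of sums, so the agreement on the
      elements \<open>f(w)v\<close> is spread by two inductions. The first, over sums in the trace
      ideal, keeps \<open>u\<close> universally quantified for use in the second.\<close>
    have t: "t \<in> carrier R \<and> (\<forall>u\<in>carrier U. ?b (t \<odot>\<^bsub>U\<^esub> u) = ?a (t \<odot>\<^bsub>U\<^esub> u))"
      if "t \<in> trace_ideal R U" for t
      using U.R.abelian_monoid_axioms that unfolding trace_ideal_def
    proof (induction rule: finite_sums_induct)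
      case zero
      show ?case using ab_zero by (simp add: U.lsmult_zero_left)
    next
      case (add s t)
      then show ?case using aD(3) bD(3) by (simp add: U.lsmult_l_distr)
    next
      case (gen t)
      then show ?case
        using rank_one left_homD(1)[of _ R U "regular_left R"]
        by (auto simp: regular_left_def)
    qed
    have "x \<in> carrier U \<and> ?b x = ?a x"
      using U.M.abelian_monoid_axioms xs
    proof (induction rule: finite_sums_induct)
      case (add x y)
      then show ?case using aD(3) bD(3) by simp
    next
      case (gen x)
      then show ?case using t by auto
    qed (rule ab_zero)
    then show ?thesis by simp
  qed
  then have "?b = ?a" using dual_eqI[OF b a] by blast
  then show "adjoint C Z U g (\<phi> \<rho>) = \<phi> (adjoint C Z U g \<rho>)"
    by (simp only: adj[OF \<rho>] adj[OF \<phi>D(1)[OF \<rho>]])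
qed

text \<open>A separating set is obtained by enlarging a finite set of functionals as long as its
  annihilator in \<open>R\<close> is nonzero.\<close>

lemma finite_separating:
  assumes faithful: "faithful_left R U" and art: "right_artinian R"
  shows "\<exists>G. finite G \<and> separating R Ud G"
proof (rule ccontr)
  assume no: "\<not> ?thesis"
  define ann where "ann F = {r \<in> carrier R. \<forall>\<rho>\<in>F. \<rho> \<cdot>\<^bsub>Ud\<^esub> r = \<zero>\<^bsub>Ud\<^esub>}" for F
  have ideal: "right_ideal (ann F) R" if F: "F \<subseteq> carrier Ud" for F
  proof -
    have F': "\<rho> \<in> carrier Ud" if "\<rho> \<in> F" for \<rho> using F that by blast
    have mul: "r \<otimes>\<^bsub>R\<^esub> s \<in> ann F" if "r \<in> ann F" "s \<in> carrier R" for r s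
      using that F' by (auto simp: ann_def dual.rsmult_assoc dual.rsmult_zero_left simp del: dual_sel)
    have "subgroup (ann F) (add_monoid R)"
    proof (rule U.R.add.subgroupI)
      show "ann F \<noteq> {}"
        using F' dual.rsmult_zero_right by (auto simp: ann_def simp del: dual_sel intro!: exI[of _ "\<zero>\<^bsub>R\<^esub>"])
      show "\<ominus>\<^bsub>R\<^esub> r \<in> ann F" if "r \<in> ann F" for r
        using mul[OF that, of "\<ominus>\<^bsub>R\<^esub> \<one>\<^bsub>R\<^esub>"] that by (simp add: ann_def U.R.r_minus)
      show "r \<oplus>\<^bsub>R\<^esub> s \<in> ann F" if "r \<in> ann F" "s \<in> ann F" for r s
        using that F' by (auto simp: ann_def dual.rsmult_r_distr simp del: dual_sel)
    qed (auto simp: ann_def)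
    then show ?thesis by (simp add: right_ideal_def additive_subgroup_def mul)
  qed
  \<comment> \<open>A nonzero \<open>r\<close> annihilated by \<open>F\<close> has \<open>ru\<close>
    nonzero for some \<open>u\<close> by faithfulness, and some \<rho> does not vanish at
    \<open>ru\<close>; adjoining this \<rho> removes \<open>r\<close> from the annihilator.\<close>
  have ext: "\<exists>\<rho>\<in>carrier Ud. ann (insert \<rho> F) \<noteq> ann F" if F: "finite F" "F \<subseteq> carrier Ud" for F
  proof -
    obtain r where r: "r \<in> ann F" "r \<noteq> \<zero>\<^bsub>R\<^esub>"
      using no F by (auto simp: separating_def ann_def simp del: dual_sel)
    then have rR: "r \<in> carrier R" by (simp add: ann_def)
    then obtain u where u: "u \<in> carrier U" "r \<odot>\<^bsub>U\<^esub> u \<noteq> \<zero>\<^bsub>U\<^esub>"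
      using faithful r by (auto simp: faithful_left_def)
    then obtain \<rho> where \<rho>: "\<rho> \<in> carrier Ud" "\<rho> (r \<odot>\<^bsub>U\<^esub> u) \<noteq> \<rho> \<zero>\<^bsub>U\<^esub>"
      using dual_separates[of "r \<odot>\<^bsub>U\<^esub> u" "\<zero>\<^bsub>U\<^esub>"] rR by auto
    have "\<rho> \<zero>\<^bsub>U\<^esub> = \<zero>\<^bsub>Z\<^esub>" by (rule dual_zero[OF \<rho>(1)])
    then have "\<rho> \<cdot>\<^bsub>Ud\<^esub> r \<noteq> \<zero>\<^bsub>Ud\<^esub>" using \<rho>(2) u(1) by (auto dest: fun_cong[of _ _ u])
    then have "r \<notin> ann (insert \<rho> F)" by (simp add: ann_def del: dual_sel)
    then show ?thesis using r(1) \<rho>(1) by blast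
  qed
  have "\<exists>F. \<forall>n. (finite (F n) \<and> F n \<subseteq> carrier Ud) \<and>
      (\<exists>\<rho>. F (Suc n) = insert \<rho> (F n) \<and> ann (F (Suc n)) \<noteq> ann (F n))"
  proof (rule dependent_nat_choice)
    fix F and n :: nat assume F: "finite F \<and> F \<subseteq> carrier Ud"
    then obtain \<rho> where "\<rho> \<in> carrier Ud" "ann (insert \<rho> F) \<noteq> ann F" using ext[of F] by blast
    with F show "\<exists>F'. (finite F' \<and> F' \<subseteq> carrier Ud) \<and> (\<exists>\<rho>. F' = insert \<rho> F \<and> ann F' \<noteq> ann F)"
      by (intro exI[of _ "insert \<rho> F"]) blast
  qed (rule exI[of _ "{}"], simp)
  then obtain F where F: "\<And>n. finite (F n)" "\<And>n. F n \<subseteq> carrier Ud"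
    "\<And>n. \<exists>\<rho>. F (Suc n) = insert \<rho> (F n) \<and> ann (F (Suc n)) \<noteq> ann (F n)" by blast
  have "ann (F (Suc n)) \<subseteq> ann (F n)" for n using F(3)[of n] by (auto simp: ann_def)
  then obtain N where N: "\<forall>n\<ge>N. ann (F n) = ann (F N)"
    using art[unfolded right_artinian_def, rule_format, of "\<lambda>n. ann (F n)"] ideal F(2) by blast
  have "ann (F (Suc N)) = ann (F N)" by (rule N[rule_format]) simp
  then show False using F(3)[of N] by blast
qed

end

section \<open>Powers and copowers\<close>

text \<open>For the degenerate case of an empty index set, in which both biendomorphism rings have a
  single element.\<close>

lemma commuting_maps_unique:
  assumes "carrier M = {z}" "g \<in> commuting_maps M E" "h \<in> commuting_maps M E"
  shows "g = h"
  by (rule extensionalityI[OF commuting_mapsD(2)[OF assms(2)] commuting_mapsD(2)[OF assms(3)]])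
     (use commuting_mapsD(1)[OF assms(2)] commuting_mapsD(1)[OF assms(3)] assms(1) in auto)

lemma power_module_sel [simp]:
  "carrier (power_module G Y) = (\<Pi>\<^sub>E i\<in>G. carrier Y)"
  "\<zero>\<^bsub>power_module G Y\<^esub> = (\<lambda>i\<in>G. \<zero>\<^bsub>Y\<^esub>)"
  "x \<oplus>\<^bsub>power_module G Y\<^esub> y = (\<lambda>i\<in>G. x i \<oplus>\<^bsub>Y\<^esub> y i)"
  "x \<cdot>\<^bsub>power_module G Y\<^esub> r = (\<lambda>i\<in>G. x i \<cdot>\<^bsub>Y\<^esub> r)"
  by (simp_all add: power_module_def)

lemma right_module_power:
  assumes "right_module R Y" shows "right_module R (power_module G Y)"
proof -
  interpret Y: right_module R Y by fact
  have mem: "x i \<in> carrier Y" if "x \<in> (\<Pi>\<^sub>E i\<in>G. carrier Y)" "i \<in> G" for x i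
    using that by blast
  have "abelian_group (power_module G Y)"
  proof (rule abelian_groupI)
    fix x assume x: "x \<in> carrier (power_module G Y)"
    show "\<exists>y\<in>carrier (power_module G Y). y \<oplus>\<^bsub>power_module G Y\<^esub> x = \<zero>\<^bsub>power_module G Y\<^esub>"
      by (rule bexI[of _ "\<lambda>i\<in>G. \<ominus>\<^bsub>Y\<^esub> x i"]) (use x mem[of x] in \<open>auto simp: Y.M.l_neg intro!: restrict_ext\<close>)
  next
    fix x assume x: "x \<in> carrier (power_module G Y)"
    show "\<zero>\<^bsub>power_module G Y\<^esub> \<oplus>\<^bsub>power_module G Y\<^esub> x = x"
      by (rule extensionalityI[of _ G]) (use x mem[of x] in \<open>auto simp: PiE_def\<close>)
  qed (use mem in \<open>auto intro!: restrict_ext simp: Y.M.a_ac\<close>)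
  then show ?thesis
  proof (intro right_module.intro right_module_axioms.intro Y.C.ring_axioms)
    fix x assume x: "x \<in> carrier (power_module G Y)"
    show "x \<cdot>\<^bsub>power_module G Y\<^esub> \<one>\<^bsub>R\<^esub> = x"
      by (rule extensionalityI[of _ G]) (use x mem[of x] in \<open>auto simp: PiE_def\<close>)
  qed (use mem in \<open>auto intro!: restrict_ext simp: Y.rsmult_l_distr Y.rsmult_r_distr Y.rsmult_assoc\<close>)
qed

text \<open>The coordinate inclusion at \<open>i\<close>. The zero element \<open>z\<close> is a
  parameter so that the same function serves copowers of \<open>U\<close> and powers of the
  dual.\<close>

definition single :: "'i set \<Rightarrow> 'a \<Rightarrow> 'i \<Rightarrow> 'a \<Rightarrow> 'i \<Rightarrow> 'a" where
  "single G z i u = (\<lambda>j\<in>G. if j = i then u else z)"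

lemma right_hom_single:
  assumes "right_module R Y" "i \<in> G"
  shows "(\<lambda>u\<in>carrier Y. single G \<zero>\<^bsub>Y\<^esub> i u) \<in> right_hom R Y (power_module G Y)"
proof -
  interpret Y: right_module R Y by fact
  show ?thesis
    by (intro right_homI) (auto simp: single_def Y.rsmult_zero_left intro!: restrict_ext)
qed


lemma copower_module_sel [simp]:
  "carrier (copower_module G U) = {x \<in> \<Pi>\<^sub>E i\<in>G. carrier U. finite {i \<in> G. x i \<noteq> \<zero>\<^bsub>U\<^esub>}}"
  "\<zero>\<^bsub>copower_module G U\<^esub> = (\<lambda>i\<in>G. \<zero>\<^bsub>U\<^esub>)"
  "x \<oplus>\<^bsub>copower_module G U\<^esub> y = (\<lambda>i\<in>G. x i \<oplus>\<^bsub>U\<^esub> y i)"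
  "r \<odot>\<^bsub>copower_module G U\<^esub> x = (\<lambda>i\<in>G. r \<odot>\<^bsub>U\<^esub> x i)"
  by (simp_all add: copower_module_def)

section \<open>Copowers and their biendomorphisms\<close>

context bimodule
begin

abbreviation Ucp :: "'i set \<Rightarrow> ('r, 'c, 'i \<Rightarrow> 'u) bimodule" where
  "Ucp G \<equiv> copower_module G U"

abbreviation single_U :: "'i set \<Rightarrow> 'i \<Rightarrow> 'u \<Rightarrow> 'i \<Rightarrow> 'u" where
  "single_U G \<equiv> single G \<zero>\<^bsub>U\<^esub>"

lemma copower_mem:
  assumes "x \<in> carrier (Ucp G)"
  shows "i \<in> G \<Longrightarrow> x i \<in> carrier U" "x \<in> extensional G" "finite {i \<in> G. x i \<noteq> \<zero>\<^bsub>U\<^esub>}"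
  using assms by (auto simp: PiE_def)

lemma copower_memI:
  assumes "\<And>i. i \<in> G \<Longrightarrow> x i \<in> carrier U" "x \<in> extensional G" "finite {i \<in> G. x i \<noteq> \<zero>\<^bsub>U\<^esub>}"
  shows "x \<in> carrier (Ucp G)"
  using assms by (auto simp: PiE_def)

lemma copower_add_closed:
  assumes "x \<in> carrier (Ucp G)" "y \<in> carrier (Ucp G)"
  shows "x \<oplus>\<^bsub>Ucp G\<^esub> y \<in> carrier (Ucp G)"
proof (rule copower_memI)
  show "finite {i \<in> G. (x \<oplus>\<^bsub>Ucp G\<^esub> y) i \<noteq> \<zero>\<^bsub>U\<^esub>}"
    by (rule finite_subset[of _ "{i \<in> G. x i \<noteq> \<zero>\<^bsub>U\<^esub>} \<union> {i \<in> G. y i \<noteq> \<zero>\<^bsub>U\<^esub>}"])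
       (use copower_mem(3)[OF assms(1)] copower_mem(3)[OF assms(2)] in auto)
qed (use copower_mem[OF assms(1)] copower_mem[OF assms(2)] in auto)

lemma copower_single_closed:
  assumes "u \<in> carrier U" shows "single_U G i u \<in> carrier (Ucp G)"
proof (rule copower_memI)
  show "finite {j \<in> G. single_U G i u j \<noteq> \<zero>\<^bsub>U\<^esub>}"
    by (rule finite_subset[of _ "{i}"]) (auto simp: single_def)
qed (use assms in \<open>auto simp: single_def\<close>)

lemma copower_map_closed:
  assumes "\<And>u. u \<in> carrier U \<Longrightarrow> g u \<in> carrier U" "g \<zero>\<^bsub>U\<^esub> = \<zero>\<^bsub>U\<^esub>" and x: "x \<in> carrier (Ucp G)"
  shows "(\<lambda>i\<in>G. g (x i)) \<in> carrier (Ucp G)"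
proof (rule copower_memI)
  show "finite {i \<in> G. (\<lambda>i\<in>G. g (x i)) i \<noteq> \<zero>\<^bsub>U\<^esub>}"
    by (rule finite_subset[OF _ copower_mem(3)[OF x]]) (use assms(2) in auto)
qed (use copower_mem[OF x] assms(1) in auto)

text \<open>The matrix unit with entry \<open>f\<close> leading from coordinate \<open>i\<close> to
  coordinate \<open>j\<close>. Commuting with these forces a biendomorphism of the copower to be
  diagonal.\<close>

lemma matrix_unit_endo:
  assumes f: "f \<in> left_hom R U U" and i: "i \<in> G" and j: "j \<in> G"
  shows "(\<lambda>x\<in>carrier (Ucp G). single_U G j (f (x i))) \<in> left_hom R (Ucp G) (Ucp G)"
proof (rule left_homI)
  note fD = left_homD[OF f]
  show "(\<lambda>x\<in>carrier (Ucp G). single_U G j (f (x i))) x \<in> carrier (Ucp G)" if "x \<in> carrier (Ucp G)" for x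
    unfolding restrict_apply'[OF that]
    by (rule copower_single_closed) (rule fD(1)[OF copower_mem(1)[OF that i]])
  show "(\<lambda>x\<in>carrier (Ucp G). single_U G j (f (x i))) (x \<oplus>\<^bsub>Ucp G\<^esub> y) =
      (\<lambda>x\<in>carrier (Ucp G). single_U G j (f (x i))) x \<oplus>\<^bsub>Ucp G\<^esub>
      (\<lambda>x\<in>carrier (Ucp G). single_U G j (f (x i))) y"
    if x: "x \<in> carrier (Ucp G)" and y: "y \<in> carrier (Ucp G)" for x y
    unfolding restrict_apply'[OF x] restrict_apply'[OF y] restrict_apply'[OF copower_add_closed[OF x y]]
    using fD copower_mem(1)[OF x i] copower_mem(1)[OF y i] i
    by (auto simp: single_def intro!: restrict_ext)
  show "(\<lambda>x\<in>carrier (Ucp G). single_U G j (f (x i))) (r \<odot>\<^bsub>Ucp G\<^esub> x) =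
      r \<odot>\<^bsub>Ucp G\<^esub> (\<lambda>x\<in>carrier (Ucp G). single_U G j (f (x i))) x"
    if r: "r \<in> carrier R" and x: "x \<in> carrier (Ucp G)" for r x
  proof -
    have rx: "r \<odot>\<^bsub>Ucp G\<^esub> x \<in> carrier (Ucp G)"
      unfolding copower_module_sel(4)
      by (rule copower_map_closed[OF _ _ x]) (use r in \<open>auto simp: U.lsmult_zero_right\<close>)
    show ?thesis
      unfolding restrict_apply'[OF x] restrict_apply'[OF rx]
      using fD copower_mem(1)[OF x i] i r
      by (auto simp: single_def U.lsmult_zero_right intro!: restrict_ext)
  qed
qed (simp del: copower_module_sel)

text \<open>An endomorphism of the copower is a matrix of endomorphisms of \<open>U\<close>, and
  \<open>g\<close> commutes with each entry. This settles families with one nonzero coordinate; the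
  others are finite sums of these.\<close>

lemma diagonal_map_biend:
  assumes g: "g \<in> carrier (left_biend R U)"
  shows "diagonal_map G U g \<in> carrier (left_biend R (Ucp G))"
  unfolding biend_sel
proof (rule commuting_mapsI)
  note gD = commuting_mapsD[OF g[unfolded biend_sel]]
  have g0: "g \<zero>\<^bsub>U\<^esub> = \<zero>\<^bsub>U\<^esub>"
    using commuting_maps_zero[OF U.M.abelian_group_axioms g[unfolded biend_sel]] .
  let ?D = "diagonal_map G U g"
  have D: "?D x = (\<lambda>i\<in>G. g (x i))" if "x \<in> carrier (Ucp G)" for x
    using that by (simp only: diagonal_map_def restrict_apply if_True)
  show cl: "?D x \<in> carrier (Ucp G)" if "x \<in> carrier (Ucp G)" for x
    unfolding D[OF that] by (rule copower_map_closed[where g = g, OF gD(1) g0 that])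
  show "?D \<in> extensional (carrier (Ucp G))" by (simp add: diagonal_map_def)
  show add: "?D (x \<oplus>\<^bsub>Ucp G\<^esub> y) = ?D x \<oplus>\<^bsub>Ucp G\<^esub> ?D y"
    if x: "x \<in> carrier (Ucp G)" and y: "y \<in> carrier (Ucp G)" for x y
    unfolding D[OF x] D[OF y] D[OF copower_add_closed[OF x y]]
    using gD(3) copower_mem(1)[OF x] copower_mem(1)[OF y] by (auto intro!: restrict_ext)
  fix \<Phi> x assume \<Phi>: "\<Phi> \<in> left_hom R (Ucp G) (Ucp G)" and x: "x \<in> carrier (Ucp G)"
  note \<Phi>D = left_homD[OF \<Phi>]
  have Dsingle: "?D (single_U G i u) = single_U G i (g u)" if "u \<in> carrier U" for i u
    unfolding D[OF copower_single_closed[OF that]] using g0 by (auto simp: single_def intro!: restrict_ext)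
  have single: "?D (\<Phi> (single_U G i u)) = \<Phi> (?D (single_U G i u))" if u: "u \<in> carrier U" and i: "i \<in> G" for i u
  proof -
    have entry: "(\<lambda>u\<in>carrier U. \<Phi> (single_U G i u) j) \<in> left_hom R U U" if j: "j \<in> G" for j
    proof (rule left_homI)
      have "single_U G i (u \<oplus>\<^bsub>U\<^esub> v) = single_U G i u \<oplus>\<^bsub>Ucp G\<^esub> single_U G i v"
        if "u \<in> carrier U" "v \<in> carrier U" for u v
        using that by (auto simp: single_def intro!: restrict_ext)
      then show "(\<lambda>u\<in>carrier U. \<Phi> (single_U G i u) j) (u \<oplus>\<^bsub>U\<^esub> v) =
          (\<lambda>u\<in>carrier U. \<Phi> (single_U G i u) j) u \<oplus>\<^bsub>U\<^esub> (\<lambda>u\<in>carrier U. \<Phi> (single_U G i u) j) v"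
        if "u \<in> carrier U" "v \<in> carrier U" for u v
        using that j \<Phi>D(3)[OF copower_single_closed copower_single_closed, OF that] by simp
      have "single_U G i (r \<odot>\<^bsub>U\<^esub> u) = r \<odot>\<^bsub>Ucp G\<^esub> single_U G i u"
        if "r \<in> carrier R" "u \<in> carrier U" for r u
        using that by (auto simp: single_def U.lsmult_zero_right intro!: restrict_ext)
      then show "(\<lambda>u\<in>carrier U. \<Phi> (single_U G i u) j) (r \<odot>\<^bsub>U\<^esub> u) =
          r \<odot>\<^bsub>U\<^esub> (\<lambda>u\<in>carrier U. \<Phi> (single_U G i u) j) u"
        if "r \<in> carrier R" "u \<in> carrier U" for r u
        using that j \<Phi>D(4)[OF _ copower_single_closed, OF that] by simp
    qed (use copower_mem(1)[OF \<Phi>D(1)[OF copower_single_closed] j] in auto)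
    have "g (\<Phi> (single_U G i u) j) = \<Phi> (single_U G i (g u)) j" if "j \<in> G" for j
      using gD(4)[OF entry[OF that] u] u gD(1) by simp
    then show ?thesis
      unfolding Dsingle[OF u] D[OF \<Phi>D(1)[OF copower_single_closed[OF u]]]
      using copower_mem(2)[OF \<Phi>D(1)[OF copower_single_closed[OF gD(1)[OF u]]]]
      by (intro extensionalityI[of _ G]) auto
  qed
  \<comment> \<open>The truncation of \<open>x\<close> to \<open>F\<close>. Induction over finite
    \<open>F\<close> adds one coordinate at a time, and \<open>x\<close> is its own truncation to
    its support.\<close>
  define cut where "cut F = (\<lambda>i\<in>G. if i \<in> F then x i else \<zero>\<^bsub>U\<^esub>)" for F
  have cut_closed: "cut F \<in> carrier (Ucp G)" for F
  proof (rule copower_memI)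
    show "finite {i \<in> G. cut F i \<noteq> \<zero>\<^bsub>U\<^esub>}"
      by (rule finite_subset[OF _ copower_mem(3)[OF x]]) (auto simp: cut_def)
  qed (use copower_mem[OF x] in \<open>auto simp: cut_def\<close>)
  have "?D (\<Phi> (cut F)) = \<Phi> (?D (cut F))" if "finite F" "F \<subseteq> G" for F
    using that
  proof (induction rule: finite_induct)
    case empty
    have e: "cut {} \<oplus>\<^bsub>Ucp G\<^esub> cut {} = cut {}" by (auto simp: cut_def intro!: restrict_ext)
    \<comment> \<open>The zero family is recognised by \<open>y + y = y\<close>, which avoids
      setting up the copower as an abelian group. Additive maps preserve this equation.\<close>
    have z: "y = cut {}" if y: "y \<in> carrier (Ucp G)" "y \<oplus>\<^bsub>Ucp G\<^esub> y = y" for y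
    proof (rule extensionalityI[of _ G])
      fix i assume i: "i \<in> G"
      have "y i \<oplus>\<^bsub>U\<^esub> y i = y i" using fun_cong[OF y(2), of i] i by simp
      then show "y i = cut {} i" using copower_mem(1)[OF y(1) i] i by (simp add: cut_def)
    qed (use copower_mem(2)[OF y(1)] in \<open>auto simp: cut_def\<close>)
    have "\<Phi> (cut {}) = cut {}"
      using z[OF \<Phi>D(1)[OF cut_closed]] \<Phi>D(3)[OF cut_closed[of "{}"] cut_closed[of "{}"]] e by metis
    moreover have "?D (cut {}) = cut {}"
      using z[OF cl[OF cut_closed]] add[OF cut_closed[of "{}"] cut_closed[of "{}"]] e by metis
    ultimately show ?case by simp
  next
    case (insert i F)
    then have i: "i \<in> G" "i \<notin> F" and IH: "?D (\<Phi> (cut F)) = \<Phi> (?D (cut F))" by auto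
    have xi: "x i \<in> carrier U" by (rule copower_mem(1)[OF x i(1)])
    have split: "cut (insert i F) = cut F \<oplus>\<^bsub>Ucp G\<^esub> single_U G i (x i)"
      using i copower_mem(1)[OF x] by (auto simp: cut_def single_def intro!: restrict_ext)
    note s = copower_single_closed[OF xi, of G i]
    show ?case
      unfolding split \<Phi>D(3)[OF cut_closed s] add[OF \<Phi>D(1)[OF cut_closed] \<Phi>D(1)[OF s]]
        add[OF cut_closed s] \<Phi>D(3)[OF cl[OF cut_closed] cl[OF s]] IH single[OF xi i(1)] ..
  qed
  moreover have "x = cut {i \<in> G. x i \<noteq> \<zero>\<^bsub>U\<^esub>}"
    by (rule extensionalityI[of _ G]) (use copower_mem[OF x] in \<open>auto simp: cut_def\<close>)
  ultimately show "?D (\<Phi> x) = \<Phi> (?D x)" using copower_mem(3)[OF x] by (metis (no_types, lifting) mem_Collect_eq subsetI)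
qed

text \<open>Moving coordinate \<open>i\<close> to \<open>i0\<close> by a matrix unit commutes with
  \<open>g\<close>, so coordinate \<open>i\<close> of \<open>g x\<close> depends on
  \<open>x i\<close> alone and through a function that is the same for all \<open>i\<close>: the
  entry of \<open>g\<close> at \<open>(i0, i0)\<close>.\<close>

lemma biend_copower_diagonal:
  assumes g: "g \<in> carrier (left_biend R (Ucp G))" and i0: "i0 \<in> G"
  obtains g0 where "g0 \<in> carrier (left_biend R U)" "g = diagonal_map G U g0"
proof -
  note gD = commuting_mapsD[OF g[unfolded biend_sel]]
  let ?g0 = "\<lambda>u\<in>carrier U. g (single_U G i0 u) i0"
  have id: "(\<lambda>u\<in>carrier U. u) \<in> left_hom R U U" by (rule left_homI) auto
  have entry: "g (single_U G i0 (x i)) i0 = g x i" if x: "x \<in> carrier (Ucp G)" and i: "i \<in> G" for x i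
    using gD(4)[OF matrix_unit_endo[OF id i i0] x] copower_mem(1)[OF x i] copower_mem(1)[OF gD(1)[OF x] i] i0
    unfolding restrict_apply'[OF x] restrict_apply'[OF gD(1)[OF x]]
    by (simp add: single_def del: copower_module_sel)
  have "?g0 \<in> carrier (left_biend R U)"
    unfolding biend_sel
  proof (rule commuting_mapsI)
    note s = copower_single_closed[of _ G i0]
    show "?g0 u \<in> carrier U" if "u \<in> carrier U" for u
      using copower_mem(1)[OF gD(1)[OF s[OF that]] i0] that by simp
    show "?g0 (u \<oplus>\<^bsub>U\<^esub> v) = ?g0 u \<oplus>\<^bsub>U\<^esub> ?g0 v" if uv: "u \<in> carrier U" "v \<in> carrier U" for u v
    proof -
      have "single_U G i0 (u \<oplus>\<^bsub>U\<^esub> v) = single_U G i0 u \<oplus>\<^bsub>Ucp G\<^esub> single_U G i0 v"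
        using uv by (auto simp: single_def intro!: restrict_ext)
      then show ?thesis using gD(3)[OF s[OF uv(1)] s[OF uv(2)]] uv i0 by simp
    qed
    show "?g0 (f u) = f (?g0 u)" if f: "f \<in> left_hom R U U" and u: "u \<in> carrier U" for f u
    proof -
      note fD = left_homD[OF f]
      from gD(4)[OF matrix_unit_endo[OF f i0 i0] s[OF u]]
      have "g (single_U G i0 (f u)) = single_U G i0 (f (g (single_U G i0 u) i0))"
        unfolding restrict_apply'[OF s[OF u]] restrict_apply'[OF gD(1)[OF s[OF u]]]
        using i0 by (simp add: single_def)
      from fun_cong[OF this, of i0] show ?thesis using u fD(1) i0 by (simp add: single_def)
    qed
  qed simp
  moreover have "g = diagonal_map G U ?g0"
  proof (rule extensionalityI[OF gD(2)])
    show "diagonal_map G U ?g0 \<in> extensional (carrier (Ucp G))" by (simp add: diagonal_map_def)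
    fix x assume x: "x \<in> carrier (Ucp G)"
    have "diagonal_map G U ?g0 x = (\<lambda>i\<in>G. ?g0 (x i))"
      using x by (simp only: diagonal_map_def restrict_apply if_True)
    also have "\<dots> = g x"
      by (rule extensionalityI[of _ G])
         (use copower_mem(2)[OF gD(1)[OF x]] copower_mem(1)[OF x] entry[OF x] in auto)
    finally show "g x = diagonal_map G U ?g0 x" by simp
  qed
  ultimately show thesis by (rule that)
qed

lemma diagonal_map_iso:
  assumes "G \<noteq> {} \<or> carrier U = {\<zero>\<^bsub>U\<^esub>}"
  shows "diagonal_map G U \<in> ring_iso (left_biend R U) (left_biend R (Ucp G))"
proof -
  let ?B = "left_biend R U" and ?K = "carrier (Ucp G)"
  have D: "diagonal_map G U g x = (\<lambda>i\<in>G. g (x i))" if "x \<in> ?K" for x g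
    using that by (simp only: diagonal_map_def restrict_apply if_True)
  have D_ext: "diagonal_map G U g \<in> extensional ?K" for g by (simp add: diagonal_map_def)
  have cl: "(\<lambda>i\<in>G. g (x i)) \<in> ?K" if "g \<in> carrier ?B" "x \<in> ?K" for g x
    using commuting_mapsD(1)[OF diagonal_map_biend[OF that(1), unfolded biend_sel] that(2)]
    unfolding D[OF that(2)] .
  have "diagonal_map G U \<in> ring_hom ?B (left_biend R (Ucp G))"
  proof (rule ring_hom_memI)
    show "diagonal_map G U g \<in> carrier (left_biend R (Ucp G))" if "g \<in> carrier ?B" for g
      by (rule diagonal_map_biend[OF that])
    show "diagonal_map G U (g \<otimes>\<^bsub>?B\<^esub> h) = diagonal_map G U g \<otimes>\<^bsub>left_biend R (Ucp G)\<^esub> diagonal_map G U h"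
      if g: "g \<in> carrier ?B" and h: "h \<in> carrier ?B" for g h
    proof (rule extensionalityI[of _ ?K])
      fix x assume x: "x \<in> ?K"
      show "diagonal_map G U (g \<otimes>\<^bsub>?B\<^esub> h) x = (diagonal_map G U g \<otimes>\<^bsub>left_biend R (Ucp G)\<^esub> diagonal_map G U h) x"
        using D[OF x] D[OF cl[OF h x]] copower_mem(1)[OF x] x
        by (auto simp: left_biend_def compose_def simp del: copower_module_sel intro!: restrict_ext)
    qed (auto simp: D_ext left_biend_def simp del: copower_module_sel)
    show "diagonal_map G U (g \<oplus>\<^bsub>?B\<^esub> h) = diagonal_map G U g \<oplus>\<^bsub>left_biend R (Ucp G)\<^esub> diagonal_map G U h"
      if g: "g \<in> carrier ?B" and h: "h \<in> carrier ?B" for g h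
    proof (rule extensionalityI[of _ ?K])
      fix x assume x: "x \<in> ?K"
      show "diagonal_map G U (g \<oplus>\<^bsub>?B\<^esub> h) x = (diagonal_map G U g \<oplus>\<^bsub>left_biend R (Ucp G)\<^esub> diagonal_map G U h) x"
        using D[OF x] copower_mem(1)[OF x] x
        by (auto simp: left_biend_def simp del: copower_module_sel(1) intro!: restrict_ext)
    qed (auto simp: D_ext left_biend_def simp del: copower_module_sel)
    show "diagonal_map G U \<one>\<^bsub>?B\<^esub> = \<one>\<^bsub>left_biend R (Ucp G)\<^esub>"
    proof (rule extensionalityI[of _ ?K])
      fix x assume x: "x \<in> ?K"
      have "(\<lambda>i\<in>G. (\<lambda>u\<in>carrier U. u) (x i)) = x"
        by (rule extensionalityI[of _ G]) (use copower_mem[OF x] in auto)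
      then show "diagonal_map G U \<one>\<^bsub>?B\<^esub> x = \<one>\<^bsub>left_biend R (Ucp G)\<^esub> x"
        using D[OF x] x by (simp add: left_biend_def del: copower_module_sel)
    qed (auto simp: D_ext left_biend_def simp del: copower_module_sel)
  qed
  moreover have "bij_betw (diagonal_map G U) (carrier ?B) (carrier (left_biend R (Ucp G)))"
  proof (cases "G = {}")
    case True
    then have U0: "carrier U = {\<zero>\<^bsub>U\<^esub>}" using assms by simp
    have K0: "?K = {\<lambda>_. undefined}" using True by auto
    have "(\<lambda>x\<in>carrier U. x) \<in> carrier ?B"
      unfolding biend_sel
      by (rule commuting_maps_id[OF U.M.abelian_group_axioms]) (rule left_homD(1))
    then show ?thesis
      using commuting_maps_unique[OF U0] commuting_maps_unique[OF K0] diagonal_map_biend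
      unfolding bij_betw_def inj_on_def biend_sel by fast
  next
    case False
    then obtain i0 where i0: "i0 \<in> G" by blast
    have "g = h" if gh: "g \<in> carrier ?B" "h \<in> carrier ?B" "diagonal_map G U g = diagonal_map G U h" for g h
    proof (rule extensionalityI[of _ "carrier U"])
      fix u assume u: "u \<in> carrier U"
      note s = copower_single_closed[OF u, of G i0]
      from fun_cong[OF fun_cong[OF gh(3)], of "single_U G i0 u" i0]
      show "g u = h u" unfolding D[OF s] using i0 by (simp add: single_def)
    qed (use gh(1,2) commuting_mapsD(2) in auto)
    then show ?thesis
      unfolding bij_betw_def inj_on_def
      using diagonal_map_biend biend_copower_diagonal[OF _ i0] by (auto simp del: biend_sel) blast
  qed
  ultimately show ?thesis by (simp add: ring_iso_def)
qed

end

section \<open>Biendomorphisms of the dual and of its powers\<close>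

lemma power_memD:
  assumes "w \<in> carrier (power_module G Y)"
  shows "i \<in> G \<Longrightarrow> w i \<in> carrier Y" "w \<in> extensional G"
  using assms by (auto simp: PiE_def)

lemma single_power_closed:
  assumes "right_module R Y" "u \<in> carrier Y"
  shows "single G \<zero>\<^bsub>Y\<^esub> i u \<in> carrier (power_module G Y)"
proof -
  interpret Y: right_module R Y by fact
  show ?thesis using assms(2) by (auto simp: single_def)
qed

text \<open>For \<open>W\<close> the power itself this makes every homomorphism into
  \<open>Y\<close> an endomorphism of the power, with which biendomorphisms commute.\<close>

lemma right_hom_single_comp:
  assumes Y: "right_module R Y" and W: "right_module R W" and \<psi>: "\<psi> \<in> right_hom R W Y"
  shows "(\<lambda>w\<in>carrier W. single G \<zero>\<^bsub>Y\<^esub> i (\<psi> w)) \<in> right_hom R W (power_module G Y)"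
proof -
  interpret Y: right_module R Y by fact
  interpret W: right_module R W by fact
  show ?thesis
  proof (rule right_homI)
    show "(\<lambda>w\<in>carrier W. single G \<zero>\<^bsub>Y\<^esub> i (\<psi> w)) w \<in> carrier (power_module G Y)"
      if "w \<in> carrier W" for w
      using single_power_closed[OF Y right_homD(1)[OF \<psi> that]] that by simp
  qed (use right_homD(1,3,4)[OF \<psi>] in
      \<open>auto simp: single_def Y.rsmult_zero_left intro!: restrict_ext\<close>)
qed

lemma right_hom_component:
  assumes "right_module R Y" "i \<in> G"
  shows "(\<lambda>w\<in>carrier (power_module G Y). w i) \<in> right_hom R (power_module G Y) Y"
proof -
  interpret W: right_module R "power_module G Y" by (rule right_module_power[OF assms(1)])
  show ?thesis
  proof (rule right_homI)
    show "(\<lambda>w\<in>carrier (power_module G Y). w i) (w \<oplus>\<^bsub>power_module G Y\<^esub> v)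
      = (\<lambda>w\<in>carrier (power_module G Y). w i) w \<oplus>\<^bsub>Y\<^esub> (\<lambda>w\<in>carrier (power_module G Y). w i) v"
      if "w \<in> carrier (power_module G Y)" "v \<in> carrier (power_module G Y)" for w v
      using W.M.a_closed[OF that] that assms(2) by (simp del: power_module_sel(1) PiE_iff)
    show "(\<lambda>w\<in>carrier (power_module G Y). w i) (w \<cdot>\<^bsub>power_module G Y\<^esub> r)
      = (\<lambda>w\<in>carrier (power_module G Y). w i) w \<cdot>\<^bsub>Y\<^esub> r"
      if "w \<in> carrier (power_module G Y)" "r \<in> carrier R" for w r
      using W.rsmult_closed[OF that] that assms(2) by (simp del: power_module_sel(1) PiE_iff)
  qed (use assms(2) in auto)
qed

context bimodule_dual
begin

abbreviation single_dual :: "'i set \<Rightarrow> 'i \<Rightarrow> ('u \<Rightarrow> 'z) \<Rightarrow> 'i \<Rightarrow> 'u \<Rightarrow> 'z" where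
  "single_dual G \<equiv> single G \<zero>\<^bsub>Ud\<^esub>"

abbreviation dual_power :: "'i set \<Rightarrow> ('r, 'i \<Rightarrow> 'u \<Rightarrow> 'z) rmodule" where
  "dual_power G \<equiv> power_module G Ud"

lemmas dual_power_module = right_module_power[OF dual.right_module_axioms]

lemma separating_family:
  assumes "separating R Ud G"
  shows "(\<lambda>\<rho>\<in>G. \<rho>) \<in> carrier (dual_power G)"
    and "\<And>r. r \<in> carrier R \<Longrightarrow> (\<lambda>\<rho>\<in>G. \<rho>) \<cdot>\<^bsub>dual_power G\<^esub> r = \<zero>\<^bsub>dual_power G\<^esub> \<Longrightarrow> r = \<zero>\<^bsub>R\<^esub>"
proof -
  show "(\<lambda>\<rho>\<in>G. \<rho>) \<in> carrier (dual_power G)"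
    using assms by (auto simp: separating_def simp del: dual_sel)
  fix r assume r: "r \<in> carrier R" and 0: "(\<lambda>\<rho>\<in>G. \<rho>) \<cdot>\<^bsub>dual_power G\<^esub> r = \<zero>\<^bsub>dual_power G\<^esub>"
  have "\<rho> \<cdot>\<^bsub>Ud\<^esub> r = \<zero>\<^bsub>Ud\<^esub>" if "\<rho> \<in> G" for \<rho>
    using fun_cong[OF 0, of \<rho>] that by (simp del: dual_sel)
  then show "r = \<zero>\<^bsub>R\<^esub>" using assms r by (simp add: separating_def del: dual_sel)
qed

lemma biend_dual_power:
  assumes flat: "flat_module TYPE('r set) R U" and sep: "separating R Ud G"
    and h: "h \<in> carrier (right_biend R (dual_power G))"
  obtains g where "g \<in> carrier (left_biend R U)"
    "\<And>w \<rho>. w \<in> carrier (dual_power G) \<Longrightarrow> \<rho> \<in> G \<Longrightarrow> h w \<rho> = compose (carrier U) (w \<rho>) g"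
proof (cases "G = {}")
  case True
  have "(\<lambda>u\<in>carrier U. u) \<in> carrier (left_biend R U)"
    unfolding biend_sel by (rule commuting_maps_id[OF U.M.abelian_group_axioms]) (rule left_homD(1))
  then show thesis using that True by blast
next
  case False
  then obtain i where i: "i \<in> G" by blast
  note hD = commuting_mapsD[OF h[unfolded biend_sel]]
  let ?W = "dual_power G" and ?w = "\<lambda>\<rho>\<in>G. \<rho>"
  \<comment> \<open>The action of \<open>h\<close> on the fixed coordinate \<open>i\<close>; the
    choice of \<open>i\<close> turns out to be immaterial.\<close>
  let ?h = "\<lambda>\<sigma>. h (single_dual G i \<sigma>) i"
  have pull: "?h (\<psi> w) = \<psi> (h w)" if \<psi>: "\<psi> \<in> right_hom R ?W Ud" and w: "w \<in> carrier ?W" for \<psi> w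
    using fun_cong[OF hD(4)[OF right_hom_single_comp[OF dual.right_module_axioms dual_power_module \<psi>] w], of i]
    unfolding restrict_apply'[OF w] restrict_apply'[OF hD(1)[OF w]] using i by (simp add: single_def del: dual_sel)
  note w = separating_family[OF sep]
  obtain g where g: "g \<in> carrier (left_biend R U)"
    "\<And>\<sigma>. \<sigma> \<in> carrier Ud \<Longrightarrow> ?h \<sigma> = compose (carrier U) \<sigma> g"
    by (rule biend_of_compatible_map[OF flat dual_power_module w(1) hD(1)[OF w(1)] w(2), of ?h])
       (use pull w(1) in blast)+
  \<comment> \<open>Taking the projection to coordinate \<rho> for \<psi> in \<open>pull\<close>
    shows that \<open>h\<close> acts on this coordinate by the same map \<open>?h\<close> as on
    \<open>i\<close>.\<close>
  have "h v \<rho> = compose (carrier U) (v \<rho>) g" if v: "v \<in> carrier ?W" and \<rho>: "\<rho> \<in> G" for v \<rho>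
    using pull[OF right_hom_component[OF dual.right_module_axioms \<rho>] v] g(2)[OF power_memD(1)[OF v \<rho>]]
    unfolding restrict_apply'[OF v] restrict_apply'[OF hD(1)[OF v]] by simp
  with g(1) show thesis by (rule that)
qed

text \<open>\<open>adjoint\<close> is restricted to the dual of the copower, so this membership is
  needed before an adjoint can be evaluated at a pairing.\<close>

lemma copower_pairing_dual:
  assumes \<rho>: "\<rho> \<in> carrier (dual_power G)"
  shows "copower_pairing G Z U \<rho> \<in> carrier (dual C Z (Ucp G))"
proof -
  have cmZ: "comm_monoid (add_monoid Z)" by (rule Z.M.a_comm_monoid)
  note \<rho>D = dualD[OF power_memD(1)[OF \<rho>, unfolded dual_sel]]
  have term_closed: "\<rho> i (x i) \<in> carrier Z" if "x \<in> carrier (Ucp G)" "i \<in> G" for x i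
    by (rule \<rho>D(1)[OF that(2) copower_mem(1)[OF that]])
  \<comment> \<open>Any finite \<open>S\<close> between the support of \<open>x\<close> and
    \<open>G\<close> gives the same sum, as each \<open>\<rho> i\<close> vanishes at zero. The
    freedom in \<open>S\<close> allows the sums for \<open>x\<close>, \<open>y\<close> and their sum
    to be compared over one index set.\<close>
  have pairing: "copower_pairing G Z U \<rho> x = finsum Z (\<lambda>i. \<rho> i (x i)) S"
    if x: "x \<in> carrier (Ucp G)" and S: "finite S" "{i \<in> G. x i \<noteq> \<zero>\<^bsub>U\<^esub>} \<subseteq> S" "S \<subseteq> G" for x S
  proof -
    have "copower_pairing G Z U \<rho> x = gfinprod (add_monoid Z) (\<lambda>i. \<rho> i (x i)) G"
      using x by (simp only: copower_pairing_def restrict_apply if_True)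
    also have "\<dots> = gfinprod (add_monoid Z) (\<lambda>i. \<rho> i (x i)) S"
    proof (rule comm_monoid.gfinprod_mono_neutral_cong_right[OF cmZ S(3)])
      fix i assume i: "i \<in> G - S"
      then have "x i = \<zero>\<^bsub>U\<^esub>" using S(2) by blast
      then show "\<rho> i (x i) = \<one>\<^bsub>add_monoid Z\<^esub>"
        using dual_zero[OF power_memD(1)[OF \<rho>]] i by simp
    qed (use term_closed[OF x] in auto)
    also have "\<dots> = finsum Z (\<lambda>i. \<rho> i (x i)) S"
      unfolding finsum_def by (rule comm_monoid.gfinprod_eq_finprod[OF cmZ S(1)]) (use term_closed[OF x] S(3) in auto)
    finally show ?thesis .
  qed
  have act: "x \<cdot>\<^bsub>right_part (Ucp G)\<^esub> c = (\<lambda>i\<in>G. bi_rsmult U (x i) c)" for x c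
    by (simp add: copower_module_def)
  have act_closed: "(\<lambda>i\<in>G. bi_rsmult U (x i) c) \<in> carrier (Ucp G)"
    if "x \<in> carrier (Ucp G)" "c \<in> carrier C" for x c
    by (rule copower_map_closed[where g = "\<lambda>u. bi_rsmult U u c", OF _ _ that(1)])
       (use right.rsmult_zero_left[OF that(2)] that(2) in auto)
  have scal: "finsum Z (\<lambda>i. f i \<cdot>\<^bsub>Z\<^esub> c) S = finsum Z f S \<cdot>\<^bsub>Z\<^esub> c"
    if "finite S" "f \<in> S \<rightarrow> carrier Z" "c \<in> carrier C" for f S c
    using that by (induction S rule: finite_induct)
      (auto simp: Z.rsmult_zero_left Z.rsmult_l_distr Pi_iff)
  show ?thesis
    unfolding dual_sel
  proof (rule right_homI, unfold right_part_sel)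
    show "copower_pairing G Z U \<rho> \<in> extensional (carrier (Ucp G))" by (simp add: copower_pairing_def)
    show "copower_pairing G Z U \<rho> x \<in> carrier Z" if x: "x \<in> carrier (Ucp G)" for x
    proof -
      let ?S = "{i \<in> G. x i \<noteq> \<zero>\<^bsub>U\<^esub>}"
      have "finsum Z (\<lambda>i. \<rho> i (x i)) ?S \<in> carrier Z"
        by (rule Z.M.finsum_closed) (use term_closed[OF x] in auto)
      then show ?thesis using pairing[OF x copower_mem(3)[OF x]] by simp
    qed
    show "copower_pairing G Z U \<rho> (x \<oplus>\<^bsub>Ucp G\<^esub> y)
      = copower_pairing G Z U \<rho> x \<oplus>\<^bsub>Z\<^esub> copower_pairing G Z U \<rho> y"
      if x: "x \<in> carrier (Ucp G)" and y: "y \<in> carrier (Ucp G)" for x y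
    proof -
      let ?S = "{i \<in> G. x i \<noteq> \<zero>\<^bsub>U\<^esub>} \<union> {i \<in> G. y i \<noteq> \<zero>\<^bsub>U\<^esub>}"
      have S: "finite ?S" "?S \<subseteq> G" using copower_mem(3)[OF x] copower_mem(3)[OF y] by auto
      have supp: "{i \<in> G. (x \<oplus>\<^bsub>Ucp G\<^esub> y) i \<noteq> \<zero>\<^bsub>U\<^esub>} \<subseteq> ?S" by auto
      have "copower_pairing G Z U \<rho> (x \<oplus>\<^bsub>Ucp G\<^esub> y)
          = finsum Z (\<lambda>i. \<rho> i ((x \<oplus>\<^bsub>Ucp G\<^esub> y) i)) ?S"
        by (rule pairing[OF copower_add_closed[OF x y] S(1) supp S(2)])
      also have "\<dots> = finsum Z (\<lambda>i. \<rho> i (x i) \<oplus>\<^bsub>Z\<^esub> \<rho> i (y i)) ?S"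
      proof (rule Z.M.finsum_cong'[OF refl])
        show "(\<lambda>i. \<rho> i (x i) \<oplus>\<^bsub>Z\<^esub> \<rho> i (y i)) \<in> ?S \<rightarrow> carrier Z"
          using term_closed[OF x] term_closed[OF y] by auto
        show "\<rho> i ((x \<oplus>\<^bsub>Ucp G\<^esub> y) i) = \<rho> i (x i) \<oplus>\<^bsub>Z\<^esub> \<rho> i (y i)" if "i \<in> ?S" for i
          using that \<rho>D(3) copower_mem(1)[OF x] copower_mem(1)[OF y] by auto
      qed
      also have "\<dots> = finsum Z (\<lambda>i. \<rho> i (x i)) ?S
          \<oplus>\<^bsub>Z\<^esub> finsum Z (\<lambda>i. \<rho> i (y i)) ?S"
        by (rule Z.M.finsum_addf) (use term_closed[OF x] term_closed[OF y] in auto)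
      finally show ?thesis using pairing[OF x S(1) _ S(2)] pairing[OF y S(1) _ S(2)] by simp
    qed
    show "copower_pairing G Z U \<rho> (bi_rsmult (Ucp G) x c) = copower_pairing G Z U \<rho> x \<cdot>\<^bsub>Z\<^esub> c"
      if x: "x \<in> carrier (Ucp G)" and c: "c \<in> carrier C" for x c
    proof -
      let ?S = "{i \<in> G. x i \<noteq> \<zero>\<^bsub>U\<^esub>}"
      have supp: "{i \<in> G. (\<lambda>i\<in>G. bi_rsmult U (x i) c) i \<noteq> \<zero>\<^bsub>U\<^esub>} \<subseteq> ?S"
        using right.rsmult_zero_left[OF c] by auto
      have S: "?S \<subseteq> G" by blast
      have "copower_pairing G Z U \<rho> (\<lambda>i\<in>G. bi_rsmult U (x i) c)
          = finsum Z (\<lambda>i. \<rho> i ((\<lambda>i\<in>G. bi_rsmult U (x i) c) i)) ?S"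
        by (rule pairing[OF act_closed[OF x c] copower_mem(3)[OF x] supp S])
      also have "\<dots> = finsum Z (\<lambda>i. \<rho> i (x i) \<cdot>\<^bsub>Z\<^esub> c) ?S"
      proof (rule Z.M.finsum_cong'[OF refl])
        show "(\<lambda>i. \<rho> i (x i) \<cdot>\<^bsub>Z\<^esub> c) \<in> ?S \<rightarrow> carrier Z"
          using term_closed[OF x] c by auto
        show "\<rho> i ((\<lambda>i\<in>G. bi_rsmult U (x i) c) i) = \<rho> i (x i) \<cdot>\<^bsub>Z\<^esub> c" if "i \<in> ?S" for i
          using that \<rho>D(4) copower_mem(1)[OF x] c by auto
      qed
      also have "\<dots> = finsum Z (\<lambda>i. \<rho> i (x i)) ?S \<cdot>\<^bsub>Z\<^esub> c"
        by (rule scal[OF copower_mem(3)[OF x] _ c]) (use term_closed[OF x] in auto)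
      finally show ?thesis using act pairing[OF x copower_mem(3)[OF x] order_refl S] by simp
    qed
  qed
qed

text \<open>The witness is the diagonal map of the \<open>g\<close> from
  \<open>biend_dual_power\<close>: applying \<open>h\<close> composes every component with this
  \<open>g\<close>, so the two sums agree term by term.\<close>

lemma copower_pairing_adjoint:
  assumes flat: "flat_module TYPE('r set) R U" and sep: "separating R Ud G"
    and h: "h \<in> carrier (right_biend R (dual_power G))"
  shows "\<exists>g\<in>carrier (left_biend R (Ucp G)). \<forall>\<rho>\<in>carrier (dual_power G).
    copower_pairing G Z U (h \<rho>) = adjoint C Z (Ucp G) g (copower_pairing G Z U \<rho>)"
proof -
  obtain g where g: "g \<in> carrier (left_biend R U)"
    "\<And>w i. w \<in> carrier (dual_power G) \<Longrightarrow> i \<in> G \<Longrightarrow> h w i = compose (carrier U) (w i) g"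
    using biend_dual_power[OF flat sep h] by blast
  show ?thesis
  proof (intro bexI ballI)
    show D: "diagonal_map G U g \<in> carrier (left_biend R (Ucp G))" by (rule diagonal_map_biend[OF g(1)])
    fix \<rho> assume \<rho>: "\<rho> \<in> carrier (dual_power G)"
    note DD = commuting_mapsD[OF D[unfolded biend_sel]]
    have cmZ: "comm_monoid (add_monoid Z)" by (rule Z.M.a_comm_monoid)
    have "copower_pairing G Z U (h \<rho>) = compose (carrier (Ucp G)) (copower_pairing G Z U \<rho>) (diagonal_map G U g)"
    proof (rule extensionalityI[of _ "carrier (Ucp G)"])
      fix x assume x: "x \<in> carrier (Ucp G)"
      have Dx: "diagonal_map G U g x = (\<lambda>i\<in>G. g (x i))"
        using x by (simp only: diagonal_map_def restrict_apply if_True)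
      have eq: "h \<rho> i (x i) = \<rho> i (diagonal_map G U g x i)" if "i \<in> G" for i
        using g(2)[OF \<rho> that] copower_mem(1)[OF x that] that by (simp add: Dx compose_def)
      have "gfinprod (add_monoid Z) (\<lambda>i. h \<rho> i (x i)) G
          = gfinprod (add_monoid Z) (\<lambda>i. \<rho> i (diagonal_map G U g x i)) G"
      proof (rule comm_monoid.gfinprod_cong[OF cmZ refl])
        show "(\<lambda>i. h \<rho> i (x i)) \<in> G \<rightarrow> carrier (add_monoid Z)"
          using eq dualD(1)[OF power_memD(1)[OF \<rho>, unfolded dual_sel]] copower_mem(1)[OF DD(1)[OF x]] by auto
      qed (use eq in \<open>simp add: simp_implies_def\<close>)
      then show "copower_pairing G Z U (h \<rho>) x
        = compose (carrier (Ucp G)) (copower_pairing G Z U \<rho>) (diagonal_map G U g) x"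
        unfolding copower_pairing_def compose_def restrict_apply'[OF x] restrict_apply'[OF DD(1)[OF x]] .
    qed (simp_all add: copower_pairing_def compose_def del: copower_module_sel)
    then show "copower_pairing G Z U (h \<rho>) = adjoint C Z (Ucp G) (diagonal_map G U g) (copower_pairing G Z U \<rho>)"
      using copower_pairing_dual[OF \<rho>] by (simp only: adjoint_def restrict_apply if_True)
  qed
qed

text \<open>Here \<open>h\<close> acts on the dual, and \<open>t\<close> is obtained by applying it
  to each coordinate of \<open>w\<close>. Finiteness of \<open>G\<close> makes \<open>w\<close> a
  finite sum of one-coordinate families, for each of which compatibility with \<psi> comes from an
  endomorphism of the dual.\<close>

lemma finite_separating_biend:
  assumes flat: "flat_module TYPE('r set) R U" and G: "finite G" "separating R Ud G"
  shows "carrier (right_biend R Ud) \<subseteq> adjoint C Z U ` carrier (left_biend R U)"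
proof
  fix h assume h: "h \<in> carrier (right_biend R Ud)"
  note hD = commuting_mapsD[OF h[unfolded biend_sel]]
  let ?W = "dual_power G" and ?w = "\<lambda>\<rho>\<in>G. \<rho>" and ?t = "\<lambda>\<rho>\<in>G. h \<rho>"
  interpret W: right_module R ?W by (rule dual_power_module)
  note w = separating_family[OF G(2)]
  have GU: "\<rho> \<in> carrier Ud" if "\<rho> \<in> G" for \<rho>
    using G(2) that by (auto simp: separating_def simp del: dual_sel)
  have t: "?t \<in> carrier ?W" using hD(1) GU by (auto simp del: dual_sel)
  have h0: "h \<zero>\<^bsub>Ud\<^esub> = \<zero>\<^bsub>Ud\<^esub>"
    by (rule commuting_maps_zero[OF dual.M.abelian_group_axioms h[unfolded biend_sel]])
  have pull: "h (\<psi> ?w) = \<psi> ?t" if \<psi>: "\<psi> \<in> right_hom R ?W Ud" for \<psi>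
  proof -
    note \<psi>D = right_homD[OF \<psi>]
    define cut where "cut v F = (\<lambda>\<rho>\<in>G. if \<rho> \<in> F then v \<rho> else \<zero>\<^bsub>Ud\<^esub>)" for v F
    have cut_closed: "cut v F \<in> carrier ?W" if "v \<in> carrier ?W" for v F
      using power_memD(1)[OF that] by (auto simp: cut_def simp del: dual_sel)
    have "h (\<psi> (cut ?w F)) = \<psi> (cut ?t F)" if "finite F" "F \<subseteq> G" for F
      using that
    proof (induction rule: finite_induct)
      case empty
      have cut0: "cut v {} = \<zero>\<^bsub>?W\<^esub>" for v by (simp add: cut_def del: dual_sel)
      show ?case
        unfolding cut0 right_hom_zero[OF dual_power_module dual.right_module_axioms \<psi>] by (rule h0)
    next
      case (insert \<rho> F)
      then have \<rho>: "\<rho> \<in> G" "\<rho> \<notin> F" and IH: "h (\<psi> (cut ?w F)) = \<psi> (cut ?t F)" by blast+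
      let ?s = "single_dual G \<rho>"
      have s: "?s \<sigma> \<in> carrier ?W" if "\<sigma> \<in> carrier Ud" for \<sigma>
        by (rule single_power_closed[OF dual.right_module_axioms that])
      have split: "cut v (insert \<rho> F) = cut v F \<oplus>\<^bsub>?W\<^esub> ?s (v \<rho>)" if v: "v \<in> carrier ?W" for v
        using \<rho> power_memD(1)[OF v] by (auto simp: cut_def single_def simp del: dual_sel intro!: restrict_ext)
      \<comment> \<open>\<psi> restricted to one coordinate is an endomorphism of the dual, so
        \<open>h\<close> commutes with it.\<close>
      have "(\<lambda>\<sigma>\<in>carrier Ud. \<psi> (?s \<sigma>)) \<in> right_hom R Ud Ud"
        using right_hom_compose[OF right_hom_single[OF dual.right_module_axioms \<rho>(1)] \<psi>]
          dual.M.a_closed dual.rsmult_closed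
        by (simp add: compose_def del: dual_sel cong: restrict_cong)
      from hD(4)[OF this GU[OF \<rho>(1)]] have e1: "h (\<psi> (?s \<rho>)) = \<psi> (?s (h \<rho>))"
        using GU[OF \<rho>(1)] hD(1) by (simp del: dual_sel)
      have e2: "\<psi> (cut ?w (insert \<rho> F)) = \<psi> (cut ?w F) \<oplus>\<^bsub>Ud\<^esub> \<psi> (?s \<rho>)"
        unfolding split[OF w(1)] using \<psi>D(3)[OF cut_closed[OF w(1)] s[OF GU]] \<rho> by (simp del: dual_sel power_module_sel)
      have e3: "\<psi> (cut ?t (insert \<rho> F)) = \<psi> (cut ?t F) \<oplus>\<^bsub>Ud\<^esub> \<psi> (?s (h \<rho>))"
        unfolding split[OF t] using \<psi>D(3)[OF cut_closed[OF t] s[OF hD(1)[OF GU]]] \<rho> by (simp del: dual_sel power_module_sel)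
      note e4 = hD(3)[OF \<psi>D(1)[OF cut_closed[OF w(1)]] \<psi>D(1)[OF s[OF GU[OF \<rho>(1)]]]]
      show ?case by (simp only: e1 e2 e3 e4 IH)
    qed
    from this[OF G(1) order_refl] have "h (\<psi> (cut ?w G)) = \<psi> (cut ?t G)" .
    moreover have "cut ?w G = ?w" "cut ?t G = ?t" by (auto simp: cut_def intro!: restrict_ext)
    ultimately show ?thesis by simp
  qed
  obtain g where g: "g \<in> carrier (left_biend R U)"
    "\<And>\<sigma>. \<sigma> \<in> carrier Ud \<Longrightarrow> h \<sigma> = compose (carrier U) \<sigma> g"
    by (rule biend_of_compatible_map[OF flat dual_power_module w(1) t w(2), of h]) (use pull in blast)+
  have "h = adjoint C Z U g"
    by (rule extensionalityI[OF hD(2)]) (use g(2) in \<open>simp_all add: adjoint_def del: dual_sel\<close>)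
  then show "h \<in> adjoint C Z U ` carrier (left_biend R U)" using g(1) by blast
qed

text \<open>For the empty set the separating condition is vacuous at \<open>r = 1\<close>, so
  \<open>R\<close> is the zero ring. This supplies the degenerate case of
  \<open>diagonal_map_iso\<close>.\<close>

lemma separating_empty_zero:
  assumes "separating R Ud {}" shows "carrier U = {\<zero>\<^bsub>U\<^esub>}"
proof -
  have "\<one>\<^bsub>R\<^esub> = \<zero>\<^bsub>R\<^esub>" using assms by (simp add: separating_def)
  then have "u = \<zero>\<^bsub>U\<^esub>" if "u \<in> carrier U" for u
    using U.lsmult_one[OF that] U.lsmult_zero_left[OF that] by simp
  then show ?thesis by auto
qed

end

theorem theorem3p1:
  fixes R :: "'r ring" and C :: "'c ring"
    and U :: "('r, 'c, 'u) bimodule" and Z :: "('c, 'z) rmodule"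
  assumes "ring R" and "ring C"
    and "is_bimodule R C U"
    and "faithful_left R U"
    and "injective_module TYPE('c set) C Z"
    and "cogenerator TYPE('c set) C Z"
  shows
    "(torsionless R U \<and> trace_accessible R U \<longrightarrow>
        adjoint C Z U ` carrier (left_biend R U) \<subseteq> carrier (right_biend R (dual C Z U)))
     \<and>
     (flat_module TYPE('r set) R U \<longrightarrow>
        (\<forall>G. separating R (dual C Z U) G \<longrightarrow>
           (\<forall>h\<in>carrier (right_biend R (power_module G (dual C Z U))).
              \<exists>g\<in>carrier (left_biend R (copower_module G U)).
                \<forall>\<rho>\<in>carrier (power_module G (dual C Z U)).
                  copower_pairing G Z U (h \<rho>) =
                    adjoint C Z (copower_module G U) g (copower_pairing G Z U \<rho>))
           \<and> diagonal_map G U \<in> ring_iso (left_biend R U) (left_biend R (copower_module G U))))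
     \<and>
     (flat_module TYPE('r set) R U \<longrightarrow>
        (\<exists>G. finite G \<and> separating R (dual C Z U) G) \<longrightarrow>
        carrier (right_biend R (dual C Z U)) \<subseteq> adjoint C Z U ` carrier (left_biend R U))
     \<and>
     (right_artinian R \<longrightarrow> (\<exists>G. finite G \<and> separating R (dual C Z U) G))"
proof -
  interpret bimodule_dual R C U Z
    by (intro bimodule_dual.intro bimodule.intro bimodule_dual_axioms.intro assms)
  have "diagonal_map G U \<in> ring_iso (left_biend R U) (left_biend R (copower_module G U))"
    if "separating R (dual C Z U) G" for G
    by (rule diagonal_map_iso) (use separating_empty_zero that in blast)
  then show ?thesis
    using adjoint_biend copower_pairing_adjoint finite_separating_biend finite_separating[OF assms(4)]
    by (intro conjI impI allI ballI image_subsetI) blast+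
qed

end
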